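(* Let $T>0$, $\gamma\in\mathbb R\setminus\{0\}$, $I=(0,+\infty)$, $y\in I$, and let $L:I\to\mathbb R$ satisfy the standing assumptions (monotonicity and Feller condition) of the context. Let $(Y_t)_{t\in[0,T]}$ be the solution of $dY_t=L(Y_t)dt+\gamma dW_t$, $Y_0=y$, and let $(\overline Y^n_t)_{t\in[0,T]}$ be its interpolated drift implicit Euler scheme with $n$ steps (see context). Let $p>1$ and assume: (i) $\mathbb{E}\Big[\Big(\int_0^T\big| L'(Y_u)L(Y_u)+\frac{\gamma^2}{2}L''(Y_u)\big| du \Big)^p\Big] < \infty$ and $\mathbb{E}\Big[\Big(\int_0^T (L'(Y_u))^2 du \Big)^{p/2}\Big]< \infty$; (ii) $L$ is $\mathcal C^2$ on $I$, and there exist $A>0$ and $L'_A>0$ such that $L$ is decreasing on $(0,A)$ and $|L'(x)|\le L'_A$ for all $x\in(A,\infty)$. Then there exists a constant $K_p>0$, not depending on $n$, such that for every integer $n\ge 1$ with $L'_A<\frac{n}{2T}$, $$\mathbb{E}^{\frac 1p}\Big[\sup_{t \in [0,T]} \big| \overline{Y}^n_t - Y_t \big|^p \Big] \leq K_p \frac{T}{n}.$$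
   Context: $(W_t)_{t\ge 0}$ is a standard one-dimensional Brownian motion; $\mathbb E^{1/p}[Z]$ means $(\mathbb E[Z])^{1/p}$. Standing assumptions on $L$. Monotonicity: $L:I\to\mathbb R$ is $\mathcal C^2$ and there is $\kappa>0$ such that $L(x')-L(x)\le\kappa(x'-x)$ for all $x\le x'$ in $I$. Feller condition: for an arbitrary $d\in I$, the function $v(x)=\int_d^x\int_d^r\exp\big(-\frac{2}{\gamma^2}\int_z^rL(\xi)d\xi\big)dz\,dr$ satisfies $\lim_{x\to0^+}v(x)=+\infty$. Under these two conditions the SDE $dY_t=L(Y_t)dt+\gamma dW_t$, $Y_0=y\in I$, has a unique strong solution with values in $I$, which never reaches $0$ or $+\infty$. Drift implicit scheme. Let $t_i=\frac{iT}{n}$, $0\le i\le n$. Set $\overline Y^n_0=y$ and, for $0\le i\le n-1$, let $\overline Y^n_{t_{i+1}}$ be the unique element of $I$ solving $\overline{Y}^n_{t_{i+1}}=\overline{Y}^n_{t_{i}}+L(\overline{Y}^n_{t_{i+1}})\frac Tn+\gamma (W_{t_{i+1}}-W_{t_i})$ (well defined when $\kappa T/n<1$; under (ii) one may take $\kappa=L'_A$). The interpolated drift implicit scheme is, for $t\in[t_i,t_{i+1}[$, $$\overline{Y}^n_t=\overline{Y}^n_{t_{i}}+L(\overline{Y}^n_{t_{i+1}})(t-t_{i})+\gamma(W_t-W_{t_{i}}).$$ *)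

theory Defs
  imports "HOL-Probability.Probability"
begin

(* Only meant for exponents r > 0, so that \<top> is mapped to \<top>. *)
definition ennreal_powr :: "ennreal \<Rightarrow> real \<Rightarrow> ennreal" where
  "ennreal_powr x r = (if x = \<top> then \<top> else ennreal (enn2real x powr r))"

(* Processes are indexed by all reals, but only their values at times t >= 0 matter. *)
locale standard_brownian_motion = prob_space M for M :: "'a measure" +
  fixes W :: "real \<Rightarrow> 'a \<Rightarrow> real"
  assumes W_measurable: "\<And>t. 0 \<le> t \<Longrightarrow> W t \<in> borel_measurable M"
    and W_zero: "AE \<omega> in M. W 0 \<omega> = 0"
    and W_continuous: "AE \<omega> in M. continuous_on {0..} (\<lambda>t. W t \<omega>)"
    and W_increments: "\<And>s t. 0 \<le> s \<Longrightarrow> s < t \<Longrightarrow>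
          distributed M lborel (\<lambda>\<omega>. W t \<omega> - W s \<omega>) (normal_density 0 (sqrt (t - s)))"
    and W_indep: "\<And>(\<tau> :: nat \<Rightarrow> real) m. 0 \<le> \<tau> 0 \<Longrightarrow> (\<And>i. i < m \<Longrightarrow> \<tau> i < \<tau> (Suc i)) \<Longrightarrow>
          indep_vars (\<lambda>_. borel) (\<lambda>i \<omega>. W (\<tau> (Suc i)) \<omega> - W (\<tau> i) \<omega>) {..<m}"

(* The filtration of W augmented by the null sets of the completion of M. *)
definition augmented_filtration ::
    "'a measure \<Rightarrow> (real \<Rightarrow> 'a \<Rightarrow> real) \<Rightarrow> real \<Rightarrow> 'a measure" where
  "augmented_filtration M W t =
     sigma (space M)
       ({W s -` B \<inter> space M | s B. 0 \<le> s \<and> s \<le> t \<and> B \<in> sets borel} \<union> null_sets (completion M))"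

(* Strong solution on [0,T], with values in (0,\<infinity>), of dY = L(Y) dt + \<gamma> dW, Y_0 = y.  The noise is
   additive, so the stochastic integral of the constant \<gamma> over [0,t] is \<gamma> (W_t - W_0). *)
definition strong_solution ::
    "'a measure \<Rightarrow> (real \<Rightarrow> 'a \<Rightarrow> real) \<Rightarrow> (real \<Rightarrow> real) \<Rightarrow> real \<Rightarrow> real \<Rightarrow> real
      \<Rightarrow> (real \<Rightarrow> 'a \<Rightarrow> real) \<Rightarrow> bool" where
  "strong_solution M W L \<gamma> y T Y \<longleftrightarrow>
     (\<forall>t\<in>{0..T}. Y t \<in> borel_measurable (augmented_filtration M W t)) \<and>
     (AE \<omega> in M. continuous_on {0..T} (\<lambda>t. Y t \<omega>) \<and>
        (\<forall>t\<in>{0..T}. Y t \<omega> > 0 \<and>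
           Y t \<omega> = y + (LBINT s=0..t. L (Y s \<omega>)) + \<gamma> * (W t \<omega> - W 0 \<omega>)))"

definition C2_on :: "real set \<Rightarrow> (real \<Rightarrow> real) \<Rightarrow> bool" where
  "C2_on S f \<longleftrightarrow>
     (\<forall>x\<in>S. f differentiable (at x)) \<and> (\<forall>x\<in>S. deriv f differentiable (at x)) \<and>
     continuous_on S (deriv (deriv f))"

definition feller_v :: "(real \<Rightarrow> real) \<Rightarrow> real \<Rightarrow> real \<Rightarrow> real \<Rightarrow> real" where
  "feller_v L \<gamma> d x =
     (LBINT r=d..x. (LBINT z=d..r. exp (- (2 / \<gamma>\<^sup>2) * (LBINT \<xi>=z..r. L \<xi>))))"

(* Grid values of the drift implicit scheme with n steps, driven by the path w.  The description is
   proper only when the implicit equation has exactly one positive solution. *)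
primrec implicit_grid ::
    "(real \<Rightarrow> real) \<Rightarrow> real \<Rightarrow> real \<Rightarrow> real \<Rightarrow> nat \<Rightarrow> (real \<Rightarrow> real) \<Rightarrow> nat \<Rightarrow> real" where
  "implicit_grid L \<gamma> y T n w 0 = y"
| "implicit_grid L \<gamma> y T n w (Suc i) =
     (THE z. z > 0 \<and>
        z = implicit_grid L \<gamma> y T n w i + L z * (T / real n)
            + \<gamma> * (w (real (Suc i) * T / real n) - w (real i * T / real n)))"

(* The index i is the one with t_i \<le> t < t_{i+1}.  For t = T it is n, both increments vanish,
   and the value is the last grid value. *)
definition implicit_scheme ::
    "(real \<Rightarrow> real) \<Rightarrow> real \<Rightarrow> real \<Rightarrow> real \<Rightarrow> nat \<Rightarrow> (real \<Rightarrow> real) \<Rightarrow> real \<Rightarrow> real" where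
  "implicit_scheme L \<gamma> y T n w t =
     (let i = nat \<lfloor>t * real n / T\<rfloor>; t\<^sub>i = real i * T / real n in
        implicit_grid L \<gamma> y T n w i + L (implicit_grid L \<gamma> y T n w (Suc i)) * (t - t\<^sub>i)
        + \<gamma> * (w t - w t\<^sub>i))"

end

(* The error e of the scheme at the grid times satisfies e_{i+1} - h (L(Ybar_{i+1}) - L(Y_{i+1})) =
   e_i + r_i with r_i the integral of L(Y_{t_{i+1}}) - L(Y_u) over the i-th cell.  By the one-sided
   Lipschitz bound this recursion is stable.  Writing L(Y_t) = drift + N_t with N a local martingale,
   r_i is, up to h times the variation of the drift, h times the integral of (u - t_i) / h against dN,
   so that a Burkholder inequality for N and for this weighted integral gives order one.

   There is no stochastic integral: along the grids with n 2^j points almost every path satisfies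
   Ito's formula pathwise, hence the two martingales are almost sure limits of discrete transforms of
   Gaussian increments.  For such transforms x with bracket q a polynomial supermartingale bounds
   E x^(2J) by E q^J.  Stopping gives P(max |x| > t) <= C E min(q / t^2, 1)^J, a bound which is stable
   under almost sure limits, and integrating it against p t^(p-1) dt yields the p-th moment bound. *)
theory Submission
  imports Defs
begin

section \<open>Transforms of Gaussian increments\<close>

text \<open>The energy, i.e. the time integral of the squared derivative of \<open>L\<close> along
  \<open>Y\<close>, has a moment of order \<open>p / 2\<close>, while the supermartingale argument
  produces integer powers \<open>J > p / 2\<close>, and the Riemann sums approximating the energy
  need have no integrable majorant. Truncation at 1 settles both points: the expectation of
  \<open>min (q / t^2) 1 ^ J\<close> is always finite, dominated convergence applies on the side of
  the bracket and Fatou's lemma on the side of the maximum, and integration in \<open>t\<close>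
  gives back \<open>q powr (p / 2)\<close>. Likewise, stopping makes the unbounded integrand, the
  derivative of \<open>L\<close> at \<open>Y\<close>, accessible to estimates for bounded ones. Two
  martingales occur because errors at the grid times accumulate over all cells and have to carry the
  factor \<open>h\<close> in total, which the weighted martingale provides; inside a single cell the
  time integral supplies \<open>h\<close>, and the crude bound by the supremum of \<open>|N|\<close>
  is enough. The solution is adapted to a filtration containing the null sets of the completion, so
  the probabilistic arguments take place on \<open>completion M\<close>.\<close>

text \<open>Convexity of even powers. The linear term has mean zero when \<open>g\<close> is a
  centred increment independent of the past, so this bounds expectations from below.\<close>

lemma even_power_tangent_le:
  fixes x g :: real
  shows "x ^ (2 * k) + real (2 * k) * x ^ (2 * k - 1) * g \<le> (x + g) ^ (2 * k)"
proof -
  have "((\<lambda>x. x ^ (2 * k)) has_field_derivative (real (2 * k) * x ^ (2 * k - 1))) (at x within UNIV)"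
    using DERIV_pow[of "2 * k" x UNIV] by simp
  from convex_on_imp_above_tangent[OF convex_power_even[of "2 * k"] _ _ _ this, of "x + g"]
  show ?thesis by simp
qed

lemma abs_add_power_le:
  fixes a b :: real
  shows "\<bar>a + b\<bar> ^ m \<le> 2 ^ m * (\<bar>a\<bar> ^ m + \<bar>b\<bar> ^ m)"
proof -
  have "\<bar>a + b\<bar> ^ m \<le> (2 * max \<bar>a\<bar> \<bar>b\<bar>) ^ m"
    by (intro power_mono) auto
  also have "\<dots> = 2 ^ m * max \<bar>a\<bar> \<bar>b\<bar> ^ m" by (simp add: power_mult_distrib)
  also have "\<dots> \<le> 2 ^ m * (\<bar>a\<bar> ^ m + \<bar>b\<bar> ^ m)"
    by (intro mult_left_mono) (auto simp: max_def)
  finally show ?thesis .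
qed

text \<open>Second order Taylor expansion, the intermediate point being bounded by
  \<open>|x| + |g|\<close>. The first order term is kept exactly because it disappears in
  expectation; the factor 1/2 of the remainder is given away.\<close>

lemma even_power_add_le:
  fixes x g :: real and r :: nat
  defines "n \<equiv> Suc r"
  defines "C \<equiv> real (2 * n) * real (2 * n - 1) * 2 ^ (2 * r)"
  shows "(x + g) ^ (2 * n) \<le> x ^ (2 * n) + real (2 * n) * x ^ (2 * n - 1) * g
     + C * (x ^ (2 * r) * g\<^sup>2 + g ^ (2 * n))"
proof (cases "g = 0")
  case False
  define D where "D = (\<lambda>m::nat. \<lambda>z::real.
    if m = 0 then z ^ (2 * n) else if m = 1 then real (2 * n) * z ^ (2 * n - 1)
    else real (2 * n) * real (2 * n - 1) * z ^ (2 * r))"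
  have D: "\<forall>m t. m < 2 \<and> min x (x + g) \<le> t \<and> t \<le> max x (x + g) \<longrightarrow> DERIV (D m) t :> D (Suc m) t"
  proof (intro allI impI)
    fix m :: nat and t assume "m < 2 \<and> min x (x + g) \<le> t \<and> t \<le> max x (x + g)"
    then consider "m = 0" | "m = 1" by linarith
    moreover have "DERIV (D 0) t :> D (Suc 0) t"
      using DERIV_pow[of "2 * n" t UNIV] by (simp add: D_def)
    moreover have "DERIV (D 1) t :> D (Suc 1) t"
      using DERIV_cmult[OF DERIV_pow[of "2 * n - 1" t UNIV], of "real (2 * n)"]
      by (simp add: D_def n_def mult.assoc)
    ultimately show "DERIV (D m) t :> D (Suc m) t" by cases simp_all
  qed
  obtain t where t: "(if x + g < x then x + g < t \<and> t < x else x < t \<and> t < x + g)"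
    and eq: "(x + g) ^ (2 * n) = (\<Sum>m<2. D m x / fact m * (x + g - x) ^ m) + D 2 t / fact 2 * (x + g - x)^2"
    using Taylor[of 2 D "\<lambda>z. z ^ (2 * n)" "min x (x+g)" "max x (x+g)" x "x+g"] D False
    by (auto simp: D_def)
  have "\<bar>t\<bar> \<le> \<bar>x\<bar> + \<bar>g\<bar>" using t by (auto split: if_splits)
  then have "\<bar>t\<bar> ^ (2 * r) \<le> \<bar>\<bar>x\<bar> + \<bar>g\<bar>\<bar> ^ (2 * r)" by (intro power_mono) auto
  also have "\<dots> \<le> 2 ^ (2 * r) * (\<bar>x\<bar> ^ (2 * r) + \<bar>g\<bar> ^ (2 * r))"
    using abs_add_power_le[of "\<bar>x\<bar>" "\<bar>g\<bar>" "2 * r"] by simp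
  finally have tp: "t ^ (2 * r) \<le> 2 ^ (2 * r) * (x ^ (2 * r) + g ^ (2 * r))"
    by (simp add: power_even_abs)
  have "(x + g) ^ (2 * n) = x ^ (2 * n) + real (2 * n) * x ^ (2 * n - 1) * g
     + real (2 * n) * real (2 * n - 1) / 2 * t ^ (2 * r) * g\<^sup>2"
    unfolding eq by (simp add: D_def numeral_2_eq_2)
  also have "real (2 * n) * real (2 * n - 1) / 2 * t ^ (2 * r) * g\<^sup>2 \<le>
     real (2 * n) * real (2 * n - 1) / 2 * (2 ^ (2 * r) * (x ^ (2 * r) + g ^ (2 * r))) * g\<^sup>2"
    by (intro mult_right_mono mult_left_mono tp) auto
  also have "\<dots> = C / 2 * (x ^ (2 * r) * g\<^sup>2 + g ^ (2 * n))"
  proof -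
    have "g ^ (2 * n) = g ^ (2 * r) * g\<^sup>2" by (simp add: n_def power2_eq_square)
    then show ?thesis unfolding C_def by (simp only: distrib_left distrib_right mult_ac times_divide_eq_right)
        (simp add: mult_ac flip: add_divide_distrib)
  qed
  also have "\<dots> \<le> C * (x ^ (2 * r) * g\<^sup>2 + g ^ (2 * n))"
    by (intro mult_right_mono) (auto simp: C_def)
  finally show ?thesis by simp
qed (auto simp: C_def n_def)

text \<open>Young's inequality by cases: if \<open>2 * C * t <= x^2\<close>, the left side is at
  most half of the leading power; otherwise \<open>x^2\<close> is dominated by a multiple of
  \<open>t\<close>. The coefficient 1/2 permits a later absorption.\<close>

lemma young_even_power:
  fixes x t C :: real
  assumes "t \<ge> 0" "C \<ge> 0"
  shows "C * (x ^ (2 * r) * t) \<le> x ^ (2 * Suc r) / 2 + 2 ^ r * C ^ Suc r * t ^ Suc r"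
proof -
  define z where "z = x\<^sup>2"
  have z: "z \<ge> 0" "x ^ (2 * r) = z ^ r" "x ^ (2 * Suc r) = z ^ Suc r"
    unfolding z_def by (simp_all only: power_mult[symmetric]) auto
  show ?thesis
  proof (cases "2 * C * t \<le> z")
    case True
    have "C * (x ^ (2 * r) * t) = z ^ r * (C * t)" using z by simp
    also have "\<dots> \<le> z ^ r * (z / 2)" using True z by (intro mult_left_mono) auto
    also have "\<dots> = x ^ (2 * Suc r) / 2" by (simp only: z) simp
    finally show ?thesis using assms by (intro order_trans[OF _ le_add_same_cancel1[THEN iffD2]]) auto
  next
    case False
    have "C * (x ^ (2 * r) * t) = z ^ r * (C * t)" using z by simp
    also have "\<dots> \<le> (2 * C * t) ^ r * (C * t)"
      using False z assms by (intro mult_right_mono power_mono) auto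
    also have "\<dots> = 2 ^ r * C ^ Suc r * t ^ Suc r" by (simp add: power_mult_distrib algebra_simps)
    finally show ?thesis using zero_le_power[OF z(1), of "Suc r"] unfolding z by linarith
  qed
qed

text \<open>The moment of order \<open>2 * k\<close> of the standard normal law, that is, the double
  factorial of 2k - 1.\<close>

definition gaussian_moment :: "nat \<Rightarrow> real" where
  "gaussian_moment k = fact (2 * k) / (2 ^ k * fact k)"

text \<open>The inner \<open>C\<close> is the Taylor constant of \<open>even_power_add_le\<close>,
  enlarged to cover the Gaussian moment as well. The outer factor 2 comes from absorbing half of the
  leading moment, and the final 1 pays for the event that the bracket exceeds the level.\<close>

definition weak_const :: "nat \<Rightarrow> real" where
  "weak_const r = (let C = real (2 * Suc r) * real (2 * Suc r - 1) * 2 ^ (2 * r) * max 1 (gaussian_moment (Suc r))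
     in 2 * (2 ^ r * C ^ Suc r + C) + 1)"

lemma weak_const_ge_1: "1 \<le> weak_const r"
  by (auto simp: weak_const_def Let_def)

text \<open>A discrete time frame with independent steps of variance \<open>\<delta>\<close>.
  Independence of the past is required for every real variable \<open>U\<close> known at time
  \<open>l\<close>, which is the form in which expectations of products are factored.\<close>

locale gaussian_increments = prob_space M for M :: "'a measure" +
  fixes F :: "nat \<Rightarrow> 'a measure" and \<xi> :: "nat \<Rightarrow> 'a \<Rightarrow> real" and \<delta> :: real
  assumes subalg: "\<And>l. subalgebra M (F l)"
    and F_mono: "\<And>l. sets (F l) \<subseteq> sets (F (Suc l))"
    and \<delta>_pos: "\<delta> > 0"
    and \<xi>_measurable_F: "\<And>l. \<xi> l \<in> borel_measurable (F (Suc l))"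
    and \<xi>_distributed: "\<And>l. distributed M lborel (\<xi> l) (normal_density 0 (sqrt \<delta>))"
    and \<xi>_indep: "\<And>l U. U \<in> borel_measurable (F l) \<Longrightarrow> indep_var borel U borel (\<xi> l)"
begin

lemma space_F [simp]: "space (F l) = space M"
  using subalg[of l] by (auto simp: subalgebra_def)

lemma measurable_F_M: "f \<in> borel_measurable (F l) \<Longrightarrow> f \<in> borel_measurable M"
  using measurable_from_subalg[OF subalg] .

lemma sets_F_le: "k \<le> l \<Longrightarrow> sets (F k) \<subseteq> sets (F l)"
  by (induction l rule: dec_induct) (use F_mono in auto)

lemma measurable_F_mono: "k \<le> l \<Longrightarrow> f \<in> borel_measurable (F k) \<Longrightarrow> f \<in> borel_measurable (F l)"
  using sets_F_le by (auto simp: measurable_def)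

lemma \<xi>_borel_measurable [measurable]: "\<xi> l \<in> borel_measurable M"
  using \<xi>_measurable_F measurable_F_M by blast

lemma
  shows integrable_\<xi>_power: "integrable M (\<lambda>\<omega>. \<xi> l \<omega> ^ k)"
    and expectation_\<xi>: "expectation (\<xi> l) = 0"
    and expectation_\<xi>_even: "expectation (\<lambda>\<omega>. \<xi> l \<omega> ^ (2 * j)) = gaussian_moment j * \<delta> ^ j"
proof -
  have s: "sqrt \<delta> > 0" using \<delta>_pos by simp
  have nd: "\<And>x. 0 \<le> normal_density 0 (sqrt \<delta>) x" by simp
  have 1: "integrable lborel (\<lambda>x. normal_density 0 (sqrt \<delta>) x * x ^ k)"
  proof (cases "even k")
    case True
    then obtain m where "k = 2 * m" by (elim evenE)
    then show ?thesis using normal_moment_even[OF s, of 0 m] by (auto dest: integrable.intros)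
  next
    case False
    then obtain m where "k = 2 * m + 1" by (elim oddE)
    then show ?thesis using normal_moment_odd[OF s, of 0 m] by (auto dest: integrable.intros)
  qed
  show "integrable M (\<lambda>\<omega>. \<xi> l \<omega> ^ k)"
    using 1 distributed_integrable[OF \<xi>_distributed[of l] , of "\<lambda>x. x ^ k"] by simp
  have "expectation (\<lambda>\<omega>. \<xi> l \<omega> ^ 1) = 0"
    using distributed_integral[OF \<xi>_distributed[of l], of "\<lambda>x. x ^ 1"]
      integral_normal_moment_odd[OF s, of 0 0] by simp
  then show "expectation (\<xi> l) = 0" by simp
  show "expectation (\<lambda>\<omega>. \<xi> l \<omega> ^ (2 * j)) = gaussian_moment j * \<delta> ^ j"
    using distributed_integral[OF \<xi>_distributed[of l], of "\<lambda>x. x ^ (2 * j)"]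
      integral_normal_moment_even[OF s, of 0 j] \<delta>_pos
    by (simp add: gaussian_moment_def power_divide)
qed

lemma
  fixes U :: "'a \<Rightarrow> real" and f :: "real \<Rightarrow> real"
  assumes U: "U \<in> borel_measurable (F l)" and i: "integrable M U"
    and f: "f \<in> borel_measurable borel" "integrable M (\<lambda>\<omega>. f (\<xi> l \<omega>))"
  shows integrable_mult_\<xi>: "integrable M (\<lambda>\<omega>. U \<omega> * f (\<xi> l \<omega>))"
    and expectation_mult_\<xi>: "expectation (\<lambda>\<omega>. U \<omega> * f (\<xi> l \<omega>)) = expectation U * expectation (\<lambda>\<omega>. f (\<xi> l \<omega>))"
proof -
  have "indep_var borel (id \<circ> U) borel (f \<circ> \<xi> l)"
    by (rule indep_var_compose[OF \<xi>_indep[OF U]]) (use f in auto)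
  then have "indep_var borel U borel (\<lambda>\<omega>. f (\<xi> l \<omega>))" by (simp add: comp_def)
  then show "integrable M (\<lambda>\<omega>. U \<omega> * f (\<xi> l \<omega>))"
    and "expectation (\<lambda>\<omega>. U \<omega> * f (\<xi> l \<omega>)) = expectation U * expectation (\<lambda>\<omega>. f (\<xi> l \<omega>))"
    using indep_var_integrable indep_var_lebesgue_integral i f by blast+
qed

lemma integrable_bounded_mult:
  fixes f g :: "'a \<Rightarrow> real"
  assumes "f \<in> borel_measurable M" "\<And>\<omega>. \<bar>f \<omega>\<bar> \<le> c" "integrable M g"
  shows "integrable M (\<lambda>\<omega>. f \<omega> * g \<omega>)"
proof (rule Bochner_Integration.integrable_bound)
  show "integrable M (\<lambda>\<omega>. c * g \<omega>)" using assms by auto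
  show "AE \<omega> in M. norm (f \<omega> * g \<omega>) \<le> norm (c * g \<omega>)"
  proof (rule AE_I2)
    fix \<omega> have "\<bar>f \<omega>\<bar> \<le> \<bar>c\<bar>" using assms(2)[of \<omega>] by linarith
    then show "norm (f \<omega> * g \<omega>) \<le> norm (c * g \<omega>)" by (simp add: abs_mult mult_right_mono)
  qed
qed (use assms in auto)

definition transform :: "(nat \<Rightarrow> 'a \<Rightarrow> real) \<Rightarrow> nat \<Rightarrow> 'a \<Rightarrow> real" where
  "transform H k \<omega> = (\<Sum>l<k. H l \<omega> * \<xi> l \<omega>)"

text \<open>The predictable bracket: each squared increment is replaced by its mean
  \<open>\<delta>\<close>, so that the value after a step is known before the step.\<close>

definition bracket :: "(nat \<Rightarrow> 'a \<Rightarrow> real) \<Rightarrow> nat \<Rightarrow> 'a \<Rightarrow> real" where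
  "bracket H k \<omega> = (\<Sum>l<k. (H l \<omega>)\<^sup>2 * \<delta>)"

lemma transform_measurable:
  assumes "\<And>l. H l \<in> borel_measurable (F l)"
  shows "transform H k \<in> borel_measurable (F k)"
  unfolding transform_def[abs_def]
proof (rule borel_measurable_sum)
  fix l assume "l \<in> {..<k}"
  then have "Suc l \<le> k" "l \<le> k" by auto
  then show "(\<lambda>\<omega>. H l \<omega> * \<xi> l \<omega>) \<in> borel_measurable (F k)"
    using measurable_F_mono[OF _ assms] measurable_F_mono[OF _ \<xi>_measurable_F] by auto
qed

text \<open>The bound \<open>Suc m\<close> instead of \<open>m\<close> expresses predictability, on
  which the stopping rule relies.\<close>

lemma bracket_measurable:
  assumes "\<And>l. H l \<in> borel_measurable (F l)" "k \<le> Suc m"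
  shows "bracket H k \<in> borel_measurable (F m)"
  unfolding bracket_def[abs_def]
proof (rule borel_measurable_sum)
  fix l assume "l \<in> {..<k}"
  then have "l \<le> m" using assms(2) by auto
  then have "H l \<in> borel_measurable (F m)"
    using measurable_F_mono[OF _ assms(1)] by auto
  then show "(\<lambda>\<omega>. (H l \<omega>)\<^sup>2 * \<delta>) \<in> borel_measurable (F m)" by simp
qed

lemma bracket_nonneg: "0 \<le> bracket H k \<omega>"
  unfolding bracket_def using \<delta>_pos by (intro sum_nonneg) auto

lemma bracket_mono: "k \<le> m \<Longrightarrow> bracket H k \<omega> \<le> bracket H m \<omega>"
  unfolding bracket_def using \<delta>_pos by (intro sum_mono2) auto

section \<open>Even moments of transforms with bounded integrands\<close>

context
  fixes H :: "nat \<Rightarrow> 'a \<Rightarrow> real" and B :: real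
  assumes H_meas: "\<And>l. H l \<in> borel_measurable (F l)" and H_bounded: "\<And>l \<omega>. \<bar>H l \<omega>\<bar> \<le> B"
begin

lemma abs_power_bound: "\<bar>H l \<omega> ^ m\<bar> \<le> B ^ m"
  using H_bounded[of l \<omega>] by (simp add: power_abs power_mono)

text \<open>Induction on the number of steps: in the binomial expansion of the new power every term
  is a quantity from the past times a power of an independent Gaussian variable.\<close>

lemma integrable_transform_power: "integrable M (\<lambda>\<omega>. transform H k \<omega> ^ r)"
proof (induction k arbitrary: r)
  case 0
  show ?case by (simp add: transform_def)
next
  case (Suc k)
  have "integrable M (\<lambda>\<omega>. \<Sum>i\<le>r. real (r choose i) * (H k \<omega> ^ (r - i) * transform H k \<omega> ^ i * \<xi> k \<omega> ^ (r - i)))"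
  proof (intro Bochner_Integration.integrable_sum integrable_mult_right integrable_mult_\<xi>)
    fix i
    show "(\<lambda>\<omega>. H k \<omega> ^ (r - i) * transform H k \<omega> ^ i) \<in> borel_measurable (F k)"
      using H_meas[of k] transform_measurable[OF H_meas, of k] by simp
    show "integrable M (\<lambda>\<omega>. H k \<omega> ^ (r - i) * transform H k \<omega> ^ i)"
      by (rule integrable_bounded_mult[OF _ abs_power_bound Suc]) (use measurable_F_M[OF H_meas] in simp)
    show "integrable M (\<lambda>\<omega>. \<xi> k \<omega> ^ (r - i))" by (rule integrable_\<xi>_power)
  qed auto
  also have "(\<lambda>\<omega>. \<Sum>i\<le>r. real (r choose i) * (H k \<omega> ^ (r - i) * transform H k \<omega> ^ i * \<xi> k \<omega> ^ (r - i)))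
      = (\<lambda>\<omega>. transform H (Suc k) \<omega> ^ r)"
  proof
    fix \<omega>
    have "transform H (Suc k) \<omega> = transform H k \<omega> + H k \<omega> * \<xi> k \<omega>" by (simp add: transform_def)
    then show "(\<Sum>i\<le>r. real (r choose i) * (H k \<omega> ^ (r - i) * transform H k \<omega> ^ i * \<xi> k \<omega> ^ (r - i)))
      = transform H (Suc k) \<omega> ^ r"
      by (simp add: binomial_ring power_mult_distrib mult_ac)
  qed
  finally show ?case .
qed

lemma bracket_bounded: "\<bar>bracket H k \<omega>\<bar> \<le> real k * (B\<^sup>2 * \<delta>)"
proof -
  have "bracket H k \<omega> \<le> (\<Sum>l<k. B\<^sup>2 * \<delta>)"
    unfolding bracket_def using \<delta>_pos abs_power_bound[of _ \<omega> 2] by (intro sum_mono mult_right_mono) auto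
  then show ?thesis using bracket_nonneg[of H k \<omega>] by simp
qed

lemma integrable_transform_bracket: "integrable M (\<lambda>\<omega>. bracket H i \<omega> ^ m * transform H k \<omega> ^ r)"
proof (rule integrable_bounded_mult[OF _ _ integrable_transform_power])
  show "(\<lambda>\<omega>. bracket H i \<omega> ^ m) \<in> borel_measurable M"
    using measurable_F_M[OF bracket_measurable[OF H_meas, of i i]] by simp
  show "\<bar>bracket H i \<omega> ^ m\<bar> \<le> (real i * (B\<^sup>2 * \<delta>)) ^ m" for \<omega>
    using bracket_bounded[of i \<omega>] by (simp add: power_abs power_mono)
qed

text \<open>With \<open>x\<close> the transform and \<open>q\<close> its bracket, the induction shows that
  \<open>x ^ (2 * J) - C * (q * x ^ (2 * r) + q ^ J)\<close> is a supermartingale.\<close>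

lemma expectation_transform_power_le:
  fixes r :: nat
  defines "J \<equiv> Suc r"
  defines "K \<equiv> real (2 * J) * real (2 * J - 1) * 2 ^ (2 * r)"
  defines "C \<equiv> K * max 1 (gaussian_moment J)"
  shows "expectation (\<lambda>\<omega>. transform H k \<omega> ^ (2 * J))
    \<le> C * expectation (\<lambda>\<omega>. bracket H k \<omega> * transform H k \<omega> ^ (2 * r))
      + C * expectation (\<lambda>\<omega>. bracket H k \<omega> ^ J)"
proof (induction k)
  case 0
  show ?case by (simp add: transform_def bracket_def J_def)
next
  case (Suc k)
  define X where "X = transform H k"
  define Q where "Q = bracket H k"
  define s where "s = (\<lambda>\<omega>. (H k \<omega>)\<^sup>2 * \<delta>)"
  define g where "g = (\<lambda>\<omega>. H k \<omega> * \<xi> k \<omega>)"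
  have X': "transform H (Suc k) \<omega> = X \<omega> + g \<omega>" and Q': "bracket H (Suc k) \<omega> = Q \<omega> + s \<omega>" for \<omega>
    by (simp_all add: X_def Q_def s_def g_def transform_def bracket_def)
  \<comment> \<open>\<open>C\<close> has to dominate both coefficients of the Taylor step:
    \<open>K\<close> for the mixed term and \<open>K * gaussian_moment J\<close> for the pure power
    of the increment.\<close>
  have KC: "K \<le> C" "K * gaussian_moment J \<le> C" "0 \<le> C" "0 \<le> K"
    unfolding C_def K_def by (auto intro!: mult_left_mono)
  note HF = H_meas[of k]
  have XF: "X \<in> borel_measurable (F k)" unfolding X_def by (rule transform_measurable[OF H_meas])
  have QF: "Q \<in> borel_measurable (F k)" unfolding Q_def by (rule bracket_measurable[OF H_meas]) simp
  have [measurable]: "X \<in> borel_measurable M" "Q \<in> borel_measurable M" "H k \<in> borel_measurable M"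
    using XF QF HF measurable_F_M by blast+
  have Q0: "0 \<le> Q \<omega>" "\<bar>Q \<omega>\<bar> \<le> real k * (B\<^sup>2 * \<delta>)" for \<omega>
    unfolding Q_def by (rule bracket_nonneg, rule bracket_bounded)
  have s0: "0 \<le> s \<omega>" "\<bar>s \<omega>\<bar> \<le> B\<^sup>2 * \<delta>" for \<omega>
    unfolding s_def using \<delta>_pos abs_power_bound[of k \<omega> 2] by (auto intro!: mult_right_mono)
  have Qs: "\<bar>Q \<omega> + s \<omega>\<bar> \<le> real k * (B\<^sup>2 * \<delta>) + B\<^sup>2 * \<delta>" for \<omega>
    using Q0[of \<omega>] s0[of \<omega>] by linarith
  have iX: "integrable M (\<lambda>\<omega>. X \<omega> ^ m)" for m unfolding X_def by (rule integrable_transform_power)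
  have iHX: "integrable M (\<lambda>\<omega>. H k \<omega> ^ i * X \<omega> ^ m)" for i m
    by (rule integrable_bounded_mult[OF _ abs_power_bound iX]) simp
  have iQX: "integrable M (\<lambda>\<omega>. Q \<omega> * X \<omega> ^ m)" for m
    by (rule integrable_bounded_mult[OF _ Q0(2) iX]) simp
  have isX: "integrable M (\<lambda>\<omega>. s \<omega> * X \<omega> ^ m)" for m
    by (rule integrable_bounded_mult[OF _ s0(2) iX]) (simp add: s_def)
  have iQHX: "integrable M (\<lambda>\<omega>. (Q \<omega> + s \<omega>) * (H k \<omega> * X \<omega> ^ m))" for m
    by (rule integrable_bounded_mult[OF _ Qs]) (use iHX[of 1 m] in \<open>simp_all add: s_def\<close>)
  have ibd: "integrable M f" if "f \<in> borel_measurable M" "\<And>\<omega>. \<bar>f \<omega>\<bar> \<le> c" for f :: "'a \<Rightarrow> real" and c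
    using integrable_bounded_mult[OF that, of "\<lambda>_. 1"] by simp
  have iQ: "integrable M (\<lambda>\<omega>. Q \<omega> ^ J)"
    by (rule ibd[of _ "(real k * (B\<^sup>2 * \<delta>)) ^ J"]) (use Q0 in \<open>auto simp: power_abs intro!: power_mono\<close>)
  have is_: "integrable M (\<lambda>\<omega>. s \<omega> ^ J)"
    by (rule ibd[of _ "(B\<^sup>2 * \<delta>) ^ J"]) (use s0 in \<open>auto simp: power_abs s_def intro!: power_mono\<close>)
  have iQsJ: "integrable M (\<lambda>\<omega>. (Q \<omega> + s \<omega>) ^ J)"
    by (rule ibd[of _ "(real k * (B\<^sup>2 * \<delta>) + B\<^sup>2 * \<delta>) ^ J"])
      (use Qs in \<open>auto simp: power_abs s_def intro!: power_mono\<close>)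

  have g1: "integrable M (\<lambda>\<omega>. X \<omega> ^ m * g \<omega>)" "expectation (\<lambda>\<omega>. X \<omega> ^ m * g \<omega>) = 0" for m
  proof -
    have m: "(\<lambda>\<omega>. H k \<omega> * X \<omega> ^ m) \<in> borel_measurable (F k)" using HF XF by simp
    have i: "integrable M (\<lambda>\<omega>. H k \<omega> * X \<omega> ^ m)" using iHX[of 1 m] by simp
    from integrable_mult_\<xi>[OF m i, of "\<lambda>x. x"] expectation_mult_\<xi>[OF m i, of "\<lambda>x. x"]
      integrable_\<xi>_power[of k 1] expectation_\<xi>[of k]
    show "integrable M (\<lambda>\<omega>. X \<omega> ^ m * g \<omega>)" "expectation (\<lambda>\<omega>. X \<omega> ^ m * g \<omega>) = 0"
      by (simp_all add: g_def mult_ac)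
  qed
  \<comment> \<open>The weight \<open>Q + s\<close> is the bracket after the step, yet it is known
    before the step; hence the first order term still has mean zero.\<close>
  have g2: "integrable M (\<lambda>\<omega>. (Q \<omega> + s \<omega>) * X \<omega> ^ m * g \<omega>)"
    "expectation (\<lambda>\<omega>. (Q \<omega> + s \<omega>) * X \<omega> ^ m * g \<omega>) = 0" for m
  proof -
    have m: "(\<lambda>\<omega>. (Q \<omega> + s \<omega>) * (H k \<omega> * X \<omega> ^ m)) \<in> borel_measurable (F k)"
      using HF XF QF by (simp add: s_def)
    from integrable_mult_\<xi>[OF m iQHX, of "\<lambda>x. x"] expectation_mult_\<xi>[OF m iQHX, of "\<lambda>x. x"]
      integrable_\<xi>_power[of k 1] expectation_\<xi>[of k]
    show "integrable M (\<lambda>\<omega>. (Q \<omega> + s \<omega>) * X \<omega> ^ m * g \<omega>)"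
      "expectation (\<lambda>\<omega>. (Q \<omega> + s \<omega>) * X \<omega> ^ m * g \<omega>) = 0"
      by (simp_all add: g_def mult_ac)
  qed
  have g3: "integrable M (\<lambda>\<omega>. X \<omega> ^ m * g \<omega> ^ (2 * i))"
    "expectation (\<lambda>\<omega>. X \<omega> ^ m * g \<omega> ^ (2 * i)) = gaussian_moment i * expectation (\<lambda>\<omega>. X \<omega> ^ m * s \<omega> ^ i)" for m i
  proof -
    have m: "(\<lambda>\<omega>. H k \<omega> ^ (2 * i) * X \<omega> ^ m) \<in> borel_measurable (F k)" using HF XF by simp
    note a = integrable_mult_\<xi>[OF m iHX, of "\<lambda>x. x ^ (2 * i)"] expectation_mult_\<xi>[OF m iHX, of "\<lambda>x. x ^ (2 * i)"]
      integrable_\<xi>_power[of k "2 * i"] expectation_\<xi>_even[of k i]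
    from a(1,3) show "integrable M (\<lambda>\<omega>. X \<omega> ^ m * g \<omega> ^ (2 * i))"
      by (simp add: g_def power_mult_distrib mult_ac)
    have "expectation (\<lambda>\<omega>. X \<omega> ^ m * g \<omega> ^ (2 * i))
      = gaussian_moment i * expectation (\<lambda>\<omega>. \<delta> ^ i * (H k \<omega> ^ (2 * i) * X \<omega> ^ m))"
      using a(2-4) by (simp add: g_def power_mult_distrib mult_ac)
    also have "(\<lambda>\<omega>. \<delta> ^ i * (H k \<omega> ^ (2 * i) * X \<omega> ^ m)) = (\<lambda>\<omega>. X \<omega> ^ m * s \<omega> ^ i)"
      by (rule ext) (simp add: s_def power_mult_distrib power_mult[symmetric] mult_ac)
    finally show "expectation (\<lambda>\<omega>. X \<omega> ^ m * g \<omega> ^ (2 * i))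
      = gaussian_moment i * expectation (\<lambda>\<omega>. X \<omega> ^ m * s \<omega> ^ i)" .
  qed
  have gm1: "gaussian_moment 1 = 1" by (simp add: gaussian_moment_def fact_numeral)
  have upper: "expectation (\<lambda>\<omega>. (X \<omega> + g \<omega>) ^ (2 * J)) \<le> expectation (\<lambda>\<omega>. X \<omega> ^ (2 * J))
      + K * expectation (\<lambda>\<omega>. s \<omega> * X \<omega> ^ (2 * r)) + K * gaussian_moment J * expectation (\<lambda>\<omega>. s \<omega> ^ J)"
  proof -
    have "expectation (\<lambda>\<omega>. (X \<omega> + g \<omega>) ^ (2 * J)) \<le> expectation (\<lambda>\<omega>. X \<omega> ^ (2 * J)
       + real (2 * J) * (X \<omega> ^ (2 * J - 1) * g \<omega>)
       + (K * (X \<omega> ^ (2 * r) * g \<omega> ^ (2 * 1)) + K * (X \<omega> ^ 0 * g \<omega> ^ (2 * J))))"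
    proof (rule integral_mono)
      show "integrable M (\<lambda>\<omega>. (X \<omega> + g \<omega>) ^ (2 * J))"
        using integrable_transform_power[of "Suc k" "2 * J"] by (simp add: X')
      show "integrable M (\<lambda>\<omega>. X \<omega> ^ (2 * J) + real (2 * J) * (X \<omega> ^ (2 * J - 1) * g \<omega>)
       + (K * (X \<omega> ^ (2 * r) * g \<omega> ^ (2 * 1)) + K * (X \<omega> ^ 0 * g \<omega> ^ (2 * J))))"
        by (intro Bochner_Integration.integrable_add integrable_mult_right iX g1(1) g3(1))
      show "(X \<omega> + g \<omega>) ^ (2 * J) \<le> X \<omega> ^ (2 * J) + real (2 * J) * (X \<omega> ^ (2 * J - 1) * g \<omega>)
       + (K * (X \<omega> ^ (2 * r) * g \<omega> ^ (2 * 1)) + K * (X \<omega> ^ 0 * g \<omega> ^ (2 * J)))" for \<omega>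
        using even_power_add_le[of "X \<omega>" "g \<omega>" r, folded J_def, folded K_def]
        by (simp add: distrib_left mult_ac)
    qed
    also have "\<dots> = expectation (\<lambda>\<omega>. X \<omega> ^ (2 * J))
      + K * expectation (\<lambda>\<omega>. s \<omega> * X \<omega> ^ (2 * r)) + K * gaussian_moment J * expectation (\<lambda>\<omega>. s \<omega> ^ J)"
      using g1(1)[of "2 * J - 1"] g3(1)[of "2 * r" 1] g3(1)[of 0 J]
      unfolding Bochner_Integration.integral_add[OF Bochner_Integration.integrable_add[OF iX integrable_mult_right[OF g1(1)]]
        Bochner_Integration.integrable_add[OF integrable_mult_right[OF g3(1)] integrable_mult_right[OF g3(1)]]]
        Bochner_Integration.integral_add[OF iX integrable_mult_right[OF g1(1)]]
        Bochner_Integration.integral_add[OF integrable_mult_right[OF g3(1)] integrable_mult_right[OF g3(1)]]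
        integral_mult_right_zero g1(2) g3(2) gm1
      by (simp add: mult_ac)
    finally show ?thesis .
  qed
  have lower: "expectation (\<lambda>\<omega>. Q \<omega> * X \<omega> ^ (2 * r)) + expectation (\<lambda>\<omega>. s \<omega> * X \<omega> ^ (2 * r))
    \<le> expectation (\<lambda>\<omega>. (Q \<omega> + s \<omega>) * (X \<omega> + g \<omega>) ^ (2 * r))"
  proof -
    have "expectation (\<lambda>\<omega>. Q \<omega> * X \<omega> ^ (2 * r)) + expectation (\<lambda>\<omega>. s \<omega> * X \<omega> ^ (2 * r))
      = expectation (\<lambda>\<omega>. Q \<omega> * X \<omega> ^ (2 * r) + s \<omega> * X \<omega> ^ (2 * r)
        + real (2 * r) * ((Q \<omega> + s \<omega>) * X \<omega> ^ (2 * r - 1) * g \<omega>))"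
      unfolding Bochner_Integration.integral_add[OF Bochner_Integration.integrable_add[OF iQX isX] integrable_mult_right[OF g2(1)]]
        Bochner_Integration.integral_add[OF iQX isX] integral_mult_right_zero g2(2) by simp
    also have "\<dots> \<le> expectation (\<lambda>\<omega>. (Q \<omega> + s \<omega>) * (X \<omega> + g \<omega>) ^ (2 * r))"
    proof (rule integral_mono)
      show "integrable M (\<lambda>\<omega>. Q \<omega> * X \<omega> ^ (2 * r) + s \<omega> * X \<omega> ^ (2 * r)
        + real (2 * r) * ((Q \<omega> + s \<omega>) * X \<omega> ^ (2 * r - 1) * g \<omega>))"
        by (intro Bochner_Integration.integrable_add integrable_mult_right iQX isX g2(1))
      show "integrable M (\<lambda>\<omega>. (Q \<omega> + s \<omega>) * (X \<omega> + g \<omega>) ^ (2 * r))"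
        using integrable_transform_bracket[of "Suc k" 1 "Suc k" "2 * r"] by (simp add: X' Q')
      show "Q \<omega> * X \<omega> ^ (2 * r) + s \<omega> * X \<omega> ^ (2 * r)
        + real (2 * r) * ((Q \<omega> + s \<omega>) * X \<omega> ^ (2 * r - 1) * g \<omega>) \<le> (Q \<omega> + s \<omega>) * (X \<omega> + g \<omega>) ^ (2 * r)" for \<omega>
        using mult_left_mono[OF even_power_tangent_le[of "X \<omega>" r "g \<omega>"], of "Q \<omega> + s \<omega>"] Q0[of \<omega>] s0[of \<omega>]
        by (simp add: algebra_simps)
    qed
    finally show ?thesis .
  qed
  \<comment> \<open>Superadditivity of the \<open>J\<close>-th power on nonnegative numbers: the
    second compensator grows by at least the expectation of \<open>s ^ J\<close>.\<close>
  have powers: "expectation (\<lambda>\<omega>. Q \<omega> ^ J) + expectation (\<lambda>\<omega>. s \<omega> ^ J) \<le> expectation (\<lambda>\<omega>. (Q \<omega> + s \<omega>) ^ J)"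
  proof -
    have pw: "a ^ J + b ^ J \<le> (a + b) ^ J" if "0 \<le> a" "0 \<le> b" for a b :: real
    proof -
      have "a ^ r * a + b ^ r * b \<le> (a + b) ^ r * a + (a + b) ^ r * b"
        using that by (intro add_mono mult_right_mono power_mono) auto
      then show ?thesis by (simp add: J_def algebra_simps)
    qed
    show ?thesis
      unfolding Bochner_Integration.integral_add[OF iQ is_, symmetric]
      by (rule integral_mono[OF Bochner_Integration.integrable_add[OF iQ is_] iQsJ]) (use pw Q0 s0 in auto)
  qed
  have nn: "0 \<le> expectation (\<lambda>\<omega>. s \<omega> * X \<omega> ^ (2 * r))" "0 \<le> expectation (\<lambda>\<omega>. s \<omega> ^ J)"
    using s0 by (auto intro!: integral_nonneg_AE)
  \<comment> \<open>The Taylor step creates the terms \<open>s * X ^ (2 * r)\<close> and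
    \<open>s ^ J\<close>. Precisely these are supplied by the growth of the two compensators, the
    first one through the tangent inequality.\<close>
  have "expectation (\<lambda>\<omega>. (X \<omega> + g \<omega>) ^ (2 * J)) \<le> C * expectation (\<lambda>\<omega>. Q \<omega> * X \<omega> ^ (2 * r))
     + C * expectation (\<lambda>\<omega>. Q \<omega> ^ J) + C * expectation (\<lambda>\<omega>. s \<omega> * X \<omega> ^ (2 * r)) + C * expectation (\<lambda>\<omega>. s \<omega> ^ J)"
    using upper Suc[folded X_def Q_def] mult_right_mono[OF KC(1) nn(1)] mult_right_mono[OF KC(2) nn(2)]
    by linarith
  also have "\<dots> \<le> C * expectation (\<lambda>\<omega>. (Q \<omega> + s \<omega>) * (X \<omega> + g \<omega>) ^ (2 * r)) + C * expectation (\<lambda>\<omega>. (Q \<omega> + s \<omega>) ^ J)"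
    using mult_left_mono[OF lower KC(3)] mult_left_mono[OF powers KC(3)] by (simp add: algebra_simps)
  finally show ?case by (simp add: X' Q')
qed

text \<open>Young's inequality turns the mixed term into half of the left side plus a power of the
  bracket. The half can be moved to the left because all moments are finite.\<close>

lemma expectation_transform_power_le_bracket:
  fixes r :: nat
  defines "J \<equiv> Suc r"
  defines "C \<equiv> real (2 * J) * real (2 * J - 1) * 2 ^ (2 * r) * max 1 (gaussian_moment J)"
  shows "expectation (\<lambda>\<omega>. transform H k \<omega> ^ (2 * J))
    \<le> 2 * (2 ^ r * C ^ J + C) * expectation (\<lambda>\<omega>. bracket H k \<omega> ^ J)"
proof -
  have C0: "0 \<le> C" unfolding C_def by auto
  have i1: "integrable M (\<lambda>\<omega>. bracket H k \<omega> * transform H k \<omega> ^ (2 * r))"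
    using integrable_transform_bracket[of k 1 k "2 * r"] by simp
  have i2: "integrable M (\<lambda>\<omega>. bracket H k \<omega> ^ J)"
    using integrable_transform_bracket[of k J k 0] by simp
  have i3: "integrable M (\<lambda>\<omega>. transform H k \<omega> ^ (2 * J))"
    by (rule integrable_transform_power)
  have "C * expectation (\<lambda>\<omega>. bracket H k \<omega> * transform H k \<omega> ^ (2 * r))
    = expectation (\<lambda>\<omega>. C * (bracket H k \<omega> * transform H k \<omega> ^ (2 * r)))" by simp
  also have "\<dots> \<le> expectation (\<lambda>\<omega>. transform H k \<omega> ^ (2 * J) / 2 + 2 ^ r * C ^ J * bracket H k \<omega> ^ J)"
  proof (rule integral_mono)
    show "C * (bracket H k \<omega> * transform H k \<omega> ^ (2 * r))
      \<le> transform H k \<omega> ^ (2 * J) / 2 + 2 ^ r * C ^ J * bracket H k \<omega> ^ J" for \<omega>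
      using young_even_power[where t="bracket H k \<omega>" and x="transform H k \<omega>" and C=C and r=r, OF bracket_nonneg C0]
      unfolding J_def
      by (simp add: mult_ac)
  qed (use i1 i2 i3 in auto)
  also have "\<dots> = expectation (\<lambda>\<omega>. transform H k \<omega> ^ (2 * J)) / 2 + 2 ^ r * C ^ J * expectation (\<lambda>\<omega>. bracket H k \<omega> ^ J)"
    using i2 i3 by simp
  finally show ?thesis
    using expectation_transform_power_le[of k r, folded J_def, folded C_def] by (simp add: algebra_simps)
qed

end

lemma integral_indicator_le_minorant:
  assumes A: "A \<in> sets M" and f: "integrable M f" "\<And>\<omega>. 0 \<le> f \<omega>" "\<And>\<omega>. \<omega> \<in> A \<Longrightarrow> 1 \<le> f \<omega>"
  shows "prob A \<le> expectation f"
proof -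
  have "integrable M (indicator A :: _ \<Rightarrow> real)"
    by (rule integrable_const_bound[of _ 1]) (use A in auto)
  moreover have "prob A = expectation (indicator A)" using A by simp
  moreover have "expectation (indicator A) \<le> expectation f"
    if "integrable M (indicator A :: _ \<Rightarrow> real)"
    by (rule integral_mono[OF that]) (use assms in \<open>auto split: split_indicator\<close>)
  ultimately show ?thesis by simp
qed

text \<open>The integrand is stopped before the bracket exceeds \<open>lam\<^sup>2\<close>, which is possible because the
  bracket is predictable, and as soon as the transform exceeds \<open>lam\<close>; the stopped transform has
  exceeded \<open>lam\<close> at the final time if it ever did, so no maximal inequality is needed.\<close>

lemma weak_type_transform:
  fixes H :: "nat \<Rightarrow> 'a \<Rightarrow> real" and lam :: real
  assumes H: "\<And>l. H l \<in> borel_measurable (F l)" and lam: "lam > 0"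
  shows "prob {\<omega>\<in>space M. \<exists>k\<le>N. lam < \<bar>transform H k \<omega>\<bar>}
    \<le> weak_const r * expectation (\<lambda>\<omega>. (min (bracket H N \<omega> / lam\<^sup>2) 1) ^ Suc r)"
proof -
  define J where "J = Suc r"
  define good where "good = (\<lambda>l \<omega>. bracket H (Suc l) \<omega> \<le> lam\<^sup>2 \<and> (\<forall>k\<le>l. \<bar>transform H k \<omega>\<bar> \<le> lam))"
  define G where "G = (\<lambda>l \<omega>. if good l \<omega> then H l \<omega> else 0)"
  have good_mono: "good l \<omega> \<Longrightarrow> k \<le> l \<Longrightarrow> good k \<omega>" for k l \<omega>
    using bracket_mono[of "Suc k" "Suc l" H \<omega>] by (auto simp: good_def)
  have good_set: "{\<omega>\<in>space (F l). good l \<omega>} \<in> sets (F l)" for l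
  proof -
    have [measurable]: "bracket H (Suc l) \<in> borel_measurable (F l)" by (rule bracket_measurable[OF H]) simp
    have tr: "transform H k \<in> borel_measurable (F l)" if "k \<le> l" for k
      using measurable_F_mono[OF that transform_measurable[OF H]] .
    have "{\<omega>\<in>space (F l). good l \<omega>} = {\<omega>\<in>space (F l). bracket H (Suc l) \<omega> \<le> lam\<^sup>2} \<inter>
      (\<Inter>k\<in>{..l}. {\<omega>\<in>space (F l). \<bar>transform H k \<omega>\<bar> \<le> lam})"
      by (auto simp: good_def)
    also have "\<dots> \<in> sets (F l)"
    proof (intro sets.Int sets.finite_INT)
      show "{\<omega>\<in>space (F l). bracket H (Suc l) \<omega> \<le> lam\<^sup>2} \<in> sets (F l)" by measurable
      fix k assume "k \<in> {..l}"
      then have [measurable]: "transform H k \<in> borel_measurable (F l)" by (auto intro: tr)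
      show "{\<omega>\<in>space (F l). \<bar>transform H k \<omega>\<bar> \<le> lam} \<in> sets (F l)" by measurable
    qed auto
    finally show ?thesis .
  qed
  have G: "G l \<in> borel_measurable (F l)" for l
    unfolding G_def using H[of l] good_set by (intro measurable_If) auto
  \<comment> \<open>An accepted step contributes at most \<open>lam^2\<close> to the bracket, so
    \<open>G\<close> is bounded even where \<open>H\<close> is not. This makes the moment estimates
    for bounded integrands applicable.\<close>
  have Gb: "\<bar>G l \<omega>\<bar> \<le> lam / sqrt \<delta>" for l \<omega>
  proof (cases "good l \<omega>")
    case True
    have "(H l \<omega>)\<^sup>2 * \<delta> \<le> bracket H (Suc l) \<omega>" using bracket_nonneg[of H l \<omega>] by (simp add: bracket_def)
    then have "(H l \<omega>)\<^sup>2 * \<delta> \<le> lam\<^sup>2" using True by (simp add: good_def)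
    then have "sqrt ((H l \<omega>)\<^sup>2 * \<delta>) \<le> sqrt (lam\<^sup>2)" by (rule real_sqrt_le_mono)
    then show ?thesis using True \<delta>_pos lam by (simp add: G_def real_sqrt_mult field_simps)
  qed (use \<delta>_pos lam in \<open>simp add: G_def\<close>)
  have [measurable]: "transform H k \<in> borel_measurable M" "bracket H k \<in> borel_measurable M"
    "transform G k \<in> borel_measurable M" "bracket G k \<in> borel_measurable M" for k
    using measurable_F_M[OF transform_measurable[OF H]] measurable_F_M[OF bracket_measurable[OF H, of k k]]
     measurable_F_M[OF transform_measurable[OF G]] measurable_F_M[OF bracket_measurable[OF G, of k k]] by simp_all
  define m where "m = (\<lambda>\<omega>. min (bracket H N \<omega> / lam\<^sup>2) 1)"
  have m0: "0 \<le> m \<omega>" "m \<omega> \<le> 1" for \<omega> using bracket_nonneg[of H N \<omega>] by (auto simp: m_def)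
  have im: "integrable M (\<lambda>\<omega>. m \<omega> ^ J)"
    by (rule integrable_const_bound[of _ 1]) (use m0 in \<open>auto simp: m_def power_le_one\<close>)
  have Gbr: "bracket G k \<omega> \<le> lam\<^sup>2 * m \<omega>" if "k \<le> N" for k \<omega>
  proof -
    have "bracket G k \<omega> \<le> bracket H k \<omega>"
      unfolding bracket_def G_def using \<delta>_pos by (intro sum_mono) auto
    also have "\<dots> \<le> bracket H N \<omega>" by (rule bracket_mono[OF that])
    finally have 1: "bracket G k \<omega> \<le> bracket H N \<omega>" .
    have "bracket G j \<omega> \<le> lam\<^sup>2" for j
    proof (induction j)
      case (Suc j)
      show ?case
      proof (cases "good j \<omega>")
        case True
        then have "bracket H (Suc j) \<omega> \<le> lam\<^sup>2" by (simp add: good_def)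
        moreover have "bracket G (Suc j) \<omega> \<le> bracket H (Suc j) \<omega>"
          unfolding bracket_def G_def using \<delta>_pos by (intro sum_mono) auto
        ultimately show ?thesis by simp
      qed (use Suc in \<open>simp add: bracket_def G_def\<close>)
    qed (simp add: bracket_def)
    with 1 show ?thesis using lam by (auto simp: m_def min_def field_simps)
  qed
  \<comment> \<open>As long as the bracket stays below the level, a step can be refused only because
    of the transform. Refusal then begins exactly at the first crossing time \<open>k\<close> and
    freezes the stopped transform there.\<close>
  have main: "lam < \<bar>transform G N \<omega>\<bar>" if Q: "bracket H N \<omega> \<le> lam\<^sup>2" and ex: "\<exists>k\<le>N. lam < \<bar>transform H k \<omega>\<bar>" for \<omega>
  proof -
    define k where "k = (LEAST k. lam < \<bar>transform H k \<omega>\<bar>)"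
    have k: "lam < \<bar>transform H k \<omega>\<bar>" "k \<le> N"
      unfolding k_def using ex by (auto intro: LeastI_ex order_trans[OF Least_le])
    have less: "\<bar>transform H l \<omega>\<bar> \<le> lam" if "l < k" for l
      using not_less_Least[OF that[unfolded k_def]] by simp
    have g1: "good l \<omega>" if "l < k" for l
      using less bracket_mono[of "Suc l" N H \<omega>] Q that k unfolding good_def by force
    have g2: "\<not> good l \<omega>" if "k \<le> l" for l
      using that k unfolding good_def by force
    have "transform G N \<omega> = (\<Sum>l<k. G l \<omega> * \<xi> l \<omega>)"
      unfolding transform_def by (rule sum.mono_neutral_right) (use k g2 in \<open>auto simp: G_def not_less\<close>)
    also have "\<dots> = transform H k \<omega>"
      unfolding transform_def by (rule sum.cong) (use g1 in \<open>auto simp: G_def\<close>)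
    finally show ?thesis using k by simp
  qed
  let ?A = "{\<omega>\<in>space M. \<exists>k\<le>N. lam < \<bar>transform H k \<omega>\<bar>}"
  have iG: "integrable M (\<lambda>\<omega>. transform G N \<omega> ^ (2 * J))"
    by (rule integrable_transform_power[OF G Gb])
  have iGb: "integrable M (\<lambda>\<omega>. bracket G N \<omega> ^ J)"
    using integrable_transform_bracket[OF G Gb, of N J N 0] by simp
  \<comment> \<open>Where the bracket is too large, \<open>m = 1\<close> alone dominates the
    indicator; elsewhere the Chebyshev term of the stopped transform does.\<close>
  have "prob ?A \<le> expectation (\<lambda>\<omega>. m \<omega> ^ J + transform G N \<omega> ^ (2 * J) / lam ^ (2 * J))"
  proof (rule integral_indicator_le_minorant)
    show "?A \<in> sets M" by measurable
    show "integrable M (\<lambda>\<omega>. m \<omega> ^ J + transform G N \<omega> ^ (2 * J) / lam ^ (2 * J))" using im iG by auto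
    show "0 \<le> m \<omega> ^ J + transform G N \<omega> ^ (2 * J) / lam ^ (2 * J)" for \<omega>
      using m0(1)[of \<omega>] lam by auto
    show "1 \<le> m \<omega> ^ J + transform G N \<omega> ^ (2 * J) / lam ^ (2 * J)" if "\<omega> \<in> ?A" for \<omega>
    proof (cases "bracket H N \<omega> \<le> lam\<^sup>2")
      case True
      then have "lam < \<bar>transform G N \<omega>\<bar>" using main that by auto
      then have "lam ^ (2 * J) \<le> \<bar>transform G N \<omega>\<bar> ^ (2 * J)" using lam by (intro power_mono) auto
      then have "1 \<le> transform G N \<omega> ^ (2 * J) / lam ^ (2 * J)" using lam by (simp add: power_even_abs)
      then show ?thesis using m0(1)[of \<omega>] zero_le_power[of "m \<omega>" J] by linarith
    next
      case False
      then have "m \<omega> = 1" using lam by (simp add: m_def)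
      then show ?thesis using lam by simp
    qed
  qed
  also have "\<dots> = expectation (\<lambda>\<omega>. m \<omega> ^ J) + expectation (\<lambda>\<omega>. transform G N \<omega> ^ (2 * J)) / lam ^ (2 * J)"
    using im iG by simp
  also have "\<dots> \<le> expectation (\<lambda>\<omega>. m \<omega> ^ J) + ((weak_const r - 1) * expectation (\<lambda>\<omega>. bracket G N \<omega> ^ J)) / lam ^ (2 * J)"
    using expectation_transform_power_le_bracket[OF G Gb, of N r] lam
    by (intro add_left_mono divide_right_mono) (auto simp: J_def weak_const_def Let_def)
  also have "\<dots> \<le> expectation (\<lambda>\<omega>. m \<omega> ^ J) + ((weak_const r - 1) * (lam ^ (2 * J) * expectation (\<lambda>\<omega>. m \<omega> ^ J))) / lam ^ (2 * J)"
  proof -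
    have "expectation (\<lambda>\<omega>. bracket G N \<omega> ^ J) \<le> expectation (\<lambda>\<omega>. lam ^ (2 * J) * m \<omega> ^ J)"
    proof (rule integral_mono[OF iGb])
      show "bracket G N \<omega> ^ J \<le> lam ^ (2 * J) * m \<omega> ^ J" for \<omega>
        using power_mono[OF Gbr[of N \<omega>] bracket_nonneg, of J] by (simp add: power_mult_distrib power_mult)
    qed (use im in auto)
    moreover have "0 \<le> weak_const r - 1" by (auto simp: weak_const_def Let_def)
    ultimately show ?thesis using lam by (intro add_left_mono divide_right_mono mult_left_mono) auto
  qed
  also have "\<dots> = weak_const r * expectation (\<lambda>\<omega>. m \<omega> ^ J)" using lam by (simp add: field_simps)
  finally show ?thesis by (simp add: m_def J_def)
qed

text \<open>Orthogonality: the squared increments minus \<open>\<delta>\<close> are centred and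
  independent of the past, so the cross terms vanish and second moments add up. With
  \<open>k\<close> of order \<open>1 / \<delta>\<close> the bound is of order
  \<open>\<delta>\<close>, hence summable along dyadic refinements.\<close>

lemma second_moment_square_sum_le:
  fixes U :: "nat \<Rightarrow> 'a \<Rightarrow> real"
  assumes U: "\<And>l. U l \<in> borel_measurable (F l)" and Ub: "\<And>l \<omega>. \<bar>U l \<omega>\<bar> \<le> B"
  defines "S \<equiv> \<lambda>k \<omega>. \<Sum>l<k. U l \<omega> * ((\<xi> l \<omega>)\<^sup>2 - \<delta>)"
  shows "integrable M (\<lambda>\<omega>. (S k \<omega>)\<^sup>2)" and "expectation (\<lambda>\<omega>. (S k \<omega>)\<^sup>2) \<le> real k * (B\<^sup>2 * (gaussian_moment 2 * \<delta>\<^sup>2))"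
proof -
  define \<eta> where "\<eta> = (\<lambda>x::real. x\<^sup>2 - \<delta>)"
  have \<eta>: "integrable M (\<lambda>\<omega>. \<eta> (\<xi> l \<omega>))" "expectation (\<lambda>\<omega>. \<eta> (\<xi> l \<omega>)) = 0"
    "integrable M (\<lambda>\<omega>. (\<eta> (\<xi> l \<omega>))\<^sup>2)" "expectation (\<lambda>\<omega>. (\<eta> (\<xi> l \<omega>))\<^sup>2) \<le> gaussian_moment 2 * \<delta>\<^sup>2" for l
  proof -
    have e: "(\<eta> (\<xi> l \<omega>))\<^sup>2 = \<xi> l \<omega> ^ 4 - 2 * \<delta> * \<xi> l \<omega> ^ 2 + \<delta>\<^sup>2" for \<omega>
      by (simp add: \<eta>_def power2_eq_square power4_eq_xxxx algebra_simps)
    have 2: "expectation (\<lambda>\<omega>. \<xi> l \<omega> ^ 2) = \<delta>"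
      using expectation_\<xi>_even[of l 1] by (simp add: gaussian_moment_def fact_numeral)
    have 4: "expectation (\<lambda>\<omega>. \<xi> l \<omega> ^ 4) = gaussian_moment 2 * \<delta>\<^sup>2"
      using expectation_\<xi>_even[of l 2] by simp
    show "integrable M (\<lambda>\<omega>. \<eta> (\<xi> l \<omega>))" "expectation (\<lambda>\<omega>. \<eta> (\<xi> l \<omega>)) = 0"
      "integrable M (\<lambda>\<omega>. (\<eta> (\<xi> l \<omega>))\<^sup>2)" unfolding e
      using integrable_\<xi>_power[of l 2] integrable_\<xi>_power[of l 4] 2 by (auto simp: \<eta>_def prob_space)
    show "expectation (\<lambda>\<omega>. (\<eta> (\<xi> l \<omega>))\<^sup>2) \<le> gaussian_moment 2 * \<delta>\<^sup>2" unfolding e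
      using integrable_\<xi>_power[of l 2] integrable_\<xi>_power[of l 4] 2 4 by (simp add: prob_space power2_eq_square)
  qed
  have \<eta>m [measurable]: "\<eta> \<in> borel_measurable borel" by (simp add: \<eta>_def)
  have SF: "S k \<in> borel_measurable (F k)" for k
    unfolding S_def
  proof (rule borel_measurable_sum)
    fix l assume "l \<in> {..<k}"
    then have "Suc l \<le> k" "l \<le> k" by auto
    then show "(\<lambda>\<omega>. U l \<omega> * ((\<xi> l \<omega>)\<^sup>2 - \<delta>)) \<in> borel_measurable (F k)"
      using measurable_F_mono[OF _ U] measurable_F_mono[OF _ \<xi>_measurable_F] by auto
  qed
  have [measurable]: "S k \<in> borel_measurable M" "U k \<in> borel_measurable M" for k
    using measurable_F_M SF U by blast+
  have "integrable M (\<lambda>\<omega>. (S k \<omega>)\<^sup>2) \<and> expectation (\<lambda>\<omega>. (S k \<omega>)\<^sup>2) \<le> real k * (B\<^sup>2 * (gaussian_moment 2 * \<delta>\<^sup>2))" for k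
  proof (induction k)
    case 0
    show ?case by (simp add: S_def)
  next
    case (Suc k)
    have iS: "integrable M (\<lambda>\<omega>. (S k \<omega>)\<^sup>2)" using Suc by simp
    then have iS1: "integrable M (S k)" by (rule square_integrable_imp_integrable[rotated]) simp
    have U2: "\<bar>(U k \<omega>)\<^sup>2\<bar> \<le> B\<^sup>2" for \<omega> using Ub[of k \<omega>] by (simp add: abs_le_square_iff[symmetric])
    have iU: "integrable M (\<lambda>\<omega>. (U k \<omega>)\<^sup>2)" by (rule integrable_const_bound[of _ "B\<^sup>2"]) (use U2 in auto)
    have iUS: "integrable M (\<lambda>\<omega>. U k \<omega> * S k \<omega>)"
      by (rule integrable_bounded_mult[OF _ Ub iS1]) simp
    note c = integrable_mult_\<xi>[OF _ iUS \<eta>m \<eta>(1)] expectation_mult_\<xi>[OF _ iUS \<eta>m \<eta>(1)]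
    have m1: "(\<lambda>\<omega>. U k \<omega> * S k \<omega>) \<in> borel_measurable (F k)" using U[of k] SF[of k] by simp
    have m2: "(\<lambda>\<omega>. (U k \<omega>)\<^sup>2) \<in> borel_measurable (F k)" using U[of k] by simp
    have \<eta>m2: "(\<lambda>x. (\<eta> x)\<^sup>2) \<in> borel_measurable borel" by simp
    note d = integrable_mult_\<xi>[OF m2 iU \<eta>m2 \<eta>(3)] expectation_mult_\<xi>[OF m2 iU \<eta>m2 \<eta>(3)]
    have eq: "(S (Suc k) \<omega>)\<^sup>2 = (S k \<omega>)\<^sup>2 + 2 * (U k \<omega> * S k \<omega> * \<eta> (\<xi> k \<omega>)) + (U k \<omega>)\<^sup>2 * (\<eta> (\<xi> k \<omega>))\<^sup>2" for \<omega>
      by (simp add: S_def \<eta>_def power2_sum power_mult_distrib)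
    have i: "integrable M (\<lambda>\<omega>. (S (Suc k) \<omega>)\<^sup>2)" unfolding eq using iS c(1)[OF m1] d(1) by auto
    have "expectation (\<lambda>\<omega>. (S (Suc k) \<omega>)\<^sup>2) = expectation (\<lambda>\<omega>. (S k \<omega>)\<^sup>2)
       + expectation (\<lambda>\<omega>. (U k \<omega>)\<^sup>2) * expectation (\<lambda>\<omega>. (\<eta> (\<xi> k \<omega>))\<^sup>2)"
      unfolding eq using iS c[OF m1] d \<eta>(2) by simp
    moreover have "expectation (\<lambda>\<omega>. (U k \<omega>)\<^sup>2) * expectation (\<lambda>\<omega>. (\<eta> (\<xi> k \<omega>))\<^sup>2) \<le> B\<^sup>2 * (gaussian_moment 2 * \<delta>\<^sup>2)"
    proof (rule mult_mono)
      have "expectation (\<lambda>\<omega>. (U k \<omega>)\<^sup>2) \<le> expectation (\<lambda>\<omega>. B\<^sup>2)"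
        by (rule integral_mono[OF iU]) (use U2 in auto)
      then show "expectation (\<lambda>\<omega>. (U k \<omega>)\<^sup>2) \<le> B\<^sup>2" by (simp add: prob_space)
    qed (use \<eta>(4) in auto)
    ultimately show ?case using Suc i by (simp add: algebra_simps)
  qed
  then show "integrable M (\<lambda>\<omega>. (S k \<omega>)\<^sup>2)" and "expectation (\<lambda>\<omega>. (S k \<omega>)\<^sup>2) \<le> real k * (B\<^sup>2 * (gaussian_moment 2 * \<delta>\<^sup>2))"
    by auto
qed

end

section \<open>Independence of the augmented past\<close>

context standard_brownian_motion
begin

text \<open>A pi-system generating the past of \<open>W\<close> before null sets are
  adjoined.\<close>

definition cylinders :: "real \<Rightarrow> 'a set set" where
  "cylinders s = {{\<omega>\<in>space M. \<forall>u\<in>J. W u \<omega> \<in> B u} | J B.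
     finite J \<and> J \<subseteq> {0..s} \<and> (\<forall>u\<in>J. B u \<in> sets borel)}"

lemma cylinders_events: "E \<in> cylinders s \<Longrightarrow> E \<in> events"
proof -
  assume "E \<in> cylinders s"
  then obtain J B where E: "E = {\<omega>\<in>space M. \<forall>u\<in>J. W u \<omega> \<in> B u}" "finite J" "J \<subseteq> {0..s}"
    "\<forall>u\<in>J. B u \<in> sets borel" unfolding cylinders_def by blast
  have "{\<omega>\<in>space M. W u \<omega> \<in> B u} \<in> events" if "u \<in> J" for u
  proof -
    have "W u \<in> borel_measurable M" using W_measurable E that by auto
    then have "W u -` B u \<inter> space M \<in> events" using E that by (auto intro: measurable_sets)
    then show ?thesis by (simp add: vimage_def Int_def conj_commute)
  qed
  then show ?thesis unfolding E(1) using E(2) by (rule sets.sets_Collect_finite_All)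
qed

lemma Int_stable_cylinders: "Int_stable (cylinders s)"
  unfolding Int_stable_def
proof safe
  fix E E' assume "E \<in> cylinders s" "E' \<in> cylinders s"
  then obtain J B J' B' where E: "E = {\<omega>\<in>space M. \<forall>u\<in>J. W u \<omega> \<in> B u}" "finite J" "J \<subseteq> {0..s}"
    "\<forall>u\<in>J. B u \<in> sets borel"
    and E': "E' = {\<omega>\<in>space M. \<forall>u\<in>J'. W u \<omega> \<in> B' u}" "finite J'" "J' \<subseteq> {0..s}"
    "\<forall>u\<in>J'. B' u \<in> sets borel" unfolding cylinders_def by blast
  define C where "C = (\<lambda>u. (if u \<in> J then B u else UNIV) \<inter> (if u \<in> J' then B' u else UNIV))"
  have "E \<inter> E' = {\<omega>\<in>space M. \<forall>u\<in>J \<union> J'. W u \<omega> \<in> C u}"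
    unfolding E(1) E'(1) C_def by (auto split: if_splits)
  moreover have "\<forall>u\<in>J \<union> J'. C u \<in> sets borel" using E(4) E'(4) by (auto simp: C_def)
  ultimately show "E \<inter> E' \<in> cylinders s"
    unfolding cylinders_def using E(2,3) E'(2,3)
    by (intro CollectI exI[of _ "J \<union> J'"] exI[of _ C]) auto
qed

text \<open>The values at finitely many times are sums of successive increments, up to the null
  event \<open>W 0 \<noteq> 0\<close>. Appending \<open>t\<close> to the ordered times makes
  \<open>W t - W s\<close> the last increment, and \<open>W_indep\<close> separates it from the
  earlier ones.\<close>

lemma prob_cylinder_Int_increment:
  assumes st: "0 \<le> s" "s < t" and E: "E \<in> cylinders s" and C: "C \<in> sets borel"
  shows "prob (E \<inter> {\<omega>\<in>space M. W t \<omega> - W s \<omega> \<in> C}) = prob E * prob {\<omega>\<in>space M. W t \<omega> - W s \<omega> \<in> C}"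
proof -
  obtain J B where J: "E = {\<omega>\<in>space M. \<forall>u\<in>J. W u \<omega> \<in> B u}" "finite J" "J \<subseteq> {0..s}"
    "\<forall>u\<in>J. B u \<in> sets borel" using E unfolding cylinders_def by blast
  \<comment> \<open>With 0 and \<open>s\<close> among the times, the sorted list starts at 0, where
    the path vanishes almost surely, and ends at \<open>s\<close>, where the new increment
    begins.\<close>
  define S where "S = insert 0 (insert s J)"
  define xs where "xs = sorted_list_of_set S"
  define m where "m = length xs - 1"
  have S: "finite S" "S \<subseteq> {0..s}" "0 \<in> S" "s \<in> S" using J st by (auto simp: S_def)
  have xs: "set xs = S" "sorted_wrt (<) xs" "xs \<noteq> []" using S by (auto simp: xs_def strict_sorted_iff)
  have len: "length xs = Suc m" using xs by (simp add: m_def)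
  have less: "xs ! i < xs ! j" if "i < j" "j \<le> m" for i j
    using xs(2) that len by (simp add: sorted_wrt_nth_less)
  have le: "xs ! i \<le> xs ! j" if "i \<le> j" "j \<le> m" for i j
    using less[of i j] that by (cases "i = j") auto
  have mem: "xs ! i \<in> S" if "i \<le> m" for i using that len xs(1) nth_mem[of i xs] by auto
  have ex: "\<exists>i. i \<le> m \<and> xs ! i = v" if "v \<in> S" for v
  proof -
    have "v \<in> set xs" using that xs(1) by simp
    then obtain i where "i < length xs" "xs ! i = v" unfolding in_set_conv_nth by blast
    then show ?thesis using len by (intro exI[of _ i]) simp
  qed
  have x0: "xs ! 0 = 0"
  proof -
    obtain i where "i \<le> m" "xs ! i = 0" using ex[OF S(3)] by auto
    then show ?thesis using le[of 0 i] mem[of 0] S(2) by fastforce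
  qed
  have xm: "xs ! m = s"
  proof -
    obtain i where "i \<le> m" "xs ! i = s" using ex[OF S(4)] by auto
    then show ?thesis using le[of i m] mem[of m] S(2) by fastforce
  qed
  define \<tau> where "\<tau> = (\<lambda>i. if i \<le> m then xs ! i else t)"
  define D where "D = (\<lambda>i \<omega>. W (\<tau> (Suc i)) \<omega> - W (\<tau> i) \<omega>)"
  have "indep_vars (\<lambda>_. borel) D {..<Suc m}"
    unfolding D_def
  proof (rule W_indep)
    show "0 \<le> \<tau> 0" by (simp add: \<tau>_def x0)
    show "\<tau> i < \<tau> (Suc i)" if "i < Suc m" for i
      using that less[of i "Suc i"] st xm by (cases "i = m") (auto simp: \<tau>_def)
  qed
  from indep_var_restrict[OF this, of "{..<m}" "{m}"]
  have ind: "indep_var (PiM {..<m} (\<lambda>_. borel)) (\<lambda>\<omega>. \<lambda>i\<in>{..<m}. D i \<omega>) (PiM {m} (\<lambda>_. borel)) (\<lambda>\<omega>. \<lambda>i\<in>{m}. D i \<omega>)"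
    by auto
  define idx where "idx = (\<lambda>u. SOME i. i \<le> m \<and> xs ! i = u)"
  have idx: "idx u \<le> m \<and> xs ! idx u = u" if "u \<in> J" for u
  proof -
    have "u \<in> S" using that by (simp add: S_def)
    from ex[OF this] show ?thesis unfolding idx_def by (rule someI_ex)
  qed
  define P where "P = {f\<in>space (PiM {..<m} (\<lambda>_. borel :: real measure)). \<forall>u\<in>J. (\<Sum>i<idx u. f i) \<in> B u}"
  define Q where "Q = {f\<in>space (PiM {m} (\<lambda>_. borel :: real measure)). f m \<in> C}"
  have P: "P \<in> sets (PiM {..<m} (\<lambda>_. borel))"
    unfolding P_def
  proof (rule sets.sets_Collect_finite_All[OF _ J(2)])
    fix u assume u: "u \<in> J"
    have "(\<lambda>f. \<Sum>i<idx u. f i) \<in> borel_measurable (PiM {..<m} (\<lambda>_. borel :: real measure))"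
      using idx[OF u] by (intro borel_measurable_sum measurable_component_singleton) auto
    from measurable_sets[OF this, of "B u"] J(4) u
    show "{f\<in>space (PiM {..<m} (\<lambda>_. borel :: real measure)). (\<Sum>i<idx u. f i) \<in> B u} \<in> sets (PiM {..<m} (\<lambda>_. borel))"
      by (simp add: vimage_def Int_def conj_commute)
  qed
  have Q: "Q \<in> sets (PiM {m} (\<lambda>_. borel))"
  proof -
    have "(\<lambda>f. f m) \<in> borel_measurable (PiM {m} (\<lambda>_. borel :: real measure))"
      by (intro measurable_component_singleton) auto
    from measurable_sets[OF this C] show ?thesis
      by (simp add: Q_def vimage_def Int_def conj_commute)
  qed
  have W_sum: "W u \<omega> = W 0 \<omega> + (\<Sum>i<idx u. D i \<omega>)" if "u \<in> J" for u \<omega>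
  proof -
    have "(\<Sum>i<idx u. D i \<omega>) = W (\<tau> (idx u)) \<omega> - W (\<tau> 0) \<omega>"
      unfolding D_def by (rule sum_lessThan_telescope)
    then show ?thesis using idx[OF that] by (simp add: \<tau>_def x0)
  qed
  have Em: "E \<in> events" using E by (rule cylinders_events)
  have Wm: "W t \<in> borel_measurable M" "W s \<in> borel_measurable M" using W_measurable st by auto
  define Ct where "Ct = {\<omega>\<in>space M. W t \<omega> - W s \<omega> \<in> C}"
  have Ctm: "Ct \<in> events"
    using measurable_sets[OF borel_measurable_diff[OF Wm] C] by (simp add: Ct_def vimage_def Int_def conj_commute)
  define E' where "E' = (\<lambda>\<omega>. \<lambda>i\<in>{..<m}. D i \<omega>) -` P \<inter> space M"
  have E'm: "E' \<in> events" unfolding E'_def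
    using indep_var_rv1[OF ind] P by (rule measurable_sets)
  have CtQ: "(\<lambda>\<omega>. \<lambda>i\<in>{m}. D i \<omega>) -` Q \<inter> space M = Ct"
    by (auto simp: Q_def Ct_def D_def \<tau>_def xm space_PiM)
  have EE': "AE \<omega> in M. \<omega> \<in> E \<longleftrightarrow> \<omega> \<in> E'"
    using W_zero
  proof (rule AE_mp, intro AE_I2 impI)
    fix \<omega> assume \<omega>: "\<omega> \<in> space M" "W 0 \<omega> = 0"
    have "(\<Sum>i<idx u. (\<lambda>i\<in>{..<m}. D i \<omega>) i) = W u \<omega>" if "u \<in> J" for u
      using W_sum[OF that, of \<omega>] \<omega> idx[OF that] by (auto intro!: sum.cong)
    then show "\<omega> \<in> E \<longleftrightarrow> \<omega> \<in> E'" using \<omega> by (auto simp: J(1) E'_def P_def space_PiM)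
  qed
  have "prob (E' \<inter> Ct) = prob E' * prob Ct"
  proof -
    have "(\<lambda>\<omega>. (\<lambda>i\<in>{..<m}. D i \<omega>, \<lambda>i\<in>{m}. D i \<omega>)) -` (P \<times> Q) \<inter> space M = E' \<inter> Ct"
      unfolding E'_def CtQ[symmetric] by blast
    then show ?thesis using indep_varD[OF ind P Q] unfolding CtQ E'_def[symmetric] by simp
  qed
  moreover have "prob (E' \<inter> Ct) = prob (E \<inter> Ct)"
    by (rule measure_eq_AE) (use EE' Em E'm Ctm in auto)
  moreover have "prob E' = prob E"
    by (rule measure_eq_AE) (use EE' Em E'm in auto)
  ultimately show ?thesis by (simp add: Ct_def)
qed

text \<open>Dynkin's argument: for fixed \<open>C\<close> the identity passes to complements and to
  disjoint countable unions, and it holds on the pi-system of cylinders.\<close>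

lemma prob_past_Int_increment:
  assumes st: "0 \<le> s" "s < t" and E: "E \<in> sigma_sets (space M) (cylinders s)" and C: "C \<in> sets borel"
  shows "prob (E \<inter> {\<omega>\<in>space M. W t \<omega> - W s \<omega> \<in> C}) = prob E * prob {\<omega>\<in>space M. W t \<omega> - W s \<omega> \<in> C}"
proof -
  define Ct where "Ct = {\<omega>\<in>space M. W t \<omega> - W s \<omega> \<in> C}"
  have Wm: "W t \<in> borel_measurable M" "W s \<in> borel_measurable M" using W_measurable st by auto
  have Ctm: "Ct \<in> events"
    using measurable_sets[OF borel_measurable_diff[OF Wm] C] by (simp add: Ct_def vimage_def Int_def conj_commute)
  have sub: "sigma_sets (space M) (cylinders s) \<subseteq> events"
    by (rule sets.sigma_sets_subset) (use cylinders_events in auto)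
  have pow: "cylinders s \<subseteq> Pow (space M)" using cylinders_events sets.sets_into_space by blast
  from Int_stable_cylinders pow E have "prob (E \<inter> Ct) = prob E * prob Ct"
  proof (induction rule: sigma_sets_induct_disjoint)
    case (basic A)
    then show ?case using prob_cylinder_Int_increment[OF st _ C] by (simp add: Ct_def)
  next
    case empty
    then show ?case by simp
  next
    case (compl A)
    have A: "A \<in> events" using compl sub by auto
    have "prob ((space M - A) \<inter> Ct) = prob (Ct - A \<inter> Ct)"
      using sets.sets_into_space[OF Ctm] by (intro arg_cong[where f=prob]) auto
    also have "\<dots> = prob Ct - prob (A \<inter> Ct)" using A Ctm by (intro finite_measure_Diff) auto
    finally show ?case using compl by (simp add: prob_compl[OF A] left_diff_distrib)
  next
    case (union A)
    have A: "range A \<subseteq> events" using union sub by auto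
    have "(\<lambda>i. prob (A i \<inter> Ct)) sums prob (\<Union>i. A i \<inter> Ct)"
      by (rule finite_measure_UNION) (use A Ctm union in \<open>auto simp: disjoint_family_on_def\<close>)
    moreover have "(\<lambda>i. prob (A i) * prob Ct) sums (prob (\<Union>i. A i) * prob Ct)"
      by (intro sums_mult2 finite_measure_UNION) (use A union in auto)
    ultimately show ?case using union by (simp add: sums_unique2)
  qed
  then show ?thesis by (simp add: Ct_def)
qed

text \<open>The sets that differ by a null set from an event of the raw past form a sigma-algebra,
  and it contains the generators of the augmented one. This reduces independence of the augmented
  past to independence of the raw past.\<close>

lemma augmented_filtration_approx:
  assumes s: "0 \<le> s" and E: "E \<in> sets (augmented_filtration M W s)"
  shows "\<exists>E'\<in>sigma_sets (space M) (cylinders s). sym_diff E E' \<in> null_sets (completion M)"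
proof -
  let ?G = "{W u -` B \<inter> space M | u B. 0 \<le> u \<and> u \<le> s \<and> B \<in> sets borel} \<union> null_sets (completion M)"
  let ?S = "sigma_sets (space M) (cylinders s)"
  have "?G \<subseteq> Pow (space M)"
    using sets.sets_into_space[of _ "completion M"] by (auto simp: null_sets_def)
  then have "E \<in> sigma_sets (space M) ?G" using E by (simp add: augmented_filtration_def sets_measure_of)
  then show ?thesis
  proof induction
    case (Basic a)
    then consider u B where "a = W u -` B \<inter> space M" "0 \<le> u" "u \<le> s" "B \<in> sets borel"
      | "a \<in> null_sets (completion M)" by auto
    then show ?case
    proof cases
      case 1
      have "a \<in> cylinders s" unfolding cylinders_def
        using 1 by (intro CollectI exI[of _ "{u}"] exI[of _ "\<lambda>_. B"]) auto
      then show ?thesis by (intro bexI[of _ a]) (auto intro: sigma_sets.Basic)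
    next
      case 2
      then show ?thesis by (intro bexI[of _ "{}"]) (auto intro: sigma_sets.Empty)
    qed
  next
    case Empty
    then show ?case by (intro bexI[of _ "{}"]) (auto intro: sigma_sets.Empty)
  next
    case (Compl a)
    then obtain a' where a': "a' \<in> ?S" "sym_diff a a' \<in> null_sets (completion M)" by auto
    have sp: "a \<subseteq> space M" "a' \<subseteq> space M"
      using sigma_sets_into_sp[OF \<open>?G \<subseteq> Pow (space M)\<close> Compl(1)]
        sigma_sets_into_sp[OF _ a'(1)] cylinders_events sets.sets_into_space by blast+
    then have "sym_diff (space M - a) (space M - a') = sym_diff a a'" by auto
    then show ?case using a' by (intro bexI[of _ "space M - a'"]) (auto intro: sigma_sets.Compl)
  next
    case (Union a)
    then obtain a' where a': "\<And>i. a' i \<in> ?S" "\<And>i. sym_diff (a i) (a' i) \<in> null_sets (completion M)"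
      by metis
    have 1: "(\<Union>i::nat. sym_diff (a i) (a' i)) \<in> null_sets (completion M)"
      using a'(2) by auto
    have "sym_diff (\<Union>i. a i) (\<Union>i. a' i) \<subseteq> (\<Union>i::nat. sym_diff (a i) (a' i))" by blast
    then have "sym_diff (\<Union>i. a i) (\<Union>i. a' i) \<in> null_sets (completion M)"
      by (rule completion.complete2[OF _ 1])
    then show ?case using a' by (intro bexI[of _ "\<Union>i. a' i"]) (auto intro: sigma_sets.Union)
  qed
qed

lemma space_augmented_filtration: "space (augmented_filtration M W s) = space M"
  by (simp add: augmented_filtration_def space_measure_of_conv)

text \<open>The ambient measure has to be \<open>completion M\<close>, since null sets of the
  completion need not be events of \<open>M\<close>. By the approximation, an augmented event is a
  raw event changed on null sets.\<close>

lemma subalgebra_augmented_filtration: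
  assumes s: "0 \<le> s"
  shows "subalgebra (completion M) (augmented_filtration M W s)"
proof -
  have sub: "sigma_sets (space M) (cylinders s) \<subseteq> events"
    by (rule sets.sigma_sets_subset) (use cylinders_events in auto)
  have augm: "a \<in> sets (completion M)" if a: "a \<in> sets (augmented_filtration M W s)" for a
  proof -
    obtain a' where a': "a' \<in> sigma_sets (space M) (cylinders s)" "sym_diff a a' \<in> null_sets (completion M)"
      using augmented_filtration_approx[OF s a] by auto
    have "a' \<in> sets (completion M)" using a'(1) sub by (auto intro: sets_completionI_sets)
    moreover have "a' - a \<in> null_sets (completion M)" "a - a' \<in> null_sets (completion M)"
      by (rule completion.complete2[OF _ a'(2)]; blast)+
    moreover have "a = (a' - (a' - a)) \<union> (a - a')" by blast
    ultimately show ?thesis by (metis null_setsD2 sets.Diff sets.Un)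
  qed
  then show ?thesis by (auto simp: subalgebra_def space_augmented_filtration)
qed

lemma prob_space_completion: "prob_space (completion M)"
  by (rule prob_spaceI) (simp add: emeasure_space_1)

lemma indep_augmented_filtration_increment:
  assumes st: "0 \<le> s" "s < t" and U: "U \<in> borel_measurable (augmented_filtration M W s)"
  shows "prob_space.indep_var (completion M) borel U borel (\<lambda>\<omega>. W t \<omega> - W s \<omega>)"
proof -
  interpret Mc: prob_space "completion M" by (rule prob_space_completion)
  define D where "D = (\<lambda>\<omega>. W t \<omega> - W s \<omega>)"
  have Dm: "D \<in> borel_measurable M" unfolding D_def using W_measurable st by auto
  have sub: "sigma_sets (space M) (cylinders s) \<subseteq> events"
    by (rule sets.sigma_sets_subset) (use cylinders_events in auto)
  have sp: "space (augmented_filtration M W s) = space M"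
    by (rule space_augmented_filtration)
  have approx: "\<exists>a'\<in>sigma_sets (space M) (cylinders s). a' \<in> events \<and> (AE \<omega> in completion M. \<omega> \<in> a \<longleftrightarrow> \<omega> \<in> a')"
    if a: "a \<in> sets (augmented_filtration M W s)" for a
  proof -
    obtain a' where a': "a' \<in> sigma_sets (space M) (cylinders s)" "sym_diff a a' \<in> null_sets (completion M)"
      using augmented_filtration_approx[OF st(1) a] by auto
    have "AE \<omega> in completion M. \<omega> \<in> a \<longleftrightarrow> \<omega> \<in> a'"
      using AE_not_in[OF a'(2)] by eventually_elim auto
    then show ?thesis using a'(1) sub by blast
  qed
  have subalg: "subalgebra (completion M) (augmented_filtration M W s)"
    by (rule subalgebra_augmented_filtration[OF st(1)])
  have augm: "a \<in> sets (completion M)" if a: "a \<in> sets (augmented_filtration M W s)" for a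
    using subalg a by (auto simp: subalgebra_def)
  have Um: "U \<in> borel_measurable (completion M)"
    using subalg U by (rule measurable_from_subalg)
  have Dmc: "D \<in> borel_measurable (completion M)" using Dm by (rule measurable_completion)
  have Usets: "sigma_sets (space M) {U -` A \<inter> space M |A. A \<in> sets borel} \<subseteq> sets (augmented_filtration M W s)"
    unfolding sp[symmetric] by (rule sets.sigma_sets_subset) (use U in \<open>auto intro: measurable_sets\<close>)
  \<comment> \<open>The preimages of Borel sets under \<open>D\<close> already form a sigma-algebra,
    so on the side of the increment only such preimages have to be tested.\<close>
  have "{D -` A \<inter> space M |A. A \<in> sigma_sets UNIV (sets borel)} = sigma_sets (space M) {D -` A \<inter> space M |A. A \<in> sets borel}"
    by (rule sigma_sets_vimage_commute) auto
  moreover have "sigma_sets UNIV (sets (borel :: real measure)) = sets borel"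
    using sets.sigma_sets_eq[of "borel :: real measure"] by simp
  ultimately have Dsets: "sigma_sets (space M) {D -` A \<inter> space M |A. A \<in> sets borel} = {D -` A \<inter> space M |A. A \<in> sets borel}"
    by metis
  have "Mc.indep_var borel U borel D"
    unfolding Mc.indep_var_eq space_completion Dsets
  proof (intro conjI Um Dmc Mc.indep_setI)
    show "sigma_sets (space M) {U -` A \<inter> space M |A. A \<in> sets borel} \<subseteq> Mc.events"
      using Usets augm by blast
    show "{D -` A \<inter> space M |A. A \<in> sets borel} \<subseteq> Mc.events"
      using measurable_sets[OF Dmc] by auto
    fix a b assume a: "a \<in> sigma_sets (space M) {U -` A \<inter> space M |A. A \<in> sets borel}"
      and b: "b \<in> {D -` A \<inter> space M |A. A \<in> sets borel}"
    obtain C where C: "C \<in> sets borel" and bC: "b = D -` C \<inter> space M" using b by auto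
    have bm: "b \<in> events" unfolding bC using Dm C by (rule measurable_sets)
    have b_eq: "b = {\<omega>\<in>space M. W t \<omega> - W s \<omega> \<in> C}" by (auto simp: bC D_def)
    have aa: "a \<in> sets (augmented_filtration M W s)" using a Usets by blast
    obtain a' where a': "a' \<in> sigma_sets (space M) (cylinders s)" "a' \<in> events"
      "AE \<omega> in completion M. \<omega> \<in> a \<longleftrightarrow> \<omega> \<in> a'" using approx[OF aa] by auto
    have "Mc.prob (a \<inter> b) = Mc.prob (a' \<inter> b)"
      by (rule measure_eq_AE) (use a' bm augm[OF aa] in \<open>auto intro: sets_completionI_sets\<close>)
    also have "\<dots> = prob a' * prob b"
      using prob_past_Int_increment[OF st a'(1) C] a'(2) bm by (simp add: b_eq)
    also have "prob a' = Mc.prob a'" using a'(2) by simp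
    also have "\<dots> = Mc.prob a"
      by (rule measure_eq_AE) (use a' augm[OF aa] in \<open>auto intro: sets_completionI_sets\<close>)
    finally show "Mc.prob (a \<inter> b) = Mc.prob a * Mc.prob b" using bm by simp
  qed
  then show ?thesis by (simp add: D_def)
qed

end

section \<open>Pathwise Ito formula\<close>

definition dyadic_pt :: "real \<Rightarrow> real \<Rightarrow> nat \<Rightarrow> nat \<Rightarrow> real" where
  "dyadic_pt c h j l = c + real l * (h / 2 ^ j)"

lemma dyadic_pt_0 [simp]: "dyadic_pt c h j 0 = c"
  by (simp add: dyadic_pt_def)

lemma dyadic_pt_last [simp]: "dyadic_pt c h j (2 ^ j) = c + h"
  by (simp add: dyadic_pt_def)

lemma dyadic_pt_Suc: "dyadic_pt c h j (Suc l) = dyadic_pt c h j l + h / 2 ^ j"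
  by (simp add: dyadic_pt_def algebra_simps add_divide_distrib)

lemma dyadic_pt_mono: "h > 0 \<Longrightarrow> k \<le> l \<Longrightarrow> dyadic_pt c h j k \<le> dyadic_pt c h j l"
  by (simp add: dyadic_pt_def mult_right_mono divide_right_mono)

lemma dyadic_pt_mem:
  assumes "h > 0" "l \<le> 2 ^ j" shows "dyadic_pt c h j l \<in> {c..c + h}"
  using dyadic_pt_mono[OF assms(1), of 0 l c j] dyadic_pt_mono[OF assms, of c j] by simp

lemma dyadic_cell_subset:
  assumes "h > 0" "l < 2 ^ j"
  shows "{dyadic_pt c h j l..dyadic_pt c h j (Suc l)} \<subseteq> {c..c + h}"
  using dyadic_pt_mem[OF assms(1), of l j c] dyadic_pt_mem[OF assms(1), of "Suc l" j c] assms by auto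

lemma eventually_dyadic_osc:
  fixes g :: "real \<Rightarrow> real"
  assumes h: "h > 0" and g: "continuous_on {c..c + h} g" and e: "e > 0"
  shows "\<forall>\<^sub>F j in sequentially. \<forall>l<2 ^ j. \<forall>u\<in>{dyadic_pt c h j l..dyadic_pt c h j (Suc l)}.
    \<bar>g u - g (dyadic_pt c h j l)\<bar> < e"
proof -
  have "uniformly_continuous_on {c..c + h} g"
    using g by (intro compact_uniformly_continuous) auto
  then obtain d where d: "d > 0" "\<And>x x'. x \<in> {c..c + h} \<Longrightarrow> x' \<in> {c..c + h} \<Longrightarrow> dist x' x < d \<Longrightarrow> dist (g x') (g x) < e"
    using e unfolding uniformly_continuous_on_def by metis
  have "(\<lambda>j. h * (1 / 2) ^ j) \<longlonglongrightarrow> h * 0"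
    by (intro tendsto_mult tendsto_const LIMSEQ_power_zero) auto
  then have "\<forall>\<^sub>F j in sequentially. h * (1 / 2) ^ j < d" using d(1) by (auto dest: order_tendstoD(2))
  then show ?thesis
  proof eventually_elim
    case (elim j)
    show ?case
    proof (intro allI impI ballI)
      fix l u assume l: "l < (2::nat) ^ j" and u: "u \<in> {dyadic_pt c h j l..dyadic_pt c h j (Suc l)}"
      have "h / 2 ^ j < d" using elim by (simp add: power_one_over)
      then have "dist u (dyadic_pt c h j l) < d"
        using u by (auto simp: dist_real_def dyadic_pt_Suc)
      moreover have "u \<in> {c..c + h}" "dyadic_pt c h j l \<in> {c..c + h}"
        using dyadic_cell_subset[OF h l, of c] u dyadic_pt_mem[OF h, of l j c] l by auto
      ultimately show "\<bar>g u - g (dyadic_pt c h j l)\<bar> < e" using d(2) by (auto simp: dist_real_def)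
    qed
  qed
qed

lemma dyadic_integral_sum:
  fixes f :: "real \<Rightarrow> real"
  assumes h: "h > 0" and f: "continuous_on {c..c + h} f" and k: "k \<le> 2 ^ j"
  shows "integral {c..dyadic_pt c h j k} f = (\<Sum>l<k. integral {dyadic_pt c h j l..dyadic_pt c h j (Suc l)} f)"
  using k
proof (induction k)
  case (Suc k)
  have "integral {c..dyadic_pt c h j (Suc k)} f
     = integral {c..dyadic_pt c h j k} f + integral {dyadic_pt c h j k..dyadic_pt c h j (Suc k)} f"
  proof (rule Henstock_Kurzweil_Integration.integral_combine[symmetric])
    show "c \<le> dyadic_pt c h j k" using dyadic_pt_mem[OF h, of k j c] Suc.prems by simp
    show "dyadic_pt c h j k \<le> dyadic_pt c h j (Suc k)" by (rule dyadic_pt_mono[OF h]) simp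
    have "{c..dyadic_pt c h j (Suc k)} \<subseteq> {c..c + h}" using dyadic_pt_mem[OF h Suc.prems, of c] by auto
    then show "f integrable_on {c..dyadic_pt c h j (Suc k)}"
      by (intro integrable_continuous_real continuous_on_subset[OF f])
  qed
  then show ?case using Suc by simp
qed simp

text \<open>The integrator is \<open>f u du\<close> rather than \<open>du\<close>, as in the drift
  term of the expansion of \<open>Y\<close>. Uniform continuity of \<open>g\<close> controls the
  error on each small interval.\<close>

lemma dyadic_riemann_tendsto:
  fixes f g :: "real \<Rightarrow> real"
  assumes h: "h > 0" and f: "continuous_on {c..c + h} f" and g: "continuous_on {c..c + h} g"
  shows "(\<lambda>j. \<Sum>l<2 ^ j. g (dyadic_pt c h j l) * integral {dyadic_pt c h j l..dyadic_pt c h j (Suc l)} f)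
    \<longlonglongrightarrow> integral {c..c + h} (\<lambda>u. g u * f u)"
proof (rule tendstoI)
  fix e :: real assume e: "e > 0"
  have "compact (f ` {c..c + h})" using f by (intro compact_continuous_image) auto
  then obtain B where B: "\<And>u. u \<in> {c..c + h} \<Longrightarrow> \<bar>f u\<bar> \<le> B"
    by (force dest!: compact_imp_bounded simp: bounded_iff)
  have B0: "0 \<le> B" using B[of c] h by force
  define d where "d = e / (2 * h * (B + 1))"
  have d: "d > 0" using e h B0 by (simp add: d_def)
  have gf: "continuous_on {c..c + h} (\<lambda>u. g u * f u)" by (intro continuous_intros f g)
  show "\<forall>\<^sub>F j in sequentially. dist (\<Sum>l<2 ^ j. g (dyadic_pt c h j l) * integral {dyadic_pt c h j l..dyadic_pt c h j (Suc l)} f)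
      (integral {c..c + h} (\<lambda>u. g u * f u)) < e"
    using eventually_dyadic_osc[OF h g d]
  proof eventually_elim
    case (elim j)
    let ?I = "\<lambda>l. {dyadic_pt c h j l..dyadic_pt c h j (Suc l)}"
    have "\<bar>g (dyadic_pt c h j l) * integral (?I l) f - integral (?I l) (\<lambda>u. g u * f u)\<bar> \<le> d * B * (h / 2 ^ j)"
      if l: "l < 2 ^ j" for l
    proof -
      note sub = dyadic_cell_subset[OF h l, of c]
      have ii: "f integrable_on ?I l" "(\<lambda>u. g u * f u) integrable_on ?I l"
        "(\<lambda>u. (g (dyadic_pt c h j l) - g u) * f u) integrable_on ?I l"
        by (intro integrable_continuous_real continuous_intros continuous_on_subset[OF f sub] continuous_on_subset[OF g sub])+
      have "g (dyadic_pt c h j l) * integral (?I l) f - integral (?I l) (\<lambda>u. g u * f u)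
          = integral (?I l) (\<lambda>u. (g (dyadic_pt c h j l) - g u) * f u)"
        using Henstock_Kurzweil_Integration.integral_diff[OF integrable_on_mult_right[OF ii(1), of "g (dyadic_pt c h j l)"] ii(2)]
        by (simp add: left_diff_distrib)
      also have "\<bar>\<dots>\<bar> \<le> (d * B) * (dyadic_pt c h j (Suc l) - dyadic_pt c h j l)"
        unfolding real_norm_def[symmetric]
      proof (rule integral_bound)
        show "dyadic_pt c h j l \<le> dyadic_pt c h j (Suc l)" by (rule dyadic_pt_mono[OF h]) simp
        show "continuous_on (?I l) (\<lambda>u. (g (dyadic_pt c h j l) - g u) * f u)"
          by (intro continuous_intros continuous_on_subset[OF f sub] continuous_on_subset[OF g sub])
        fix u assume u: "u \<in> ?I l"
        have "\<bar>g (dyadic_pt c h j l) - g u\<bar> \<le> d" using elim l u by (force simp: abs_minus_commute)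
        then show "norm ((g (dyadic_pt c h j l) - g u) * f u) \<le> d * B"
          using B[of u] u sub d by (auto simp: abs_mult intro!: mult_mono)
      qed
      finally show ?thesis by (simp add: dyadic_pt_Suc)
    qed
    then have "\<bar>\<Sum>l<2 ^ j. g (dyadic_pt c h j l) * integral (?I l) f - integral (?I l) (\<lambda>u. g u * f u)\<bar> \<le> (\<Sum>l<(2::nat) ^ j. d * B * (h / 2 ^ j))"
      by (intro order_trans[OF sum_abs] sum_mono) auto
    also have "\<dots> = d * B * h" by simp
    also have "\<dots> \<le> e * (B / (2 * (B + 1)))" using h B0 by (simp add: d_def)
    also have "\<dots> < e * 1" using e B0 by (intro mult_strict_left_mono) (auto simp: field_simps)
    finally show ?case
      using dyadic_integral_sum[OF h gf, of "2 ^ j" j] by (simp add: dist_real_def sum_subtractf)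
  qed
qed

lemma dyadic_riemann_tendsto':
  fixes g :: "real \<Rightarrow> real"
  assumes h: "h > 0" and g: "continuous_on {c..c + h} g"
  shows "(\<lambda>j. \<Sum>l<2 ^ j. g (dyadic_pt c h j l) * (h / 2 ^ j)) \<longlonglongrightarrow> integral {c..c + h} g"
  using dyadic_riemann_tendsto[OF h continuous_on_const[of _ 1] g] h by (simp add: dyadic_pt_Suc)

text \<open>Product rule for \<open>u - c\<close> times the primitive of \<open>f\<close>. It trades
  the weight \<open>(u - c) / h\<close> for the final value minus the mean of the primitive.\<close>

lemma integral_by_parts_linear_weight:
  fixes f :: "real \<Rightarrow> real"
  assumes h: "h > 0" and f: "continuous_on {c..c + h} f"
  shows "integral {c..c + h} (\<lambda>u. (u - c) * f u)
    = h * integral {c..c + h} f - integral {c..c + h} (\<lambda>t. integral {c..t} f)"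
proof -
  define G where "G = (\<lambda>t. integral {c..t} f)"
  have dG: "(G has_vector_derivative f t) (at t within {c..c + h})" if "t \<in> {c..c + h}" for t
    unfolding G_def using integral_has_vector_derivative[OF f that] .
  have cG: "continuous_on {c..c + h} G"
    using dG by (intro continuous_on_vector_derivative)
  have "((\<lambda>u. (u - c) * f u + G u) has_integral ((c + h - c) * G (c + h) - (c - c) * G c)) {c..c + h}"
  proof (rule fundamental_theorem_of_calculus)
    show "c \<le> c + h" using h by simp
    fix t assume t: "t \<in> {c..c + h}"
    show "((\<lambda>u. (u - c) * G u) has_vector_derivative (t - c) * f t + G t) (at t within {c..c + h})"
      using dG[OF t] by (auto intro!: derivative_eq_intros simp: has_real_derivative_iff_has_vector_derivative[symmetric])
  qed
  then have "integral {c..c + h} (\<lambda>u. (u - c) * f u + G u) = h * G (c + h)" by (simp add: has_integral_iff)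
  moreover have "integral {c..c + h} (\<lambda>u. (u - c) * f u + G u) = integral {c..c + h} (\<lambda>u. (u - c) * f u) + integral {c..c + h} G"
    by (intro Henstock_Kurzweil_Integration.integral_add integrable_continuous_real continuous_intros f cG)
  ultimately show ?thesis by (simp add: G_def)
qed

text \<open>Summation by parts, the discrete counterpart of the preceding partial
  integration.\<close>

lemma sum_linear_weight_telescope:
  fixes f :: "nat \<Rightarrow> real"
  shows "(\<Sum>l<m. real l * (f (Suc l) - f l)) = real m * f m - (\<Sum>l<m. f (Suc l))"
  by (induction m) (simp_all add: algebra_simps)

lemma taylor_second_order_mean:
  fixes f :: "real \<Rightarrow> real"
  assumes f: "\<And>x. x > 0 \<Longrightarrow> (f has_real_derivative f' x) (at x)"
    and f': "\<And>x. x > 0 \<Longrightarrow> (f' has_real_derivative f'' x) (at x)"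
    and ab: "a > 0" "b > 0"
  shows "\<exists>z\<in>{min a b..max a b}. f b = f a + f' a * (b - a) + f'' z / 2 * (b - a)\<^sup>2"
proof (cases "a = b")
  case False
  define D where "D = (\<lambda>m::nat. if m = 0 then f else if m = 1 then f' else f'')"
  have D: "\<forall>m t. m < 2 \<and> min a b \<le> t \<and> t \<le> max a b \<longrightarrow> DERIV (D m) t :> D (Suc m) t"
  proof (intro allI impI)
    fix m :: nat and t assume t: "m < 2 \<and> min a b \<le> t \<and> t \<le> max a b"
    then have "t > 0" using ab by auto
    with t show "DERIV (D m) t :> D (Suc m) t"
      using f f' by (cases "m = 0") (auto simp: D_def less_2_cases_iff)
  qed
  obtain t where t: "(if b < a then b < t \<and> t < a else a < t \<and> t < b)"
    and eq: "f b = (\<Sum>m<2. D m a / fact m * (b - a) ^ m) + D 2 t / fact 2 * (b - a)^2"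
    using Taylor[of 2 D f "min a b" "max a b" a b] D False by (auto simp: D_def)
  show ?thesis
    by (rule bexI[of _ t]) (use t eq in \<open>auto simp: D_def numeral_2_eq_2 split: if_splits\<close>)
qed (auto intro!: bexI[of _ a])

text \<open>Foellmer's pathwise form of Ito's formula: only the convergence of weighted squared increments
  of the driving path is used. The weights \<open>\<alpha> = 1, \<beta> = 0\<close> give the increment of the martingale part
  \<open>N\<close>, and \<open>\<alpha> = 0, \<beta> = 1\<close> give the integral of \<open>(u - c) / h\<close> against \<open>dN\<close>, with the stochastic integral
  removed by partial integration.\<close>

lemma pathwise_ito_dyadic:
  fixes Y w b f f' f'' N :: "real \<Rightarrow> real" and \<alpha> \<beta> \<gamma> c h :: real
  defines "x \<equiv> dyadic_pt c h"
  assumes h: "h > 0"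
    and Y: "continuous_on {c..c + h} Y" "\<And>t. t \<in> {c..c + h} \<Longrightarrow> Y t > 0"
    and w: "continuous_on {c..c + h} w"
    and b: "continuous_on {c..c + h} b"
    and Y_eq: "\<And>s t. c \<le> s \<Longrightarrow> s \<le> t \<Longrightarrow> t \<le> c + h \<Longrightarrow> Y t - Y s = integral {s..t} b + \<gamma> * (w t - w s)"
    and f: "\<And>x. x > 0 \<Longrightarrow> (f has_real_derivative f' x) (at x)"
    and f': "\<And>x. x > 0 \<Longrightarrow> (f' has_real_derivative f'' x) (at x)"
    and f'': "continuous_on {0<..} f''"
    and N: "\<And>t. t \<in> {c..c + h} \<Longrightarrow> N t = N c + (f (Y t) - f (Y c))
       - integral {c..t} (\<lambda>u. f' (Y u) * b u + \<gamma>\<^sup>2 / 2 * f'' (Y u))"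
    and qv: "(\<lambda>j. \<Sum>l<2 ^ j. (w (x j (Suc l)) - w (x j l))\<^sup>2 - h / 2 ^ j) \<longlonglongrightarrow> 0"
    and qv'': "(\<lambda>j. \<Sum>l<2 ^ j. (\<alpha> + \<beta> * (real l / 2 ^ j)) * f'' (Y (x j l))
       * ((w (x j (Suc l)) - w (x j l))\<^sup>2 - h / 2 ^ j)) \<longlonglongrightarrow> 0"
  shows "(\<lambda>j. \<Sum>l<2 ^ j. (\<alpha> + \<beta> * (real l / 2 ^ j)) * f' (Y (x j l)) * \<gamma> * (w (x j (Suc l)) - w (x j l)))
    \<longlonglongrightarrow> \<alpha> * (N (c + h) - N c) + \<beta> * (N (c + h) - integral {c..c + h} N / h)"
proof -
  \<comment> \<open>The discrete weights are the values at the dyadic points of this affine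
    function, which runs from \<open>\<alpha>\<close> to \<open>\<alpha> + \<beta>\<close> over the
    cell.\<close>
  define a where "a = (\<lambda>u. \<alpha> + \<beta> * ((u - c) / h))"
  have a_x: "a (x j l) = \<alpha> + \<beta> * (real l / 2 ^ j)" for j l
    using h by (simp add: a_def x_def dyadic_pt_def)
  have ca: "continuous_on {c..c + h} a" unfolding a_def using h by (intro continuous_intros) auto
  have cf: "continuous_on {0<..} f" "continuous_on {0<..} f'"
    using f f' by (auto intro!: continuous_at_imp_continuous_on DERIV_isCont)
  have cfY: "continuous_on {c..c + h} (\<lambda>u. f (Y u))" "continuous_on {c..c + h} (\<lambda>u. f' (Y u))"
    "continuous_on {c..c + h} (\<lambda>u. f'' (Y u))"
    using cf f'' Y by (auto intro!: continuous_on_compose2[OF _ Y(1)])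
  define \<psi> where "\<psi> = (\<lambda>u. f' (Y u) * b u + \<gamma>\<^sup>2 / 2 * f'' (Y u))"
  have c\<psi>: "continuous_on {c..c + h} \<psi>" unfolding \<psi>_def by (intro continuous_intros cfY b)
  have mem: "x j l \<in> {c..c + h}" if "l \<le> 2 ^ j" for j l
    unfolding x_def by (rule dyadic_pt_mem[OF h that])
  have Yx: "Y (x j l) > 0" if "l \<le> 2 ^ j" for j l using mem[OF that] Y(2) by simp
  define \<delta> where "\<delta> = (\<lambda>j::nat. h / 2 ^ j)"
  have \<delta>_eq: "\<delta> j = h * (1 / 2) ^ j" for j by (simp add: \<delta>_def power_one_over)
  have x_Suc: "x j (Suc l) = x j l + \<delta> j" for j l by (simp add: x_def \<delta>_def dyadic_pt_Suc)
  have \<delta>0: "\<delta> j > 0" for j using h by (simp add: \<delta>_def)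
  define lam where "lam = (\<lambda>j l. integral {x j l..x j (Suc l)} b)"
  define dw where "dw = (\<lambda>j l. w (x j (Suc l)) - w (x j l))"
  define dY where "dY = (\<lambda>j l. Y (x j (Suc l)) - Y (x j l))"
  have dY: "dY j l = lam j l + \<gamma> * dw j l" if "l < 2 ^ j" for j l
    unfolding dY_def lam_def dw_def
    by (rule Y_eq) (use mem[of l j] mem[of "Suc l" j] that \<delta>0[of j] in \<open>auto simp: x_Suc\<close>)
  have "\<exists>B. \<forall>u\<in>{c..c + h}. \<bar>g u\<bar> \<le> B" if "continuous_on {c..c + h} g" for g :: "real \<Rightarrow> real"
  proof -
    have "compact (g ` {c..c + h})" using that by (intro compact_continuous_image) auto
    then show ?thesis by (force dest!: compact_imp_bounded simp: bounded_iff)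
  qed
  note bdd = this
  obtain Ba where Ba: "\<And>u. u \<in> {c..c + h} \<Longrightarrow> \<bar>a u\<bar> \<le> Ba" using bdd[OF ca] by blast
  obtain Bb where Bb: "\<And>u. u \<in> {c..c + h} \<Longrightarrow> \<bar>b u\<bar> \<le> Bb" using bdd[OF b] by blast
  obtain Bf where Bf: "\<And>u. u \<in> {c..c + h} \<Longrightarrow> \<bar>a u * f'' (Y u)\<bar> \<le> Bf"
    using bdd[OF continuous_on_mult[OF ca cfY(3)]] by blast
  have cmem: "c \<in> {c..c + h}" using h by simp
  have B0: "0 \<le> Ba" "0 \<le> Bb" "0 \<le> Bf" using Ba[OF cmem] Bb[OF cmem] Bf[OF cmem] by linarith+
  have lam: "\<bar>lam j l\<bar> \<le> Bb * \<delta> j" if l: "l < 2 ^ j" for j l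
  proof -
    note sub = dyadic_cell_subset[OF h l, of c, folded x_def]
    have "norm (lam j l) \<le> Bb * (x j (Suc l) - x j l)" unfolding lam_def
    proof (rule integral_bound[OF _ continuous_on_subset[OF b sub]])
      show "x j l \<le> x j (Suc l)" using \<delta>0[of j] by (simp add: x_Suc)
      show "norm (b u) \<le> Bb" if "u \<in> {x j l..x j (Suc l)}" for u using that sub Bb by auto
    qed
    then show ?thesis by (simp add: x_Suc)
  qed
  have small: "\<forall>\<^sub>F j in sequentially. \<forall>l<2 ^ j. \<bar>lam j l\<bar> < e \<and> \<bar>dw j l\<bar> < e \<and> \<bar>dY j l\<bar> < e" if e: "e > 0" for e
  proof -
    have "(\<lambda>j. Bb * (h * (1 / 2) ^ j)) \<longlonglongrightarrow> Bb * (h * 0)"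
      by (intro tendsto_mult tendsto_const LIMSEQ_power_zero) auto
    then have "\<forall>\<^sub>F j in sequentially. Bb * (h * (1 / 2) ^ j) < e"
      using e by (auto dest: order_tendstoD(2))
    then have "\<forall>\<^sub>F j in sequentially. Bb * \<delta> j < e" by (simp only: \<delta>_eq)
    then show ?thesis using eventually_dyadic_osc[OF h w e, folded x_def] eventually_dyadic_osc[OF h Y(1) e, folded x_def]
    proof eventually_elim
      case (elim j)
      have "x j (Suc l) \<in> {x j l..x j (Suc l)}" for l using \<delta>0[of j] by (simp add: x_Suc)
      with elim lam show ?case unfolding dw_def dY_def by (meson le_less_trans)
    qed
  qed
  \<comment> \<open>Bookkeeping of the second order expansion: \<open>A\<close> collects the
    increments of \<open>f (Y)\<close>, \<open>Bs\<close> the first order drift, \<open>E\<close>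
    the second order terms containing the drift, \<open>Q\<close> the centred squared increments,
    \<open>Dr\<close> their compensator and \<open>R\<close> the Taylor remainder.\<close>
  define A where "A = (\<lambda>j. \<Sum>l<2 ^ j. a (x j l) * (f (Y (x j (Suc l))) - f (Y (x j l))))"
  define Bs where "Bs = (\<lambda>j. \<Sum>l<2 ^ j. a (x j l) * f' (Y (x j l)) * lam j l)"
  define E where "E = (\<lambda>j. \<Sum>l<2 ^ j. a (x j l) * f'' (Y (x j l)) * (lam j l * (lam j l + 2 * \<gamma> * dw j l)))"
  define Q where "Q = (\<lambda>j. \<Sum>l<2 ^ j. a (x j l) * f'' (Y (x j l)) * ((dw j l)\<^sup>2 - \<delta> j))"
  define Dr where "Dr = (\<lambda>j. \<Sum>l<2 ^ j. a (x j l) * f'' (Y (x j l)) * \<delta> j)"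
  define R where "R = (\<lambda>j. \<Sum>l<2 ^ j. a (x j l) * (f (Y (x j (Suc l))) - f (Y (x j l)) - f' (Y (x j l)) * dY j l
      - f'' (Y (x j l)) / 2 * (dY j l)\<^sup>2))"
  define S where "S = (\<lambda>j. \<Sum>l<2 ^ j. (\<alpha> + \<beta> * (real l / 2 ^ j)) * f' (Y (x j l)) * \<gamma> * dw j l)"
  have S_eq: "S j = A j - Bs j - (E j + \<gamma>\<^sup>2 * Q j + \<gamma>\<^sup>2 * Dr j) / 2 - R j" for j
  proof -
    have "S j = (\<Sum>l<2 ^ j. a (x j l) * f' (Y (x j l)) * \<gamma> * dw j l)" unfolding S_def a_x ..
    also have "\<dots> = A j - Bs j - (E j + \<gamma>\<^sup>2 * Q j + \<gamma>\<^sup>2 * Dr j) / 2 - R j"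
      unfolding A_def Bs_def E_def Q_def Dr_def R_def sum_distrib_left sum_subtractf[symmetric] sum.distrib[symmetric]
        sum_divide_distrib
      by (rule sum.cong) (auto simp: dY power2_eq_square field_simps)
    finally show ?thesis .
  qed
  have limBs: "Bs \<longlonglongrightarrow> integral {c..c + h} (\<lambda>u. (a u * f' (Y u)) * b u)"
    unfolding Bs_def lam_def x_def by (intro dyadic_riemann_tendsto[OF h b] continuous_intros ca cfY)
  have limDr: "Dr \<longlonglongrightarrow> integral {c..c + h} (\<lambda>u. a u * f'' (Y u))"
    unfolding Dr_def \<delta>_def x_def by (intro dyadic_riemann_tendsto'[OF h] continuous_intros ca cfY)
  have limQ: "Q \<longlonglongrightarrow> 0" using qv'' unfolding Q_def dw_def \<delta>_def a_x .
  \<comment> \<open>The \<open>\<alpha>\<close> part telescopes. The \<open>\<beta>\<close> part,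
    summed by parts, leaves a Riemann sum \<open>r\<close> for the mean of \<open>f (Y)\<close> and
    a boundary term of order \<open>\<delta> j\<close>.\<close>
  have limA: "A \<longlonglongrightarrow> \<alpha> * (f (Y (c + h)) - f (Y c)) + \<beta> * (f (Y (c + h)) - integral {c..c + h} (\<lambda>u. f (Y u)) / h)"
  proof -
    define r where "r = (\<lambda>j. \<Sum>l<2 ^ j. f (Y (x j l)) * \<delta> j)"
    have r: "r \<longlonglongrightarrow> integral {c..c + h} (\<lambda>u. f (Y u))"
      unfolding r_def \<delta>_def x_def by (rule dyadic_riemann_tendsto'[OF h cfY(1)])
    have d0: "\<delta> \<longlonglongrightarrow> 0"
    proof -
      have "(\<lambda>j. h * (1 / 2) ^ j) \<longlonglongrightarrow> h * 0"
        by (intro tendsto_mult tendsto_const LIMSEQ_power_zero) auto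
      then show ?thesis by (simp add: \<delta>_eq[abs_def])
    qed
    have "A j = \<alpha> * (f (Y (c + h)) - f (Y c)) + \<beta> * (f (Y (c + h)) - (r j + (f (Y (c + h)) - f (Y c)) * \<delta> j) / h)" for j
    proof -
      let ?g = "\<lambda>l. f (Y (x j l))"
      have e: "?g (2 ^ j) = f (Y (c + h))" "?g 0 = f (Y c)" by (simp_all add: x_def)
      have tele: "(\<Sum>l<2 ^ j. ?g (Suc l) - ?g l) = f (Y (c + h)) - f (Y c)"
        using sum_lessThan_telescope[of ?g "2 ^ j"] e by simp
      have "A j = \<alpha> * (\<Sum>l<2 ^ j. ?g (Suc l) - ?g l) + \<beta> * ((\<Sum>l<2 ^ j. real l * (?g (Suc l) - ?g l)) / 2 ^ j)"
        unfolding A_def a_x by (simp add: sum_distrib_left sum_divide_distrib sum.distrib[symmetric] field_simps)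
      also have "(\<Sum>l<2 ^ j. real l * (?g (Suc l) - ?g l)) = 2 ^ j * f (Y (c + h)) - (\<Sum>l<2 ^ j. ?g (Suc l))"
        using sum_linear_weight_telescope[of ?g "2 ^ j"] e by simp
      also have "(\<Sum>l<2 ^ j. ?g (Suc l)) = (\<Sum>l<2 ^ j. ?g l) + (f (Y (c + h)) - f (Y c))"
        using tele by (simp add: sum_subtractf)
      also have "(2 ^ j * f (Y (c + h)) - ((\<Sum>l<2 ^ j. ?g l) + (f (Y (c + h)) - f (Y c)))) / 2 ^ j
         = f (Y (c + h)) - (r j + (f (Y (c + h)) - f (Y c)) * \<delta> j) / h"
        using h unfolding r_def sum_distrib_right[symmetric] by (simp add: \<delta>_def field_simps)
      finally show ?thesis unfolding tele .
    qed
    moreover have "(\<lambda>j. \<alpha> * (f (Y (c + h)) - f (Y c)) + \<beta> * (f (Y (c + h)) - (r j + (f (Y (c + h)) - f (Y c)) * \<delta> j) / h))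
      \<longlonglongrightarrow> \<alpha> * (f (Y (c + h)) - f (Y c)) + \<beta> * (f (Y (c + h)) - (integral {c..c + h} (\<lambda>u. f (Y u)) + (f (Y (c + h)) - f (Y c)) * 0) / h)"
      using h by (intro tendsto_intros r d0) auto
    ultimately have "(\<lambda>j. A j) \<longlonglongrightarrow> \<alpha> * (f (Y (c + h)) - f (Y c)) + \<beta> * (f (Y (c + h)) - (integral {c..c + h} (\<lambda>u. f (Y u)) + (f (Y (c + h)) - f (Y c)) * 0) / h)"
      by simp
    then show ?thesis by simp
  qed
  \<comment> \<open>The drift increments \<open>lam\<close> are of order \<open>\<delta> j\<close>,
    so their absolute sum is at most \<open>Bb * h\<close>, while the remaining factor is uniformly
    small.\<close>
  have lamsum: "\<bar>\<Sum>l<2 ^ j. q l * (lam j l * (lam j l + 2 * \<gamma> * dw j l))\<bar> \<le> Bq * (Bb * h) * ((1 + 2 * \<bar>\<gamma>\<bar>) * e)"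
    if sm: "\<forall>l<2 ^ j. \<bar>lam j l\<bar> < e \<and> \<bar>dw j l\<bar> < e \<and> \<bar>dY j l\<bar> < e" and q: "\<And>l. l < 2 ^ j \<Longrightarrow> \<bar>q l\<bar> \<le> Bq" for j q Bq e
  proof -
    have "\<bar>q l * (lam j l * (lam j l + 2 * \<gamma> * dw j l))\<bar> \<le> Bq * (Bb * \<delta> j) * ((1 + 2 * \<bar>\<gamma>\<bar>) * e)" if l: "l < 2 ^ j" for l
    proof -
      have "\<bar>lam j l + 2 * \<gamma> * dw j l\<bar> \<le> \<bar>lam j l\<bar> + 2 * \<bar>\<gamma>\<bar> * \<bar>dw j l\<bar>"
        by (rule order_trans[OF abs_triangle_ineq]) (simp add: abs_mult)
      also have "\<dots> \<le> e + 2 * \<bar>\<gamma>\<bar> * e" using sm l by (intro add_mono mult_left_mono) (auto intro: less_imp_le)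
      finally have "\<bar>lam j l + 2 * \<gamma> * dw j l\<bar> \<le> (1 + 2 * \<bar>\<gamma>\<bar>) * e" by (simp add: algebra_simps)
      then have "\<bar>q l\<bar> * \<bar>lam j l\<bar> * \<bar>lam j l + 2 * \<gamma> * dw j l\<bar> \<le> Bq * (Bb * \<delta> j) * ((1 + 2 * \<bar>\<gamma>\<bar>) * e)"
        using q[OF l] lam[OF l] B0 \<delta>0[of j] by (intro mult_mono) auto
      then show ?thesis by (simp add: abs_mult mult.assoc)
    qed
    then have "\<bar>\<Sum>l<2 ^ j. q l * (lam j l * (lam j l + 2 * \<gamma> * dw j l))\<bar> \<le> (\<Sum>l<(2::nat) ^ j. Bq * (Bb * \<delta> j) * ((1 + 2 * \<bar>\<gamma>\<bar>) * e))"
      by (intro order_trans[OF sum_abs] sum_mono) auto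
    then show ?thesis by (simp add: \<delta>_def)
  qed
  have lamsum_lim: "(\<lambda>j. \<Sum>l<2 ^ j. q j l * (lam j l * (lam j l + 2 * \<gamma> * dw j l))) \<longlonglongrightarrow> 0"
    if q: "\<And>j l. l < 2 ^ j \<Longrightarrow> \<bar>q j l\<bar> \<le> Bq" and Bq: "0 \<le> Bq" for q Bq
  proof (rule tendstoI)
    fix e :: real assume e: "e > 0"
    define K where "K = Bq * (Bb * h) * (1 + 2 * \<bar>\<gamma>\<bar>)"
    have K: "K \<ge> 0" using Bq B0 h by (simp add: K_def)
    have "e / (K + 1) > 0" using e K by simp
    from small[OF this] show "\<forall>\<^sub>F j in sequentially. dist (\<Sum>l<2 ^ j. q j l * (lam j l * (lam j l + 2 * \<gamma> * dw j l))) 0 < e"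
    proof eventually_elim
      case (elim j)
      have "\<bar>\<Sum>l<2 ^ j. q j l * (lam j l * (lam j l + 2 * \<gamma> * dw j l))\<bar> \<le> K * (e / (K + 1))"
        using lamsum[OF elim q] by (simp add: K_def mult.assoc)
      also have "\<dots> < e" using e K by (simp add: field_simps)
      finally show ?case by (simp add: dist_real_def)
    qed
  qed
  have limE: "E \<longlonglongrightarrow> 0"
    unfolding E_def by (rule lamsum_lim[OF _ B0(3)]) (use Bf mem in auto)
  have qv': "(\<lambda>j. \<Sum>l<2 ^ j. (dw j l)\<^sup>2 - h / 2 ^ j) \<longlonglongrightarrow> 0" using qv by (simp add: dw_def)
  \<comment> \<open>The quadratic variation of \<open>Y\<close> is that of
    \<open>\<gamma> * w\<close>; its boundedness is what controls the Taylor remainder.\<close>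
  have dY2: "(\<lambda>j. \<Sum>l<2 ^ j. (dY j l)\<^sup>2) \<longlonglongrightarrow> 0 + \<gamma>\<^sup>2 * (0 + h)"
  proof -
    have "(\<Sum>l<2 ^ j. (dY j l)\<^sup>2) = (\<Sum>l<2 ^ j. 1 * (lam j l * (lam j l + 2 * \<gamma> * dw j l)))
        + \<gamma>\<^sup>2 * ((\<Sum>l<2 ^ j. (dw j l)\<^sup>2 - h / 2 ^ j) + h)" for j
    proof -
      have "(\<Sum>l<2 ^ j. (dw j l)\<^sup>2 - h / 2 ^ j) + h = (\<Sum>l<2 ^ j. (dw j l)\<^sup>2)" by (simp add: sum_subtractf)
      then show ?thesis unfolding sum_distrib_left
        by (simp add: sum_distrib_left sum.distrib[symmetric] dY power2_eq_square algebra_simps)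
    qed
    moreover have "(\<lambda>j. (\<Sum>l<2 ^ j. 1 * (lam j l * (lam j l + 2 * \<gamma> * dw j l)))
        + \<gamma>\<^sup>2 * ((\<Sum>l<2 ^ j. (dw j l)\<^sup>2 - h / 2 ^ j) + h)) \<longlonglongrightarrow> 0 + \<gamma>\<^sup>2 * (0 + h)"
      by (intro tendsto_intros qv' lamsum_lim[of "\<lambda>_ _. 1" 1]) auto
    ultimately show ?thesis by simp
  qed
  have limR: "R \<longlonglongrightarrow> 0"
  proof (rule tendstoI)
    fix e :: real assume e: "e > 0"
    define G where "G = \<gamma>\<^sup>2 * h + 1"
    have G: "G > 0" using h by (simp add: G_def add_nonneg_pos)
    define e' where "e' = e / (Ba * G + 1)"
    have e': "e' > 0" using e B0 G by (simp add: e'_def add_nonneg_pos)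
    \<comment> \<open>On the compact cell the path stays in some \<open>{lo..hi}\<close> with
      \<open>lo > 0\<close>, away from a possible singularity at 0, and there \<open>f''\<close> is
      uniformly continuous.\<close>
    have "compact (Y ` {c..c + h})" "Y ` {c..c + h} \<noteq> {}" using Y h by (auto intro!: compact_continuous_image)
    then obtain lo hi where lo: "lo \<in> Y ` {c..c + h}" "\<And>y. y \<in> Y ` {c..c + h} \<Longrightarrow> lo \<le> y"
      and hi: "\<And>y. y \<in> Y ` {c..c + h} \<Longrightarrow> y \<le> hi"
      using compact_attains_inf compact_attains_sup by metis
    have lo0: "lo > 0" using lo(1) Y(2) by auto
    have "uniformly_continuous_on {lo..hi} f''"
      by (rule compact_uniformly_continuous) (use lo0 in \<open>auto intro: continuous_on_subset[OF f'']\<close>)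
    then obtain d where d: "d > 0" "\<And>u v. u \<in> {lo..hi} \<Longrightarrow> v \<in> {lo..hi} \<Longrightarrow> dist v u < d \<Longrightarrow> dist (f'' v) (f'' u) < e'"
      using e' unfolding uniformly_continuous_on_def by metis
    have "\<forall>\<^sub>F j in sequentially. (\<Sum>l<2 ^ j. (dY j l)\<^sup>2) < G"
      using order_tendstoD(2)[OF dY2, of G] by (simp add: G_def)
    then show "\<forall>\<^sub>F j in sequentially. dist (R j) 0 < e" using small[OF d(1)]
    proof eventually_elim
      case (elim j)
      have "\<bar>a (x j l) * (f (Y (x j (Suc l))) - f (Y (x j l)) - f' (Y (x j l)) * dY j l
      - f'' (Y (x j l)) / 2 * (dY j l)\<^sup>2)\<bar> \<le> Ba * (e' * (dY j l)\<^sup>2)" if l: "l < 2 ^ j" for l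
      proof -
        let ?p = "Y (x j l)" and ?q = "Y (x j (Suc l))"
        have pq: "?p > 0" "?q > 0" using Yx l by auto
        have pqm: "?p \<in> {lo..hi}" "?q \<in> {lo..hi}" using lo hi mem[of l j] mem[of "Suc l" j] l by auto
        obtain z where z: "z \<in> {min ?p ?q..max ?p ?q}" "f ?q = f ?p + f' ?p * (?q - ?p) + f'' z / 2 * (?q - ?p)\<^sup>2"
          using taylor_second_order_mean[OF f f' pq] by blast
        have "dist z ?p < d" using z(1) elim(2) l by (auto simp: dist_real_def dY_def min_def max_def split: if_splits)
        moreover have "z \<in> {lo..hi}" using pqm z(1) by (auto simp: min_le_iff_disj le_max_iff_disj)
        ultimately have "dist (f'' z) (f'' ?p) < e'" using d(2) pqm by blast
        then have fz: "\<bar>(f'' z - f'' ?p) / 2\<bar> \<le> e'" using e' by (simp add: dist_real_def)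
        have "f ?q - f ?p - f' ?p * dY j l - f'' ?p / 2 * (dY j l)\<^sup>2 = (f'' z - f'' ?p) / 2 * (dY j l)\<^sup>2"
          unfolding z(2) dY_def by (simp add: algebra_simps)
        also have "\<bar>\<dots>\<bar> \<le> e' * (dY j l)\<^sup>2" unfolding abs_mult using fz by (intro mult_mono) auto
        finally show ?thesis unfolding abs_mult using Ba[OF mem[of l j]] l B0 by (intro mult_mono) auto
      qed
      then have "\<bar>R j\<bar> \<le> (\<Sum>l<2 ^ j. Ba * (e' * (dY j l)\<^sup>2))"
        unfolding R_def by (intro order_trans[OF sum_abs] sum_mono) auto
      also have "\<dots> = Ba * (\<Sum>l<2 ^ j. (dY j l)\<^sup>2) * e'" by (simp add: sum_distrib_left sum_distrib_right mult_ac)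
      also have "\<dots> \<le> Ba * G * e'" using elim(1) B0 e' by (intro mult_right_mono mult_left_mono) auto
      also have "\<dots> < e"
      proof -
        have "Ba * G + 1 > 0" using B0 G by (simp add: add_nonneg_pos)
        then have "(Ba * G + 1) * e' = e" by (simp add: e'_def)
        then show ?thesis using e' by (simp add: distrib_right)
      qed
      finally show ?case by (simp add: dist_real_def)
    qed
  qed
  have "(\<lambda>j. A j - Bs j - (E j + \<gamma>\<^sup>2 * Q j + \<gamma>\<^sup>2 * Dr j) / 2 - R j) \<longlonglongrightarrow>
    (\<alpha> * (f (Y (c + h)) - f (Y c)) + \<beta> * (f (Y (c + h)) - integral {c..c + h} (\<lambda>u. f (Y u)) / h))
     - integral {c..c + h} (\<lambda>u. (a u * f' (Y u)) * b u)
     - (0 + \<gamma>\<^sup>2 * 0 + \<gamma>\<^sup>2 * integral {c..c + h} (\<lambda>u. a u * f'' (Y u))) / 2 - 0"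
    by (intro tendsto_intros limA limBs limE limQ limDr limR) auto
  moreover have "(\<alpha> * (f (Y (c + h)) - f (Y c)) + \<beta> * (f (Y (c + h)) - integral {c..c + h} (\<lambda>u. f (Y u)) / h))
     - integral {c..c + h} (\<lambda>u. (a u * f' (Y u)) * b u)
     - (0 + \<gamma>\<^sup>2 * 0 + \<gamma>\<^sup>2 * integral {c..c + h} (\<lambda>u. a u * f'' (Y u))) / 2 - 0
     = \<alpha> * (N (c + h) - N c) + \<beta> * (N (c + h) - integral {c..c + h} N / h)"
  proof -
    \<comment> \<open>The drift integrals are expressed through the primitive \<open>P\<close> of
      \<open>\<psi>\<close>, so that \<open>f (Y) - P\<close> becomes \<open>N\<close> up to a
      constant. The constant cancels both in the increment and in the final value minus the
      mean.\<close>
    define P where "P = (\<lambda>t. integral {c..t} \<psi>)"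
    have cP: "continuous_on {c..c + h} P"
      unfolding P_def by (rule indefinite_integral_continuous_1) (rule integrable_continuous_real[OF c\<psi>])
    have "integral {c..c + h} (\<lambda>u. (a u * f' (Y u)) * b u) + \<gamma>\<^sup>2 / 2 * integral {c..c + h} (\<lambda>u. a u * f'' (Y u))
      = integral {c..c + h} (\<lambda>u. (a u * f' (Y u)) * b u + \<gamma>\<^sup>2 / 2 * (a u * f'' (Y u)))"
      by (subst Henstock_Kurzweil_Integration.integral_add)
        (auto intro!: integrable_continuous_real continuous_intros ca cfY b)
    also have "(\<lambda>u. (a u * f' (Y u)) * b u + \<gamma>\<^sup>2 / 2 * (a u * f'' (Y u))) = (\<lambda>u. \<alpha> * \<psi> u + \<beta> / h * ((u - c) * \<psi> u))"
    proof
      fix u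
      define q where "q = (u - c) / h"
      have "a u = \<alpha> + \<beta> * q" "\<beta> / h * ((u - c) * \<psi> u) = \<beta> * q * \<psi> u" by (simp_all add: a_def q_def)
      then show "(a u * f' (Y u)) * b u + \<gamma>\<^sup>2 / 2 * (a u * f'' (Y u)) = \<alpha> * \<psi> u + \<beta> / h * ((u - c) * \<psi> u)"
        by (simp add: \<psi>_def algebra_simps)
    qed
    also have "integral {c..c + h} \<dots> = \<alpha> * P (c + h) + \<beta> / h * integral {c..c + h} (\<lambda>u. (u - c) * \<psi> u)"
      unfolding P_def
      by (subst Henstock_Kurzweil_Integration.integral_add)
        (use h in \<open>auto intro!: integrable_continuous_real continuous_intros c\<psi>\<close>)
    also have "integral {c..c + h} (\<lambda>u. (u - c) * \<psi> u) = h * P (c + h) - integral {c..c + h} P"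
      unfolding P_def by (rule integral_by_parts_linear_weight[OF h c\<psi>])
    finally have 1: "integral {c..c + h} (\<lambda>u. (a u * f' (Y u)) * b u) + \<gamma>\<^sup>2 / 2 * integral {c..c + h} (\<lambda>u. a u * f'' (Y u))
      = \<alpha> * P (c + h) + \<beta> / h * (h * P (c + h) - integral {c..c + h} P)" .
    have Nt: "N t = (N c - f (Y c)) + f (Y t) - P t" if "t \<in> {c..c + h}" for t
      using N[OF that] by (simp add: P_def \<psi>_def)
    have "integral {c..c + h} N = integral {c..c + h} (\<lambda>t. (N c - f (Y c)) + f (Y t) - P t)"
      by (rule Henstock_Kurzweil_Integration.integral_cong) (rule Nt)
    also have "\<dots> = h * (N c - f (Y c)) + integral {c..c + h} (\<lambda>t. f (Y t)) - integral {c..c + h} P"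
      using h by (simp add: Henstock_Kurzweil_Integration.integral_diff Henstock_Kurzweil_Integration.integral_add
        integrable_continuous_real cfY cP integrable_add)
    finally have 2: "integral {c..c + h} N = h * (N c - f (Y c)) + integral {c..c + h} (\<lambda>t. f (Y t)) - integral {c..c + h} P" .
    have 3: "N (c + h) = (N c - f (Y c)) + f (Y (c + h)) - P (c + h)" using Nt[of "c + h"] h by simp
    have 4: "integral {c..c + h} (\<lambda>u. (a u * f' (Y u)) * b u) = \<alpha> * P (c + h) + \<beta> / h * (h * P (c + h) - integral {c..c + h} P)
       - \<gamma>\<^sup>2 / 2 * integral {c..c + h} (\<lambda>u. a u * f'' (Y u))" using 1 by linarith
    show ?thesis unfolding 2 3 4 using h by (simp add: field_simps)
  qed
  ultimately show ?thesis unfolding S_eq[symmetric] S_def dw_def by simp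
qed

section \<open>Moments from weak type inequalities\<close>

lemma nn_integral_powr_tail:
  fixes x p :: real
  assumes p: "p > 0" and x: "x \<ge> 0"
  shows "(\<integral>\<^sup>+t. indicator {0..x} t * ennreal (p * t powr (p - 1)) \<partial>lborel) = ennreal (x powr p)"
proof -
  have "((\<lambda>t. p * t powr (p - 1)) has_integral (p * (x powr (p - 1 + 1) / (p - 1 + 1)))) {0..x}"
    by (intro has_integral_mult_right has_integral_powr_from_0) (use assms in auto)
  then have "((\<lambda>t. p * t powr (p - 1)) has_integral (x powr p)) {0..x}" using p by simp
  from nn_integral_has_integral_lebesgue'[OF _ this] p show ?thesis
    by (simp add: mult.commute)
qed

text \<open>Split at \<open>t = sqrt q\<close>. Below, the integrand is at most
  \<open>p * t powr (p - 1)\<close>; above, it is at most a multiple of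
  \<open>t powr (p - 1 - 2 * J)\<close>, integrable at infinity because \<open>p < 2 * J\<close>. By
  scaling, both parts are multiples of \<open>q powr (p / 2)\<close>.\<close>

lemma nn_integral_powr_min_le:
  fixes q p :: real
  assumes p: "p > 0" and q: "q \<ge> 0" and J: "p < 2 * real J"
  shows "(\<integral>\<^sup>+t. indicator {0<..} t * (ennreal (p * t powr (p - 1)) * ennreal (min (q / t\<^sup>2) 1 ^ J)) \<partial>lborel)
    \<le> ennreal ((1 + p / (2 * real J - p)) * q powr (p / 2))"
proof (cases "q = 0")
  case True
  have "J \<noteq> 0" using J p by (cases J) auto
  then show ?thesis using True by (simp add: power_0_left)
next
  case False
  define s where "s = sqrt q"
  have s: "s > 0" "q = s\<^sup>2" using False q by (auto simp: s_def)
  define e where "e = p - 1 - 2 * real J"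
  have e: "e < -1" "e + 1 = - (2 * real J - p)" using J by (auto simp: e_def)
  have "((\<lambda>t. p * q ^ J * t powr e) has_integral (p * q ^ J * (- (s powr (e + 1)) / (e + 1)))) {s..}"
    by (intro has_integral_mult_right has_integral_powr_to_inf) (use s e in auto)
  also have "p * q ^ J * (- (s powr (e + 1)) / (e + 1)) = p / (2 * real J - p) * s powr p"
  proof -
    have "q ^ J = s powr (2 * real J)" using powr_realpow[OF s(1), of "2 * J"] s(2) by (simp add: power_mult)
    then have "q ^ J * s powr (e + 1) = s powr p" by (simp add: e(2) powr_add[symmetric])
    moreover define m where "m = 2 * real J - p"
    moreover have "e + 1 = - m" unfolding m_def by (rule e(2))
    ultimately show ?thesis unfolding m_def[symmetric] by simp
  qed
  finally have "(\<integral>\<^sup>+t. indicator {s..} t * ennreal (p * q ^ J * t powr e) \<partial>lborel) = ennreal (p / (2 * real J - p) * s powr p)"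
    using nn_integral_has_integral_lebesgue'[of "{s..}" "\<lambda>t. p * q ^ J * t powr e"] p q by (simp add: mult.commute)
  note tail = this
  have "(\<integral>\<^sup>+t. indicator {0<..} t * (ennreal (p * t powr (p - 1)) * ennreal (min (q / t\<^sup>2) 1 ^ J)) \<partial>lborel)
    \<le> (\<integral>\<^sup>+t. indicator {0..s} t * ennreal (p * t powr (p - 1)) + indicator {s..} t * ennreal (p * q ^ J * t powr e) \<partial>lborel)"
  proof (rule nn_integral_mono)
    fix t :: real
    consider "t \<le> 0" | "0 < t" "t < s" | "s \<le> t" "0 < t" by linarith
    then show "indicator {0<..} t * (ennreal (p * t powr (p - 1)) * ennreal (min (q / t\<^sup>2) 1 ^ J))
      \<le> indicator {0..s} t * ennreal (p * t powr (p - 1)) + indicator {s..} t * ennreal (p * q ^ J * t powr e)"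
    proof cases
      case 2
      have "ennreal (p * t powr (p - 1)) * ennreal (min (q / t\<^sup>2) 1 ^ J) \<le> ennreal (p * t powr (p - 1)) * ennreal 1"
        using q by (intro mult_left_mono ennreal_leI power_le_one) auto
      then show ?thesis using 2 by simp
    next
      case 3
      have "p * t powr (p - 1) * min (q / t\<^sup>2) 1 ^ J \<le> p * t powr (p - 1) * (q / t\<^sup>2) ^ J"
        using q p by (intro mult_left_mono power_mono) auto
      also have "\<dots> = p * q ^ J * (t powr (p - 1) * t powr - (2 * real J))"
        using powr_realpow[OF 3(2), of "2 * J"] by (simp add: powr_minus power_mult divide_inverse power_mult_distrib power_inverse)
      also have "t powr (p - 1) * t powr - (2 * real J) = t powr e" by (simp add: e_def powr_add[symmetric])
      finally have "ennreal (p * t powr (p - 1)) * ennreal (min (q / t\<^sup>2) 1 ^ J) \<le> ennreal (p * q ^ J * t powr e)"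
        using p q by (simp add: ennreal_mult[symmetric] ennreal_leI)
      then show ?thesis using 3 by (simp add: add_increasing)
    qed auto
  qed
  also have "\<dots> = ennreal (s powr p) + ennreal (p / (2 * real J - p) * s powr p)"
    by (subst nn_integral_add) (use s p tail nn_integral_powr_tail[OF p, of s] in auto)
  also have "\<dots> = ennreal ((1 + p / (2 * real J - p)) * q powr (p / 2))"
  proof -
    have "s\<^sup>2 = s powr 2" using s by simp
    then have "s powr p = q powr (p / 2)" unfolding s(2) by (simp only: powr_powr) simp
    then show ?thesis using p J by (simp add: ennreal_plus[symmetric] algebra_simps del: ennreal_plus)
  qed
  finally show ?thesis .
qed

text \<open>Layer cake formula for \<open>X powr p\<close>, the weak type bound inside the integral
  over \<open>t\<close>, and Tonelli back to an integral over \<open>\<omega>\<close>. The power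
  \<open>p / 2\<close> of \<open>Q\<close> then comes from
  \<open>nn_integral_powr_min_le\<close>.\<close>

lemma (in prob_space) moment_le_of_weak_type:
  fixes X Q :: "'a \<Rightarrow> real" and p C :: real
  assumes X: "X \<in> borel_measurable M" "\<And>\<omega>. 0 \<le> X \<omega>"
    and Q: "Q \<in> borel_measurable M" "\<And>\<omega>. 0 \<le> Q \<omega>"
    and p: "p > 0" and J: "p < 2 * real J" and C: "C \<ge> 0"
    and weak: "\<And>t. t > 0 \<Longrightarrow> prob {\<omega>\<in>space M. t < X \<omega>} \<le> C * expectation (\<lambda>\<omega>. min (Q \<omega> / t\<^sup>2) 1 ^ J)"
  shows "(\<integral>\<^sup>+\<omega>. ennreal (X \<omega> powr p) \<partial>M)
    \<le> ennreal (C * (1 + p / (2 * real J - p))) * (\<integral>\<^sup>+\<omega>. ennreal (Q \<omega> powr (p / 2)) \<partial>M)"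
proof -
  interpret P: pair_sigma_finite M lborel
    by (intro pair_sigma_finite.intro sigma_finite_measure_axioms lborel.sigma_finite_measure_axioms)
  note [measurable] = X(1) Q(1)
  have weak': "(\<integral>\<^sup>+\<omega>. indicator {\<omega>\<in>space M. t < X \<omega>} \<omega> \<partial>M) \<le> ennreal C * (\<integral>\<^sup>+\<omega>. ennreal (min (Q \<omega> / t\<^sup>2) 1 ^ J) \<partial>M)"
    if t: "t > 0" for t
  proof -
    have i: "integrable M (\<lambda>\<omega>. min (Q \<omega> / t\<^sup>2) 1 ^ J)"
      by (rule integrable_const_bound[of _ 1]) (use Q in \<open>auto simp: power_le_one\<close>)
    have "(\<integral>\<^sup>+\<omega>. indicator {\<omega>\<in>space M. t < X \<omega>} \<omega> \<partial>M) = ennreal (prob {\<omega>\<in>space M. t < X \<omega>})"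
      by (subst nn_integral_indicator) (auto simp: emeasure_eq_measure)
    also have "\<dots> \<le> ennreal (C * expectation (\<lambda>\<omega>. min (Q \<omega> / t\<^sup>2) 1 ^ J))"
      by (rule ennreal_leI[OF weak[OF t]])
    also have "\<dots> = ennreal C * (\<integral>\<^sup>+\<omega>. ennreal (min (Q \<omega> / t\<^sup>2) 1 ^ J) \<partial>M)"
      using i C Q(2) by (subst nn_integral_eq_integral) (auto simp: ennreal_mult intro!: integral_nonneg_AE)
    finally show ?thesis .
  qed
  have "(\<integral>\<^sup>+\<omega>. ennreal (X \<omega> powr p) \<partial>M) = (\<integral>\<^sup>+\<omega>. (\<integral>\<^sup>+t. indicator {0..X \<omega>} t * ennreal (p * t powr (p - 1)) \<partial>lborel) \<partial>M)"
    using nn_integral_powr_tail[OF p X(2)] by simp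
  also have "\<dots> = (\<integral>\<^sup>+\<omega>. (\<integral>\<^sup>+t. (indicator {0<..} t * ennreal (p * t powr (p - 1))) * indicator {\<omega>\<in>space M. t < X \<omega>} \<omega> \<partial>lborel) \<partial>M)"
  proof (rule nn_integral_cong, rule nn_integral_cong_AE)
    fix \<omega> assume \<omega>: "\<omega> \<in> space M"
    \<comment> \<open>The two ranges of \<open>t\<close> differ at most in 0 and
      \<open>X \<omega>\<close>, a null set.\<close>
    have "AE t in lborel. t \<noteq> X \<omega>" "AE t in lborel. t \<noteq> (0::real)"
      by (rule AE_lborel_singleton)+
    then show "AE t in lborel. indicator {0..X \<omega>} t * ennreal (p * t powr (p - 1))
      = (indicator {0<..} t * ennreal (p * t powr (p - 1))) * indicator {\<omega>\<in>space M. t < X \<omega>} \<omega>"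
      by eventually_elim (use \<omega> in \<open>auto split: split_indicator\<close>)
  qed
  also have "\<dots> = (\<integral>\<^sup>+t. (\<integral>\<^sup>+\<omega>. (indicator {0<..} t * ennreal (p * t powr (p - 1))) * indicator {\<omega>\<in>space M. t < X \<omega>} \<omega> \<partial>M) \<partial>lborel)"
    by (rule P.Fubini'[symmetric]) measurable
  also have "\<dots> = (\<integral>\<^sup>+t. (indicator {0<..} t * ennreal (p * t powr (p - 1))) * (\<integral>\<^sup>+\<omega>. indicator {\<omega>\<in>space M. t < X \<omega>} \<omega> \<partial>M) \<partial>lborel)"
    by (rule nn_integral_cong, rule nn_integral_cmult) measurable
  also have "\<dots> \<le> (\<integral>\<^sup>+t. (indicator {0<..} t * ennreal (p * t powr (p - 1))) * (ennreal C * (\<integral>\<^sup>+\<omega>. ennreal (min (Q \<omega> / t\<^sup>2) 1 ^ J) \<partial>M)) \<partial>lborel)"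
  proof (rule nn_integral_mono)
    fix t :: real
    show "(indicator {0<..} t * ennreal (p * t powr (p - 1))) * (\<integral>\<^sup>+\<omega>. indicator {\<omega>\<in>space M. t < X \<omega>} \<omega> \<partial>M)
      \<le> (indicator {0<..} t * ennreal (p * t powr (p - 1))) * (ennreal C * (\<integral>\<^sup>+\<omega>. ennreal (min (Q \<omega> / t\<^sup>2) 1 ^ J) \<partial>M))"
      using mult_left_mono[OF weak'[of t]] by (cases "t > 0") auto
  qed
  also have "\<dots> = (\<integral>\<^sup>+t. (\<integral>\<^sup>+\<omega>. ennreal C * (indicator {0<..} t * (ennreal (p * t powr (p - 1)) * ennreal (min (Q \<omega> / t\<^sup>2) 1 ^ J))) \<partial>M) \<partial>lborel)"
    by (rule nn_integral_cong) (simp add: nn_integral_cmult mult_ac)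
  also have "\<dots> = (\<integral>\<^sup>+\<omega>. (\<integral>\<^sup>+t. ennreal C * (indicator {0<..} t * (ennreal (p * t powr (p - 1)) * ennreal (min (Q \<omega> / t\<^sup>2) 1 ^ J))) \<partial>lborel) \<partial>M)"
    by (rule P.Fubini') measurable
  also have "\<dots> \<le> (\<integral>\<^sup>+\<omega>. ennreal C * ennreal ((1 + p / (2 * real J - p)) * Q \<omega> powr (p / 2)) \<partial>M)"
    by (rule nn_integral_mono, subst nn_integral_cmult) (auto intro!: mult_left_mono nn_integral_powr_min_le p J Q)
  also have "\<dots> = ennreal (C * (1 + p / (2 * real J - p))) * (\<integral>\<^sup>+\<omega>. ennreal (Q \<omega> powr (p / 2)) \<partial>M)"
    using p J C by (simp add: ennreal_mult nn_integral_cmult mult.assoc)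
  finally show ?thesis .
qed

text \<open>Geometric decay makes the series of squares integrable, hence almost surely finite, so
  its terms tend to 0.\<close>

lemma (in prob_space) AE_tendsto_0_of_second_moment:
  fixes X :: "nat \<Rightarrow> 'a \<Rightarrow> real"
  assumes X: "\<And>j. X j \<in> borel_measurable M" "\<And>j. integrable M (\<lambda>\<omega>. (X j \<omega>)\<^sup>2)"
    and le: "\<And>j. expectation (\<lambda>\<omega>. (X j \<omega>)\<^sup>2) \<le> C * (1 / 2) ^ j"
  shows "AE \<omega> in M. (\<lambda>j. X j \<omega>) \<longlonglongrightarrow> 0"
proof -
  note [measurable] = X(1)
  have "(\<integral>\<^sup>+\<omega>. (\<Sum>j. ennreal ((X j \<omega>)\<^sup>2)) \<partial>M) = (\<Sum>j. \<integral>\<^sup>+\<omega>. ennreal ((X j \<omega>)\<^sup>2) \<partial>M)"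
    by (rule nn_integral_suminf) measurable
  also have "\<dots> = (\<Sum>j. ennreal (expectation (\<lambda>\<omega>. (X j \<omega>)\<^sup>2)))"
    by (intro arg_cong[where f=suminf] ext nn_integral_eq_integral X(2)) simp
  also have "\<dots> \<le> (\<Sum>j. ennreal (C * (1 / 2) ^ j))"
    by (intro suminf_le ennreal_leI le) auto
  also have "\<dots> < top"
  proof -
    have "0 \<le> C * (1 / 2) ^ j" for j using order_trans[OF integral_nonneg_AE le[of j]] by simp
    moreover have "summable (\<lambda>j. C * (1 / 2 :: real) ^ j)" by (intro summable_mult summable_geometric) auto
    ultimately have "(\<Sum>j. ennreal (C * (1 / 2) ^ j)) = ennreal (\<Sum>j. C * (1 / 2) ^ j)"
      by (rule suminf_ennreal2)
    then show ?thesis by simp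
  qed
  finally have "(\<integral>\<^sup>+\<omega>. (\<Sum>j. ennreal ((X j \<omega>)\<^sup>2)) \<partial>M) \<noteq> \<infinity>" by (simp add: less_top)
  then have "AE \<omega> in M. (\<Sum>j. ennreal ((X j \<omega>)\<^sup>2)) \<noteq> \<infinity>"
    by (intro nn_integral_PInf_AE) measurable
  then show ?thesis
  proof eventually_elim
    case (elim \<omega>)
    then have "summable (\<lambda>j. (X j \<omega>)\<^sup>2)" by (intro summable_suminf_not_top) auto
    then have "(\<lambda>j. sqrt ((X j \<omega>)\<^sup>2)) \<longlonglongrightarrow> sqrt 0" by (intro tendsto_real_sqrt summable_LIMSEQ_zero)
    then show ?case by (simp add: tendsto_rabs_zero_iff)
  qed
qed

section \<open>The martingale part of L(Y)\<close>

text \<open>Completeness permits arbitrary values on the exceptional set. This is how path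
  functionals of \<open>Y\<close>, which are understood on regular paths only, are shown to be
  measurable.\<close>

lemma borel_measurable_completion_AE_limit:
  fixes u :: "nat \<Rightarrow> 'a \<Rightarrow> real"
  assumes u: "\<And>j. u j \<in> borel_measurable (completion M)" and lim: "AE \<omega> in completion M. (\<lambda>j. u j \<omega>) \<longlonglongrightarrow> f \<omega>"
  shows "f \<in> borel_measurable (completion M)"
proof -
  obtain N where N: "N \<in> null_sets (completion M)" "{\<omega>\<in>space M. \<not> (\<lambda>j. u j \<omega>) \<longlonglongrightarrow> f \<omega>} \<subseteq> N"
    using lim unfolding eventually_ae_filter by auto
  define g where "g = (\<lambda>\<omega>. if \<omega> \<in> N then 0 else f \<omega>)"
  have Ns: "N \<in> sets (completion M)" using N by auto
  have g: "g \<in> borel_measurable (completion M)"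
  proof (rule borel_measurable_LIMSEQ_real)
    show "(\<lambda>j. if \<omega> \<in> N then 0 else u j \<omega>) \<longlonglongrightarrow> g \<omega>" if "\<omega> \<in> space (completion M)" for \<omega>
      using N(2) that by (auto simp: g_def)
    show "(\<lambda>\<omega>. if \<omega> \<in> N then 0 else u j \<omega>) \<in> borel_measurable (completion M)" for j
      using Ns u[of j] by (intro measurable_If_set) (auto intro: sets.Int)
  qed
  show ?thesis
  proof (rule measurableI)
    fix A :: "real set" assume A: "A \<in> sets borel"
    have "f -` A \<inter> space (completion M) \<inter> N \<in> null_sets (completion M)"
      by (rule completion.complete2[OF _ N(1)]) auto
    moreover have "f -` A \<inter> space (completion M) = (g -` A \<inter> space (completion M) - N) \<union> (f -` A \<inter> space (completion M) \<inter> N)"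
      by (auto simp: g_def)
    moreover have "g -` A \<inter> space (completion M) \<in> sets (completion M)" using g A by (rule measurable_sets)
    ultimately show "f -` A \<inter> space (completion M) \<in> sets (completion M)"
      using Ns by (metis null_setsD2 sets.Diff sets.Un)
  qed simp
qed

lemma integral_uniform_partition:
  fixes f :: "real \<Rightarrow> real"
  assumes h: "h \<ge> 0" and f: "continuous_on {0..real n * h} f" and k: "k \<le> n"
  shows "integral {0..real k * h} f = (\<Sum>i<k. integral {real i * h..real i * h + h} f)"
  using k
proof (induction k)
  case (Suc k)
  have "integral {0..real (Suc k) * h} f = integral {0..real k * h} f + integral {real k * h..real (Suc k) * h} f"
  proof (rule Henstock_Kurzweil_Integration.integral_combine[symmetric])
    have "real (Suc k) * h \<le> real n * h" using Suc.prems h by (intro mult_right_mono) auto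
    then show "f integrable_on {0..real (Suc k) * h}"
      by (intro integrable_continuous_real continuous_on_subset[OF f]) auto
    show "real k * h \<le> real (Suc k) * h" using h by (intro mult_right_mono) auto
  qed (use h in auto)
  then show ?case using Suc by (simp add: algebra_simps)
qed simp

lemma sum_nat_blocks:
  fixes f :: "nat \<Rightarrow> 'b::comm_monoid_add"
  shows "(\<Sum>l<i * m. f l) = (\<Sum>k<i. \<Sum>l<m. f (k * m + l))"
proof -
  have "sum f {k * m..<k * m + m} = (\<Sum>l<m. f (k * m + l))" for k
    by (rule sum.reindex_bij_witness[where i="\<lambda>l. k * m + l" and j="\<lambda>l. l - k * m"]) auto
  then show ?thesis by (simp flip: sum.nat_group)
qed

text \<open>Truncation to \<open>{- B..B}\<close> for \<open>B >= 0\<close>. The estimate for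
  squared increments needs bounded weights, whereas \<open>L2\<close> may blow up at 0; on a fixed
  path the truncation is inactive once \<open>B\<close> is large.\<close>

definition clamp_to :: "real \<Rightarrow> real \<Rightarrow> real" where
  "clamp_to B v = max (- B) (min B v)"

lemma clamp_to_measurable [measurable]: "clamp_to B \<in> borel_measurable borel"
  unfolding clamp_to_def[abs_def] by measurable

text \<open>\<open>L1\<close> and \<open>L2\<close> are the derivatives of \<open>L\<close> on the
  positive half-line and Borel on the whole line, so that composing them with \<open>Y\<close> is
  measurable also where a path leaves the half-line.\<close>

locale additive_sde = standard_brownian_motion M W for M :: "'a measure" and W +
  fixes Y :: "real \<Rightarrow> 'a \<Rightarrow> real" and L L1 L2 :: "real \<Rightarrow> real" and \<gamma> y T :: real
  assumes T_pos: "T > 0"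
    and Y_adapted: "\<And>t. t \<in> {0..T} \<Longrightarrow> Y t \<in> borel_measurable (augmented_filtration M W t)"
    and L_borel [measurable]: "L1 \<in> borel_measurable borel" "L2 \<in> borel_measurable borel"
    and L_deriv: "\<And>x. x > 0 \<Longrightarrow> (L has_real_derivative L1 x) (at x)"
    and L1_deriv: "\<And>x. x > 0 \<Longrightarrow> (L1 has_real_derivative L2 x) (at x)"
    and L2_cont: "continuous_on {0<..} L2"
    and AE_path: "AE \<omega> in M. continuous_on {0..T} (\<lambda>t. W t \<omega>) \<and> continuous_on {0..T} (\<lambda>t. Y t \<omega>) \<and>
       (\<forall>t\<in>{0..T}. 0 < Y t \<omega> \<and> Y t \<omega> = y + integral {0..t} (\<lambda>s. L (Y s \<omega>)) + \<gamma> * (W t \<omega> - W 0 \<omega>))"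
begin

definition regular_path :: "'a \<Rightarrow> bool" where
  "regular_path \<omega> \<longleftrightarrow> continuous_on {0..T} (\<lambda>t. W t \<omega>) \<and> continuous_on {0..T} (\<lambda>t. Y t \<omega>) \<and>
       (\<forall>t\<in>{0..T}. 0 < Y t \<omega> \<and> Y t \<omega> = y + integral {0..t} (\<lambda>s. L (Y s \<omega>)) + \<gamma> * (W t \<omega> - W 0 \<omega>))"

lemma AE_regular_path: "AE \<omega> in completion M. regular_path \<omega>"
  using AE_path unfolding regular_path_def[symmetric] by (rule AE_completion)

definition generator :: "'a \<Rightarrow> real \<Rightarrow> real" where
  "generator \<omega> u = L1 (Y u \<omega>) * L (Y u \<omega>) + \<gamma>\<^sup>2 / 2 * L2 (Y u \<omega>)"

text \<open>By Ito's formula this is the stochastic integral of \<open>\<gamma> * L1 (Y)\<close>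
  against \<open>W\<close>; subtracting the drift defines it without such an integral.\<close>

definition martingale_part :: "real \<Rightarrow> 'a \<Rightarrow> real" where
  "martingale_part t \<omega> = L (Y t \<omega>) - L y - integral {0..t} (generator \<omega>)"

text \<open>Multiplied by the square of \<open>\<gamma>\<close>, this is the bracket of
  \<open>martingale_part\<close> at time \<open>T\<close>.\<close>

definition deriv_energy :: "'a \<Rightarrow> real" where
  "deriv_energy \<omega> = integral {0..T} (\<lambda>u. (L1 (Y u \<omega>))\<^sup>2)"

lemma
  assumes "regular_path \<omega>"
  shows Y_cont: "continuous_on {0..T} (\<lambda>t. Y t \<omega>)"
    and W_cont: "continuous_on {0..T} (\<lambda>t. W t \<omega>)"
    and Y_pos: "\<And>t. t \<in> {0..T} \<Longrightarrow> Y t \<omega> > 0"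
    and LY_cont: "continuous_on {0..T} (\<lambda>t. L (Y t \<omega>))"
    and L1Y_cont: "continuous_on {0..T} (\<lambda>t. L1 (Y t \<omega>))"
    and L2Y_cont: "continuous_on {0..T} (\<lambda>t. L2 (Y t \<omega>))"
    and generator_cont: "continuous_on {0..T} (generator \<omega>)"
    and martingale_part_cont: "continuous_on {0..T} (\<lambda>t. martingale_part t \<omega>)"
    and martingale_part_0: "martingale_part 0 \<omega> = 0"
proof -
  show Y: "continuous_on {0..T} (\<lambda>t. Y t \<omega>)" "continuous_on {0..T} (\<lambda>t. W t \<omega>)"
    "\<And>t. t \<in> {0..T} \<Longrightarrow> Y t \<omega> > 0" using assms unfolding regular_path_def by blast+
  have c: "continuous_on {0<..} L" "continuous_on {0<..} L1"
    using L_deriv L1_deriv by (auto intro!: continuous_at_imp_continuous_on DERIV_isCont)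
  show 1: "continuous_on {0..T} (\<lambda>t. L (Y t \<omega>))" "continuous_on {0..T} (\<lambda>t. L1 (Y t \<omega>))"
    "continuous_on {0..T} (\<lambda>t. L2 (Y t \<omega>))"
    using c L2_cont Y by (auto intro!: continuous_on_compose2[OF _ Y(1)])
  show g: "continuous_on {0..T} (generator \<omega>)"
    unfolding generator_def by (intro continuous_intros 1)
  show "continuous_on {0..T} (\<lambda>t. martingale_part t \<omega>)"
    unfolding martingale_part_def by (intro continuous_intros 1 indefinite_integral_continuous_1 integrable_continuous_real g)
  have "0 \<in> {0..T}" using T_pos by simp
  then have "Y 0 \<omega> = y" using assms unfolding regular_path_def by force
  then show "martingale_part 0 \<omega> = 0" by (simp add: martingale_part_def)
qed

lemma Y_measurable: "t \<in> {0..T} \<Longrightarrow> Y t \<in> borel_measurable (completion M)"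
  using measurable_from_subalg[OF subalgebra_augmented_filtration Y_adapted] by auto

section \<open>Grids with \<open>n * 2 ^ j\<close> steps and the Brownian increments along
  them\<close>

definition grid_step :: "nat \<Rightarrow> nat \<Rightarrow> real" where
  "grid_step n j = T / (real n * 2 ^ j)"

lemma grid_step_pos: "n \<ge> 1 \<Longrightarrow> grid_step n j > 0"
  using T_pos by (simp add: grid_step_def)

lemma grid_time_mem:
  assumes "n \<ge> 1" "l \<le> n * 2 ^ j" shows "real l * grid_step n j \<in> {0..T}"
proof -
  have "real l * grid_step n j \<le> real (n * 2 ^ j) * grid_step n j"
    using assms grid_step_pos[OF assms(1), of j] by (intro mult_right_mono) (simp_all only: of_nat_le_iff less_imp_le)
  also have "\<dots> = T" using assms by (simp add: grid_step_def)
  finally show ?thesis using grid_step_pos[OF assms(1), of j] by simp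
qed

definition grid_filtration :: "nat \<Rightarrow> nat \<Rightarrow> nat \<Rightarrow> 'a measure" where
  "grid_filtration n j l = augmented_filtration M W (real l * grid_step n j)"

definition grid_increment :: "nat \<Rightarrow> nat \<Rightarrow> nat \<Rightarrow> 'a \<Rightarrow> real" where
  "grid_increment n j l \<omega> = W (real (Suc l) * grid_step n j) \<omega> - W (real l * grid_step n j) \<omega>"

lemma augmented_filtration_mono:
  "s \<le> t \<Longrightarrow> sets (augmented_filtration M W s) \<subseteq> sets (augmented_filtration M W t)"
proof -
  assume st: "s \<le> t"
  have G: "{W u -` B \<inter> space M | u B. 0 \<le> u \<and> u \<le> t \<and> B \<in> sets borel} \<union> null_sets (completion M) \<subseteq> Pow (space M)" for t
    using sets.sets_into_space[of _ "completion M"] by (auto simp: null_sets_def)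
  show ?thesis unfolding augmented_filtration_def sets_measure_of[OF G]
    by (rule sigma_sets_mono') (use st in fastforce)
qed

lemma W_measurable_augmented:
  assumes "0 \<le> s" "s \<le> t" shows "W s \<in> borel_measurable (augmented_filtration M W t)"
proof (rule measurableI)
  have G: "{W u -` B \<inter> space M | u B. 0 \<le> u \<and> u \<le> t \<and> B \<in> sets borel} \<union> null_sets (completion M) \<subseteq> Pow (space M)"
    using sets.sets_into_space[of _ "completion M"] by (auto simp: null_sets_def)
  fix A :: "real set" assume "A \<in> sets borel"
  then have "W s -` A \<inter> space M \<in> {W u -` B \<inter> space M | u B. 0 \<le> u \<and> u \<le> t \<and> B \<in> sets borel} \<union> null_sets (completion M)"
    using assms by blast
  then show "W s -` A \<inter> space (augmented_filtration M W t) \<in> sets (augmented_filtration M W t)"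
    unfolding space_augmented_filtration unfolding augmented_filtration_def sets_measure_of[OF G]
    by (rule sigma_sets.Basic)
qed simp

text \<open>The locale asks for increments of every index, including those after \<open>T\<close>;
  they exist because \<open>W\<close> is given for all nonnegative times.\<close>

lemma gaussian_increments_grid:
  assumes n: "n \<ge> 1"
  shows "gaussian_increments (completion M) (grid_filtration n j) (grid_increment n j) (grid_step n j)"
proof -
  note grid_step = grid_step_pos[OF n, of j]
  have less: "0 \<le> real l * grid_step n j" "real l * grid_step n j < real (Suc l) * grid_step n j" for l
    using grid_step by (auto simp: algebra_simps)
  show ?thesis
  proof (intro gaussian_increments.intro gaussian_increments_axioms.intro prob_space_completion grid_step)
    fix l
    show "subalgebra (completion M) (grid_filtration n j l)"
      unfolding grid_filtration_def by (rule subalgebra_augmented_filtration) (use less in auto)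
    show "sets (grid_filtration n j l) \<subseteq> sets (grid_filtration n j (Suc l))"
      unfolding grid_filtration_def by (rule augmented_filtration_mono) (use less in \<open>auto intro: less_imp_le\<close>)
    show "grid_increment n j l \<in> borel_measurable (grid_filtration n j (Suc l))"
      unfolding grid_filtration_def grid_increment_def[abs_def]
      by (intro borel_measurable_diff W_measurable_augmented) (use less less_imp_le in \<open>auto simp del: of_nat_Suc\<close>)
    have d: "distributed M lborel (grid_increment n j l) (normal_density 0 (sqrt (grid_step n j)))"
      using W_increments[OF less] by (simp add: grid_increment_def[abs_def] algebra_simps)
    show "distributed (completion M) lborel (grid_increment n j l) (normal_density 0 (sqrt (grid_step n j)))"
      using d unfolding distributed_def by (auto simp: distr_completion measurable_completion)
    show "prob_space.indep_var (completion M) borel U borel (grid_increment n j l)" if "U \<in> borel_measurable (grid_filtration n j l)" for U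
      unfolding grid_increment_def[abs_def] by (rule indep_augmented_filtration_increment[OF less that[unfolded grid_filtration_def]])
  qed
qed

lemma dyadic_pt_grid:
  assumes "n \<ge> 1"
  shows "dyadic_pt (real i * (T / real n)) (T / real n) j l = real (i * 2 ^ j + l) * grid_step n j"
  using assms by (simp add: dyadic_pt_def grid_step_def field_simps)

lemma sum_block:
  fixes f :: "nat \<Rightarrow> real"
  assumes "i < n"
  shows "(\<Sum>l<n * 2 ^ j. if i * 2 ^ j \<le> l \<and> l < i * 2 ^ j + 2 ^ j then f l else 0) = (\<Sum>l<2 ^ j. f (i * 2 ^ j + l))"
proof -
  have "Suc i * 2 ^ j \<le> n * 2 ^ j" using assms by (intro mult_right_mono) auto
  then have le: "i * 2 ^ j + 2 ^ j \<le> n * 2 ^ j" by (simp add: add.commute)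
  have "(\<Sum>l<n * 2 ^ j. if i * 2 ^ j \<le> l \<and> l < i * 2 ^ j + 2 ^ j then f l else 0)
     = sum f {l\<in>{..<n * 2 ^ j}. i * 2 ^ j \<le> l \<and> l < i * 2 ^ j + 2 ^ j}"
    by (rule sum.inter_filter[symmetric]) simp
  also have "{l\<in>{..<n * 2 ^ j}. i * 2 ^ j \<le> l \<and> l < i * 2 ^ j + 2 ^ j} = {i * 2 ^ j..<i * 2 ^ j + 2 ^ j}"
    using le by auto
  also have "sum f \<dots> = (\<Sum>l<2 ^ j. f (i * 2 ^ j + l))"
    by (rule sum.reindex_bij_witness[where i="\<lambda>l. i * 2 ^ j + l" and j="\<lambda>l. l - i * 2 ^ j"]) auto
  finally show ?thesis .
qed

text \<open>There are \<open>n * 2 ^ j\<close> terms with second moments of order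
  \<open>(grid_step n j)^2\<close>, so the total decays like \<open>(1 / 2) ^ j\<close>, which
  yields almost sure convergence along the full sequence.\<close>

lemma AE_quadratic_variation:
  fixes \<phi> :: "real \<Rightarrow> real" and \<alpha> \<beta> B :: real
  assumes n: "n \<ge> 1" and i: "i < n" and \<phi> [measurable]: "\<phi> \<in> borel_measurable borel" and B: "B \<ge> 0"
  defines "h \<equiv> T / real n"
  defines "x \<equiv> dyadic_pt (real i * h) h"
  shows "AE \<omega> in completion M. (\<lambda>j. \<Sum>l<2 ^ j. (\<alpha> + \<beta> * (real l / 2 ^ j)) * clamp_to B (\<phi> (Y (x j l) \<omega>))
       * ((W (x j (Suc l)) \<omega> - W (x j l) \<omega>)\<^sup>2 - h / 2 ^ j)) \<longlonglongrightarrow> 0"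
proof -
  interpret Mc: prob_space "completion M" by (rule prob_space_completion)
  \<comment> \<open>The weights are extended by zero outside cell \<open>i\<close>, so that the sum
    runs over the global grid, whose filtration starts at time 0.\<close>
  define U where "U = (\<lambda>j l \<omega>. if i * 2 ^ j \<le> l \<and> l < i * 2 ^ j + 2 ^ j
     then (\<alpha> + \<beta> * (real (l - i * 2 ^ j) / 2 ^ j)) * clamp_to B (\<phi> (Y (real l * grid_step n j) \<omega>)) else 0)"
  define S where "S = (\<lambda>j \<omega>. \<Sum>l<n * 2 ^ j. U j l \<omega> * ((grid_increment n j l \<omega>)\<^sup>2 - grid_step n j))"
  have eq: "(\<Sum>l<2 ^ j. (\<alpha> + \<beta> * (real l / 2 ^ j)) * clamp_to B (\<phi> (Y (x j l) \<omega>))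
       * ((W (x j (Suc l)) \<omega> - W (x j l) \<omega>)\<^sup>2 - h / 2 ^ j)) = S j \<omega>" for j \<omega>
  proof -
    have "S j \<omega> = (\<Sum>l<n * 2 ^ j. if i * 2 ^ j \<le> l \<and> l < i * 2 ^ j + 2 ^ j then
        (\<alpha> + \<beta> * (real (l - i * 2 ^ j) / 2 ^ j)) * clamp_to B (\<phi> (Y (real l * grid_step n j) \<omega>)) * ((grid_increment n j l \<omega>)\<^sup>2 - grid_step n j) else 0)"
      unfolding S_def U_def by (rule sum.cong) auto
    also have "\<dots> = (\<Sum>l<2 ^ j. (\<alpha> + \<beta> * (real l / 2 ^ j)) * clamp_to B (\<phi> (Y (real (i * 2 ^ j + l) * grid_step n j) \<omega>))
        * ((grid_increment n j (i * 2 ^ j + l) \<omega>)\<^sup>2 - grid_step n j))"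
      by (subst sum_block[OF i]) (auto intro!: sum.cong)
    moreover have "h / 2 ^ j = grid_step n j" by (simp add: h_def grid_step_def)
    moreover have "x j l = real (i * 2 ^ j + l) * grid_step n j" for l
      unfolding x_def h_def by (rule dyadic_pt_grid[OF n])
    ultimately show ?thesis by (simp add: grid_increment_def del: of_nat_add of_nat_mult of_nat_Suc)
  qed
  have "AE \<omega> in completion M. (\<lambda>j. S j \<omega>) \<longlonglongrightarrow> 0"
  proof (rule Mc.AE_tendsto_0_of_second_moment)
    fix j
    interpret G: gaussian_increments "completion M" "grid_filtration n j" "grid_increment n j" "grid_step n j"
      by (rule gaussian_increments_grid[OF n])
    have Um: "U j l \<in> borel_measurable (grid_filtration n j l)" for l
    proof (cases "l < n * 2 ^ j")
      case True
      have "real l * grid_step n j \<in> {0..T}" using grid_time_mem[OF n] True by simp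
      from Y_adapted[OF this] have [measurable]: "Y (real l * grid_step n j) \<in> borel_measurable (grid_filtration n j l)" by (simp add: grid_filtration_def)
      show ?thesis unfolding U_def by (intro measurable_If) measurable
    next
      case False
      have "Suc i * 2 ^ j \<le> n * 2 ^ j" using i by (intro mult_right_mono) auto
      then have "\<not> (i * 2 ^ j \<le> l \<and> l < i * 2 ^ j + 2 ^ j)" using False by auto
      then have "U j l = (\<lambda>_. 0)" unfolding U_def by auto
      then show ?thesis by simp
    qed
    have Ub: "\<bar>U j l \<omega>\<bar> \<le> (\<bar>\<alpha>\<bar> + \<bar>\<beta>\<bar>) * B" for l \<omega>
    proof (cases "i * 2 ^ j \<le> l \<and> l < i * 2 ^ j + 2 ^ j")
      case True
      then have "l - i * 2 ^ j < 2 ^ j" by auto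
      then have "real (l - i * 2 ^ j) < real (2 ^ j)" by (simp only: of_nat_less_iff)
      then have r: "real (l - i * 2 ^ j) / 2 ^ j \<le> 1" by simp
      have "\<bar>\<beta>\<bar> * (real (l - i * 2 ^ j) / 2 ^ j) \<le> \<bar>\<beta>\<bar> * 1" by (rule mult_left_mono[OF r]) simp
      then have "\<bar>\<alpha> + \<beta> * (real (l - i * 2 ^ j) / 2 ^ j)\<bar> \<le> \<bar>\<alpha>\<bar> + \<bar>\<beta>\<bar>"
        by (intro order_trans[OF abs_triangle_ineq] add_left_mono) (simp add: abs_mult)
      moreover have "\<bar>clamp_to B v\<bar> \<le> B" for v using B by (auto simp: clamp_to_def)
      ultimately show ?thesis using True unfolding U_def by (auto simp: abs_mult intro!: mult_mono)
    qed (use B in \<open>auto simp: U_def\<close>)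
    note sm = G.second_moment_square_sum_le[OF Um Ub, of "n * 2 ^ j"]
    show "S j \<in> borel_measurable (completion M)"
      unfolding S_def using G.measurable_F_M[OF Um] G.\<xi>_borel_measurable by measurable
    show "integrable (completion M) (\<lambda>\<omega>. (S j \<omega>)\<^sup>2)" unfolding S_def by (rule sm(1))
    have "Mc.expectation (\<lambda>\<omega>. (S j \<omega>)\<^sup>2) \<le> real (n * 2 ^ j) * (((\<bar>\<alpha>\<bar> + \<bar>\<beta>\<bar>) * B)\<^sup>2 * (gaussian_moment 2 * (grid_step n j)\<^sup>2))"
      unfolding S_def by (rule sm(2))
    also have "\<dots> = (((\<bar>\<alpha>\<bar> + \<bar>\<beta>\<bar>) * B)\<^sup>2 * gaussian_moment 2 * T\<^sup>2 / real n) * (1 / 2) ^ j"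
      using n by (simp add: grid_step_def power2_eq_square field_simps power_one_over)
    finally show "Mc.expectation (\<lambda>\<omega>. (S j \<omega>)\<^sup>2) \<le> (((\<bar>\<alpha>\<bar> + \<bar>\<beta>\<bar>) * B)\<^sup>2 * gaussian_moment 2 * T\<^sup>2 / real n) * (1 / 2) ^ j" .
  qed
  then show ?thesis by (simp only: eq)
qed

text \<open>The integral of \<open>\<alpha> + \<beta> * (u - c) / h\<close> against
  \<open>martingale_part\<close> over cell \<open>i\<close>, written in the form it takes after
  partial integration.\<close>

definition block_limit :: "real \<Rightarrow> real \<Rightarrow> nat \<Rightarrow> nat \<Rightarrow> 'a \<Rightarrow> real" where
  "block_limit \<alpha> \<beta> n i \<omega> = (let h = T / real n; c = real i * h in
     \<alpha> * (martingale_part (c + h) \<omega> - martingale_part c \<omega>) + \<beta> * (martingale_part (c + h) \<omega> - integral {c..c + h} (\<lambda>u. martingale_part u \<omega>) / h))"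

definition weighted_martingale :: "real \<Rightarrow> real \<Rightarrow> nat \<Rightarrow> nat \<Rightarrow> 'a \<Rightarrow> real" where
  "weighted_martingale \<alpha> \<beta> n i \<omega> = (\<Sum>k<i. block_limit \<alpha> \<beta> n k \<omega>)"

lemma block_subset:
  assumes "n \<ge> 1" "i < n"
  shows "0 \<le> real i * (T / real n)" "real i * (T / real n) + T / real n \<le> T" "T / real n > 0"
proof -
  have "real (Suc i) * (T / real n) \<le> real n * (T / real n)"
    using assms T_pos by (intro mult_right_mono) auto
  then show "real i * (T / real n) + T / real n \<le> T" using assms by (simp add: algebra_simps add_divide_distrib)
qed (use assms T_pos in auto)

text \<open>The quadratic variation statements for all natural truncation levels hold outside one
  null set. On a given path a level above the maximum of \<open>|L2 (Y)|\<close> on the cell is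
  chosen, and the pathwise Ito formula applies to the untruncated weights.\<close>

lemma AE_block_limit:
  assumes n: "n \<ge> 1" and i: "i < n"
  defines "h \<equiv> T / real n"
  defines "x \<equiv> dyadic_pt (real i * h) h"
  shows "AE \<omega> in completion M. (\<lambda>j. \<Sum>l<2 ^ j. (\<alpha> + \<beta> * (real l / 2 ^ j)) * L1 (Y (x j l) \<omega>) * \<gamma>
      * (W (x j (Suc l)) \<omega> - W (x j l) \<omega>)) \<longlonglongrightarrow> block_limit \<alpha> \<beta> n i \<omega>"
proof -
  define c where "c = real i * h"
  have ch: "0 \<le> c" "c + h \<le> T" "h > 0" using block_subset[OF n i] by (auto simp: c_def h_def)
  have sub: "{c..c + h} \<subseteq> {0..T}" using ch by auto
  have A1: "AE \<omega> in completion M. \<forall>b::nat. (\<lambda>j. \<Sum>l<2 ^ j. (\<alpha> + \<beta> * (real l / 2 ^ j)) * clamp_to (real b) (L2 (Y (x j l) \<omega>))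
       * ((W (x j (Suc l)) \<omega> - W (x j l) \<omega>)\<^sup>2 - h / 2 ^ j)) \<longlonglongrightarrow> 0"
    unfolding AE_all_countable x_def h_def by (intro allI AE_quadratic_variation[OF n i]) auto
  \<comment> \<open>Since \<open>clamp_to 1 1 = 1\<close>, this instance is the plain quadratic
    variation of \<open>W\<close>.\<close>
  have A2: "AE \<omega> in completion M. (\<lambda>j. \<Sum>l<2 ^ j. (1 + 0 * (real l / 2 ^ j)) * clamp_to 1 1
       * ((W (x j (Suc l)) \<omega> - W (x j l) \<omega>)\<^sup>2 - h / 2 ^ j)) \<longlonglongrightarrow> 0"
    using AE_quadratic_variation[OF n i, of "\<lambda>_. 1" 1 1 0] unfolding x_def h_def by auto
  from A1 A2 AE_regular_path show ?thesis
  proof eventually_elim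
    case (elim \<omega>)
    note g = elim(3)
    note cont = Y_cont[OF g] W_cont[OF g] LY_cont[OF g] L2Y_cont[OF g] generator_cont[OF g]
    note cont' = cont[THEN continuous_on_subset, OF sub]
    have ig: "f integrable_on {s..t}" if "continuous_on {0..T} f" "0 \<le> s" "t \<le> T" for f :: "real \<Rightarrow> real" and s t
      by (rule integrable_continuous_real, rule continuous_on_subset[OF that(1)]) (use that in auto)
    have comb: "integral {0..t} f - integral {0..s} f = integral {s..t} f"
      if "continuous_on {0..T} f" "0 \<le> s" "s \<le> t" "t \<le> T" for f :: "real \<Rightarrow> real" and s t
      using Henstock_Kurzweil_Integration.integral_combine[OF that(2,3) ig[OF that(1) order_refl that(4)]] by simp
    have "compact ((\<lambda>u. L2 (Y u \<omega>)) ` {c..c + h})" using cont' by (intro compact_continuous_image) auto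
    then obtain b' where b': "\<And>u. u \<in> {c..c + h} \<Longrightarrow> \<bar>L2 (Y u \<omega>)\<bar> \<le> b'"
      by (force dest!: compact_imp_bounded simp: bounded_iff)
    obtain b :: nat where b: "b' \<le> real b" using real_arch_simple by blast
    have "(\<lambda>j. \<Sum>l<2 ^ j. (\<alpha> + \<beta> * (real l / 2 ^ j)) * L1 (Y (x j l) \<omega>) * \<gamma> * (W (x j (Suc l)) \<omega> - W (x j l) \<omega>))
      \<longlonglongrightarrow> \<alpha> * (martingale_part (c + h) \<omega> - martingale_part c \<omega>) + \<beta> * (martingale_part (c + h) \<omega> - integral {c..c + h} (\<lambda>u. martingale_part u \<omega>) / h)"
      unfolding x_def c_def[symmetric]
    proof (rule pathwise_ito_dyadic[where f=L and f'=L1 and f''=L2 and b="\<lambda>u. L (Y u \<omega>)" and Y="\<lambda>u. Y u \<omega>" and w="\<lambda>u. W u \<omega>" and N="\<lambda>u. martingale_part u \<omega>"])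
      show "0 < Y t \<omega>" if "t \<in> {c..c + h}" for t using Y_pos[OF g] sub that by blast
      show "Y t \<omega> - Y s \<omega> = integral {s..t} (\<lambda>u. L (Y u \<omega>)) + \<gamma> * (W t \<omega> - W s \<omega>)"
        if st: "c \<le> s" "s \<le> t" "t \<le> c + h" for s t
      proof -
        have "s \<in> {0..T}" "t \<in> {0..T}" using st ch by auto
        then have "Y s \<omega> = y + integral {0..s} (\<lambda>s. L (Y s \<omega>)) + \<gamma> * (W s \<omega> - W 0 \<omega>)"
          "Y t \<omega> = y + integral {0..t} (\<lambda>s. L (Y s \<omega>)) + \<gamma> * (W t \<omega> - W 0 \<omega>)"
          using g unfolding regular_path_def by blast+
        then show ?thesis using comb[OF cont(3), of s t] st ch by (simp add: algebra_simps)
      qed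
      show "martingale_part t \<omega> = martingale_part c \<omega> + (L (Y t \<omega>) - L (Y c \<omega>)) - integral {c..t} (\<lambda>u. L1 (Y u \<omega>) * L (Y u \<omega>) + \<gamma>\<^sup>2 / 2 * L2 (Y u \<omega>))"
        if "t \<in> {c..c + h}" for t
        using comb[OF cont(5), of c t] that ch by (simp add: martingale_part_def generator_def[abs_def])
      show "(\<lambda>j. \<Sum>l<2 ^ j. (W (dyadic_pt c h j (Suc l)) \<omega> - W (dyadic_pt c h j l) \<omega>)\<^sup>2 - h / 2 ^ j) \<longlonglongrightarrow> 0"
        using elim(2) by (simp add: clamp_to_def x_def c_def)
      have "clamp_to (real b) (L2 (Y (x j l) \<omega>)) = L2 (Y (x j l) \<omega>)" if "l < 2 ^ j" for j l
        using b'[OF dyadic_pt_mem[OF ch(3), of l j]] that b by (auto simp: clamp_to_def x_def c_def)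
      then have "(\<Sum>l<2 ^ j. (\<alpha> + \<beta> * (real l / 2 ^ j)) * clamp_to (real b) (L2 (Y (x j l) \<omega>))
       * ((W (x j (Suc l)) \<omega> - W (x j l) \<omega>)\<^sup>2 - h / 2 ^ j))
       = (\<Sum>l<2 ^ j. (\<alpha> + \<beta> * (real l / 2 ^ j)) * L2 (Y (x j l) \<omega>)
       * ((W (x j (Suc l)) \<omega> - W (x j l) \<omega>)\<^sup>2 - h / 2 ^ j))" for j
        by (intro sum.cong) auto
      then show "(\<lambda>j. \<Sum>l<2 ^ j. (\<alpha> + \<beta> * (real l / 2 ^ j)) * L2 (Y (dyadic_pt c h j l) \<omega>)
       * ((W (dyadic_pt c h j (Suc l)) \<omega> - W (dyadic_pt c h j l) \<omega>)\<^sup>2 - h / 2 ^ j)) \<longlonglongrightarrow> 0"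
        using elim(1)[rule_format, of b] unfolding x_def c_def by simp
    qed (use ch cont' L_deriv L1_deriv L2_cont in auto)
    then show ?case by (simp add: block_limit_def Let_def h_def c_def)
  qed
qed

text \<open>The quotient \<open>real (l mod 2 ^ j) / 2 ^ j\<close> is the elapsed fraction of the
  current cell of the scheme. From time \<open>T\<close> on, the value 0 keeps the integrand
  adapted, as \<open>Y\<close> is adapted up to \<open>T\<close>.\<close>

definition grid_integrand :: "real \<Rightarrow> real \<Rightarrow> nat \<Rightarrow> nat \<Rightarrow> nat \<Rightarrow> 'a \<Rightarrow> real" where
  "grid_integrand \<alpha> \<beta> n j l \<omega> = (if l < n * 2 ^ j then (\<alpha> + \<beta> * (real (l mod 2 ^ j) / 2 ^ j)) * L1 (Y (real l * grid_step n j) \<omega>) * \<gamma> else 0)"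

lemma grid_integrand_measurable: 
  assumes n: "n \<ge> 1"
  shows "grid_integrand \<alpha> \<beta> n j l \<in> borel_measurable (grid_filtration n j l)"
proof (cases "l < n * 2 ^ j")
  case True
  have "real l * grid_step n j \<in> {0..T}" using grid_time_mem[OF n] True by simp
  from Y_adapted[OF this] have [measurable]: "Y (real l * grid_step n j) \<in> borel_measurable (grid_filtration n j l)" by (simp add: grid_filtration_def)
  show ?thesis unfolding grid_integrand_def using True by simp
qed (simp add: grid_integrand_def[abs_def])

definition grid_transform :: "real \<Rightarrow> real \<Rightarrow> nat \<Rightarrow> nat \<Rightarrow> nat \<Rightarrow> 'a \<Rightarrow> real" where
  "grid_transform \<alpha> \<beta> n j k \<omega> = (\<Sum>l<k. grid_integrand \<alpha> \<beta> n j l \<omega> * grid_increment n j l \<omega>)"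

lemma AE_grid_transform_tendsto:
  assumes n: "n \<ge> 1"
  shows "AE \<omega> in completion M. \<forall>i\<le>n. (\<lambda>j. grid_transform \<alpha> \<beta> n j (i * 2 ^ j) \<omega>) \<longlonglongrightarrow> weighted_martingale \<alpha> \<beta> n i \<omega>"
proof -
  have "AE \<omega> in completion M. \<forall>i\<in>{..<n}. (\<lambda>j. \<Sum>l<2 ^ j. grid_integrand \<alpha> \<beta> n j (i * 2 ^ j + l) \<omega> * grid_increment n j (i * 2 ^ j + l) \<omega>)
     \<longlonglongrightarrow> block_limit \<alpha> \<beta> n i \<omega>"
    unfolding AE_ball_countable[OF countable_finite[OF finite_lessThan]]
  proof
    fix i assume "i \<in> {..<n}"
    then have i: "i < n" by simp
    have eq: "(\<Sum>l<2 ^ j. (\<alpha> + \<beta> * (real l / 2 ^ j)) * L1 (Y (dyadic_pt (real i * (T / real n)) (T / real n) j l) \<omega>) * \<gamma>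
      * (W (dyadic_pt (real i * (T / real n)) (T / real n) j (Suc l)) \<omega> - W (dyadic_pt (real i * (T / real n)) (T / real n) j l) \<omega>))
      = (\<Sum>l<2 ^ j. grid_integrand \<alpha> \<beta> n j (i * 2 ^ j + l) \<omega> * grid_increment n j (i * 2 ^ j + l) \<omega>)" for j \<omega>
      unfolding dyadic_pt_grid[OF n]
    proof (rule sum.cong[OF refl])
      fix l assume "l \<in> {..<(2::nat) ^ j}"
      moreover have "Suc i * 2 ^ j \<le> n * 2 ^ j" using i by (intro mult_right_mono) auto
      ultimately have "i * 2 ^ j + l < n * 2 ^ j" "(i * 2 ^ j + l) mod 2 ^ j = l" by auto
      then show "(\<alpha> + \<beta> * (real l / 2 ^ j)) * L1 (Y (real (i * 2 ^ j + l) * grid_step n j) \<omega>) * \<gamma>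
        * (W (real (i * 2 ^ j + Suc l) * grid_step n j) \<omega> - W (real (i * 2 ^ j + l) * grid_step n j) \<omega>)
        = grid_integrand \<alpha> \<beta> n j (i * 2 ^ j + l) \<omega> * grid_increment n j (i * 2 ^ j + l) \<omega>"
        by (simp add: grid_integrand_def grid_increment_def)
    qed
    show "AE \<omega> in completion M. (\<lambda>j. \<Sum>l<2 ^ j. grid_integrand \<alpha> \<beta> n j (i * 2 ^ j + l) \<omega> * grid_increment n j (i * 2 ^ j + l) \<omega>)
     \<longlonglongrightarrow> block_limit \<alpha> \<beta> n i \<omega>"
      using AE_block_limit[OF n i, of \<alpha> \<beta>] unfolding eq .
  qed
  then show ?thesis
  proof eventually_elim
    case (elim \<omega>)
    show ?case
    proof (intro allI impI)
      fix i assume i: "i \<le> n"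
      have "grid_transform \<alpha> \<beta> n j (i * 2 ^ j) \<omega> = (\<Sum>k<i. \<Sum>l<2 ^ j. grid_integrand \<alpha> \<beta> n j (k * 2 ^ j + l) \<omega> * grid_increment n j (k * 2 ^ j + l) \<omega>)" for j
        unfolding grid_transform_def by (rule sum_nat_blocks)
      then show "(\<lambda>j. grid_transform \<alpha> \<beta> n j (i * 2 ^ j) \<omega>) \<longlonglongrightarrow> weighted_martingale \<alpha> \<beta> n i \<omega>"
        unfolding weighted_martingale_def using elim i by (auto intro!: tendsto_sum)
    qed
  qed
qed

definition grid_bracket :: "nat \<Rightarrow> nat \<Rightarrow> 'a \<Rightarrow> real" where
  "grid_bracket n j \<omega> = (\<Sum>l<n * 2 ^ j. (L1 (Y (real l * grid_step n j) \<omega>))\<^sup>2 * grid_step n j)"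

lemma grid_riemann_tendsto:
  fixes f :: "real \<Rightarrow> real"
  assumes n: "n \<ge> 1" and f: "continuous_on {0..T} f"
  shows "(\<lambda>j. \<Sum>l<n * 2 ^ j. f (real l * grid_step n j) * grid_step n j) \<longlonglongrightarrow> integral {0..T} f"
proof -
  let ?h = "T / real n"
  have "(\<lambda>j. \<Sum>l<2 ^ j. f (dyadic_pt (real i * ?h) ?h j l) * (?h / 2 ^ j)) \<longlonglongrightarrow> integral {real i * ?h..real i * ?h + ?h} f"
    if "i < n" for i
    using block_subset[OF n that] by (intro dyadic_riemann_tendsto' continuous_on_subset[OF f]) auto
  then have "(\<lambda>j. \<Sum>i<n. \<Sum>l<2 ^ j. f (dyadic_pt (real i * ?h) ?h j l) * (?h / 2 ^ j))
    \<longlonglongrightarrow> (\<Sum>i<n. integral {real i * ?h..real i * ?h + ?h} f)"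
    by (intro tendsto_sum) auto
  also have "(\<Sum>i<n. integral {real i * ?h..real i * ?h + ?h} f) = integral {0..T} f"
    using integral_uniform_partition[of ?h n f n] n T_pos f by simp
  also have "(\<lambda>j. \<Sum>i<n. \<Sum>l<2 ^ j. f (dyadic_pt (real i * ?h) ?h j l) * (?h / 2 ^ j))
    = (\<lambda>j. \<Sum>l<n * 2 ^ j. f (real l * grid_step n j) * grid_step n j)"
  proof
    fix j
    have "?h / 2 ^ j = grid_step n j" by (simp add: grid_step_def)
    then show "(\<Sum>i<n. \<Sum>l<2 ^ j. f (dyadic_pt (real i * ?h) ?h j l) * (?h / 2 ^ j)) = (\<Sum>l<n * 2 ^ j. f (real l * grid_step n j) * grid_step n j)"
      unfolding dyadic_pt_grid[OF n] sum_nat_blocks by simp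
  qed
  finally show ?thesis .
qed

lemma AE_grid_bracket_tendsto:
  assumes n: "n \<ge> 1"
  shows "AE \<omega> in completion M. (\<lambda>j. grid_bracket n j \<omega>) \<longlonglongrightarrow> deriv_energy \<omega>"
  using AE_regular_path
proof eventually_elim
  case (elim \<omega>)
  have "continuous_on {0..T} (\<lambda>u. (L1 (Y u \<omega>))\<^sup>2)" by (intro continuous_intros L1Y_cont[OF elim])
  from grid_riemann_tendsto[OF n this] show ?case by (simp add: grid_bracket_def deriv_energy_def)
qed

lemma Y_grid_measurable: "n \<ge> 1 \<Longrightarrow> l \<le> n * 2 ^ j \<Longrightarrow> Y (real l * grid_step n j) \<in> borel_measurable (completion M)"
  by (rule Y_measurable[OF grid_time_mem])

lemma grid_bracket_measurable: "n \<ge> 1 \<Longrightarrow> grid_bracket n j \<in> borel_measurable (completion M)"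
  unfolding grid_bracket_def
proof (rule borel_measurable_sum)
  fix l assume "n \<ge> 1" "l \<in> {..<n * 2 ^ j}"
  then have [measurable]: "Y (real l * grid_step n j) \<in> borel_measurable (completion M)"
    by (intro Y_grid_measurable) auto
  show "(\<lambda>\<omega>. (L1 (Y (real l * grid_step n j) \<omega>))\<^sup>2 * grid_step n j) \<in> borel_measurable (completion M)" by measurable
qed

lemma grid_transform_measurable:
  assumes n: "n \<ge> 1"
  shows "grid_transform \<alpha> \<beta> n j k \<in> borel_measurable (completion M)"
proof -
  interpret G: gaussian_increments "completion M" "grid_filtration n j" "grid_increment n j" "grid_step n j"
    by (rule gaussian_increments_grid[OF n])
  show ?thesis unfolding grid_transform_def
    using G.measurable_F_M[OF grid_integrand_measurable[OF n]] G.\<xi>_borel_measurable by measurable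
qed

lemma deriv_energy_measurable: "deriv_energy \<in> borel_measurable (completion M)"
  by (rule borel_measurable_completion_AE_limit[OF grid_bracket_measurable AE_grid_bracket_tendsto[of 1]]) auto

lemma weighted_martingale_measurable:
  assumes "n \<ge> 1" "i \<le> n" shows "weighted_martingale \<alpha> \<beta> n i \<in> borel_measurable (completion M)"
  by (rule borel_measurable_completion_AE_limit[OF grid_transform_measurable[OF assms(1)]])
    (use AE_grid_transform_tendsto[OF assms(1), of \<alpha> \<beta>] assms(2) in \<open>auto elim!: eventually_mono\<close>)

lemma deriv_energy_nonneg: "0 \<le> deriv_energy \<omega>"
proof (cases "(\<lambda>u. (L1 (Y u \<omega>))\<^sup>2) integrable_on {0..T}")
  case True
  then show ?thesis unfolding deriv_energy_def by (intro Henstock_Kurzweil_Integration.integral_nonneg) auto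
qed (simp add: deriv_energy_def not_integrable_integral)

lemma grid_bracket_nonneg: "n \<ge> 1 \<Longrightarrow> 0 \<le> grid_bracket n j \<omega>"
  unfolding grid_bracket_def using grid_step_pos[of n j] by (intro sum_nonneg) auto

section \<open>Maximal and moment inequalities for the limiting martingales\<close>

lemma weak_type_grid_transform:
  assumes n: "n \<ge> 1" and t: "t > 0" and ab: "0 \<le> \<alpha>" "0 \<le> \<beta>" "\<alpha> + \<beta> \<le> 1"
  shows "measure (completion M) {\<omega>\<in>space M. \<exists>i\<le>n. t < \<bar>grid_transform \<alpha> \<beta> n j (i * 2 ^ j) \<omega>\<bar>}
    \<le> weak_const r * (\<integral>\<omega>. min (\<gamma>\<^sup>2 * grid_bracket n j \<omega> / t\<^sup>2) 1 ^ Suc r \<partial>completion M)"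
proof -
  interpret G: gaussian_increments "completion M" "grid_filtration n j" "grid_increment n j" "grid_step n j"
    by (rule gaussian_increments_grid[OF n])
  note [measurable] = grid_transform_measurable[OF n] grid_bracket_measurable[OF n]
  have tr: "G.transform (grid_integrand \<alpha> \<beta> n j) k = grid_transform \<alpha> \<beta> n j k" for k
    by (rule ext) (simp add: G.transform_def grid_transform_def)
  \<comment> \<open>The weight lies in \<open>{0..1}\<close>, so all admissible weights share one
    bracket bound. This is why the plain and the weighted martingale obey the same
    inequality.\<close>
  have br: "G.bracket (grid_integrand \<alpha> \<beta> n j) (n * 2 ^ j) \<omega> \<le> \<gamma>\<^sup>2 * grid_bracket n j \<omega>" for \<omega>
    unfolding G.bracket_def grid_bracket_def sum_distrib_left
  proof (rule sum_mono)
    fix l assume "l \<in> {..<n * 2 ^ j}"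
    define q where "q = \<alpha> + \<beta> * (real (l mod 2 ^ j) / 2 ^ j)"
    have "l mod 2 ^ j < 2 ^ j" by simp
    then have "real (l mod 2 ^ j) < real (2 ^ j)" by (simp only: of_nat_less_iff)
    then have "real (l mod 2 ^ j) / 2 ^ j \<le> 1" by simp
    then have "\<beta> * (real (l mod 2 ^ j) / 2 ^ j) \<le> \<beta> * 1" using ab by (intro mult_left_mono) auto
    then have q: "0 \<le> q" "q \<le> 1" using ab by (auto simp: q_def)
    have "(grid_integrand \<alpha> \<beta> n j l \<omega>)\<^sup>2 = q\<^sup>2 * (\<gamma>\<^sup>2 * (L1 (Y (real l * grid_step n j) \<omega>))\<^sup>2)"
      using \<open>l \<in> _\<close> by (simp add: grid_integrand_def q_def power_mult_distrib)
    also have "\<dots> \<le> 1 * (\<gamma>\<^sup>2 * (L1 (Y (real l * grid_step n j) \<omega>))\<^sup>2)"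
      using q by (intro mult_right_mono power_le_one) auto
    finally have "(grid_integrand \<alpha> \<beta> n j l \<omega>)\<^sup>2 * grid_step n j \<le> 1 * (\<gamma>\<^sup>2 * (L1 (Y (real l * grid_step n j) \<omega>))\<^sup>2) * grid_step n j"
      using grid_step_pos[OF n, of j] by (intro mult_right_mono) auto
    then show "(grid_integrand \<alpha> \<beta> n j l \<omega>)\<^sup>2 * grid_step n j \<le> \<gamma>\<^sup>2 * ((L1 (Y (real l * grid_step n j) \<omega>))\<^sup>2 * grid_step n j)"
      by (simp add: mult.assoc)
  qed
  have "G.prob {\<omega>\<in>space M. \<exists>i\<le>n. t < \<bar>grid_transform \<alpha> \<beta> n j (i * 2 ^ j) \<omega>\<bar>}
    \<le> G.prob {\<omega>\<in>space (completion M). \<exists>k\<le>n * 2 ^ j. t < \<bar>G.transform (grid_integrand \<alpha> \<beta> n j) k \<omega>\<bar>}"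
    unfolding tr
  proof (rule G.finite_measure_mono)
    show "{\<omega>\<in>space (completion M). \<exists>k\<le>n * 2 ^ j. t < \<bar>grid_transform \<alpha> \<beta> n j k \<omega>\<bar>} \<in> G.events" by measurable
    show "{\<omega>\<in>space M. \<exists>i\<le>n. t < \<bar>grid_transform \<alpha> \<beta> n j (i * 2 ^ j) \<omega>\<bar>}
      \<subseteq> {\<omega>\<in>space (completion M). \<exists>k\<le>n * 2 ^ j. t < \<bar>grid_transform \<alpha> \<beta> n j k \<omega>\<bar>}"
      by auto (meson mult_le_mono1)
  qed
  also have "\<dots> \<le> weak_const r * G.expectation (\<lambda>\<omega>. min (G.bracket (grid_integrand \<alpha> \<beta> n j) (n * 2 ^ j) \<omega> / t\<^sup>2) 1 ^ Suc r)"
    by (rule G.weak_type_transform[OF grid_integrand_measurable[OF n] t])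
  also have "\<dots> \<le> weak_const r * G.expectation (\<lambda>\<omega>. min (\<gamma>\<^sup>2 * grid_bracket n j \<omega> / t\<^sup>2) 1 ^ Suc r)"
  proof (intro mult_left_mono integral_mono)
    have [measurable]: "G.bracket (grid_integrand \<alpha> \<beta> n j) (n * 2 ^ j) \<in> borel_measurable (completion M)"
      using G.measurable_F_M[OF G.bracket_measurable[OF grid_integrand_measurable[OF n] le_SucI[OF order_refl]]] .
    have nn: "0 \<le> G.bracket (grid_integrand \<alpha> \<beta> n j) (n * 2 ^ j) \<omega>" for \<omega> by (rule G.bracket_nonneg)
    show "integrable (completion M) (\<lambda>\<omega>. min (G.bracket (grid_integrand \<alpha> \<beta> n j) (n * 2 ^ j) \<omega> / t\<^sup>2) 1 ^ Suc r)"
      by (rule G.integrable_const_bound[of _ 1]) (use nn in \<open>auto simp: power_abs intro!: power_le_one simp del: power_Suc\<close>)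
    show "integrable (completion M) (\<lambda>\<omega>. min (\<gamma>\<^sup>2 * grid_bracket n j \<omega> / t\<^sup>2) 1 ^ Suc r)"
      by (rule G.integrable_const_bound[of _ 1]) (use grid_bracket_nonneg[OF n] in \<open>auto simp: power_abs intro!: power_le_one simp del: power_Suc\<close>)
    show "min (G.bracket (grid_integrand \<alpha> \<beta> n j) (n * 2 ^ j) \<omega> / t\<^sup>2) 1 ^ Suc r \<le> min (\<gamma>\<^sup>2 * grid_bracket n j \<omega> / t\<^sup>2) 1 ^ Suc r" for \<omega>
      using nn[of \<omega>] br[of \<omega>] t by (intro power_mono min.mono divide_right_mono) auto
  qed (use weak_const_ge_1[of r] in auto)
  finally show ?thesis .
qed

text \<open>Exceeding \<open>t\<close> strictly is an open condition, so the indicator of the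
  limiting event is at most the lower limit of the indicators on the grids, and Fatou's lemma
  applies. On the right the truncated brackets converge under the majorant 1.\<close>

lemma weak_type_weighted_martingale:
  assumes n: "n \<ge> 1" and t: "t > 0" and ab: "0 \<le> \<alpha>" "0 \<le> \<beta>" "\<alpha> + \<beta> \<le> 1"
  shows "measure (completion M) {\<omega>\<in>space M. \<exists>i\<le>n. t < \<bar>weighted_martingale \<alpha> \<beta> n i \<omega>\<bar>}
    \<le> weak_const r * (\<integral>\<omega>. min (\<gamma>\<^sup>2 * deriv_energy \<omega> / t\<^sup>2) 1 ^ Suc r \<partial>completion M)"
proof -
  interpret Mc: prob_space "completion M" by (rule prob_space_completion)
  note [measurable] = grid_transform_measurable[OF n] grid_bracket_measurable[OF n] deriv_energy_measurable
  define A where "A = {\<omega>\<in>space M. \<exists>i\<le>n. t < \<bar>weighted_martingale \<alpha> \<beta> n i \<omega>\<bar>}"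
  define Aj where "Aj = (\<lambda>j. {\<omega>\<in>space M. \<exists>i\<le>n. t < \<bar>grid_transform \<alpha> \<beta> n j (i * 2 ^ j) \<omega>\<bar>})"
  have Am: "A \<in> Mc.events"
  proof -
    have "A = (\<Union>i\<in>{..n}. {\<omega>\<in>space (completion M). t < \<bar>weighted_martingale \<alpha> \<beta> n i \<omega>\<bar>})" by (auto simp: A_def)
    also have "\<dots> \<in> Mc.events"
    proof (intro sets.finite_UN)
      fix i assume "i \<in> {..n}"
      then have [measurable]: "weighted_martingale \<alpha> \<beta> n i \<in> borel_measurable (completion M)" using weighted_martingale_measurable[OF n] by simp
      show "{\<omega>\<in>space (completion M). t < \<bar>weighted_martingale \<alpha> \<beta> n i \<omega>\<bar>} \<in> Mc.events" by measurable
    qed simp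
    finally show ?thesis .
  qed
  have Ajm: "Aj j \<in> Mc.events" for j
  proof -
    have "{\<omega>\<in>space (completion M). \<exists>i\<le>n. t < \<bar>grid_transform \<alpha> \<beta> n j (i * 2 ^ j) \<omega>\<bar>} \<in> Mc.events" by measurable
    then show ?thesis by (simp only: Aj_def space_completion)
  qed
  define E where "E = (\<lambda>j. \<integral>\<omega>. min (\<gamma>\<^sup>2 * grid_bracket n j \<omega> / t\<^sup>2) 1 ^ Suc r \<partial>completion M)"
  define E' where "E' = (\<integral>\<omega>. min (\<gamma>\<^sup>2 * deriv_energy \<omega> / t\<^sup>2) 1 ^ Suc r \<partial>completion M)"
  have E: "E \<longlonglongrightarrow> E'" unfolding E_def E'_def
  proof (rule integral_dominated_convergence[where w="\<lambda>_. 1"])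
    show "AE \<omega> in completion M. (\<lambda>j. min (\<gamma>\<^sup>2 * grid_bracket n j \<omega> / t\<^sup>2) 1 ^ Suc r) \<longlonglongrightarrow> min (\<gamma>\<^sup>2 * deriv_energy \<omega> / t\<^sup>2) 1 ^ Suc r"
      using AE_grid_bracket_tendsto[OF n] by eventually_elim (use t in \<open>intro tendsto_intros tendsto_min; auto\<close>)
    show "AE \<omega> in completion M. norm (min (\<gamma>\<^sup>2 * grid_bracket n j \<omega> / t\<^sup>2) 1 ^ Suc r) \<le> 1" for j
      by (rule AE_I2) (use grid_bracket_nonneg[OF n] in \<open>auto simp: power_abs intro!: power_le_one simp del: power_Suc\<close>)
  qed auto
  have le: "Mc.prob (Aj j) \<le> weak_const r * E j" for j
    unfolding Aj_def E_def by (rule weak_type_grid_transform[OF n t ab])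
  have "ennreal (Mc.prob A) = (\<integral>\<^sup>+\<omega>. indicator A \<omega> \<partial>completion M)"
    using Am by (simp add: Mc.emeasure_eq_measure)
  also have "\<dots> \<le> (\<integral>\<^sup>+\<omega>. liminf (\<lambda>j. indicator (Aj j) \<omega>) \<partial>completion M)"
  proof (rule nn_integral_mono_AE)
    show "AE \<omega> in completion M. indicator A \<omega> \<le> liminf (\<lambda>j. indicator (Aj j) \<omega> :: ennreal)"
      using AE_grid_transform_tendsto[OF n, of \<alpha> \<beta>]
    proof eventually_elim
      case (elim \<omega>)
      show ?case
      proof (cases "\<omega> \<in> A")
        case True
        then obtain i where i: "i \<le> n" "t < \<bar>weighted_martingale \<alpha> \<beta> n i \<omega>\<bar>" "\<omega> \<in> space M" by (auto simp: A_def)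
        have "(\<lambda>j. \<bar>grid_transform \<alpha> \<beta> n j (i * 2 ^ j) \<omega>\<bar>) \<longlonglongrightarrow> \<bar>weighted_martingale \<alpha> \<beta> n i \<omega>\<bar>"
          using elim i(1) by (intro tendsto_rabs) auto
        then have "\<forall>\<^sub>F j in sequentially. t < \<bar>grid_transform \<alpha> \<beta> n j (i * 2 ^ j) \<omega>\<bar>"
          using i(2) by (rule order_tendstoD)
        then have "\<forall>\<^sub>F j in sequentially. (1::ennreal) \<le> indicator (Aj j) \<omega>"
        proof eventually_elim
          case (elim j)
          then have "\<omega> \<in> Aj j" unfolding Aj_def using i by blast
          then show ?case by simp
        qed
        then show ?thesis using True by (auto intro: Liminf_bounded)
      qed simp
    qed
  qed
  also have "\<dots> \<le> liminf (\<lambda>j. \<integral>\<^sup>+\<omega>. indicator (Aj j) \<omega> \<partial>completion M)"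
    by (rule nn_integral_liminf) (use Ajm in auto)
  also have "\<dots> = liminf (\<lambda>j. ennreal (Mc.prob (Aj j)))"
    using Ajm by (simp add: Mc.emeasure_eq_measure)
  also have "\<dots> \<le> liminf (\<lambda>j. ennreal (weak_const r * E j))"
    by (intro Liminf_mono always_eventually allI ennreal_leI le)
  also have "\<dots> = ennreal (weak_const r * E')"
    by (intro lim_imp_Liminf tendsto_ennrealI tendsto_intros E) auto
  finally have "Mc.prob A \<le> weak_const r * E'"
    using weak_const_ge_1[of r] deriv_energy_nonneg by (subst (asm) ennreal_le_iff) (auto simp: E'_def intro!: integral_nonneg_AE mult_nonneg_nonneg)
  then show ?thesis unfolding A_def E'_def .
qed

text \<open>\<open>Suc r\<close> is the integer power of the supermartingale argument. Any
  \<open>r\<close> with \<open>p < 2 * (r + 1)\<close> would serve; the ceiling of \<open>p\<close>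
  is one.\<close>

definition moment_const :: "real \<Rightarrow> real" where
  "moment_const p = (let r = nat \<lceil>p\<rceil> in weak_const r * (1 + p / (2 * real (Suc r) - p)))"

text \<open>The upper half of a Burkholder-Davis-Gundy inequality at the ends of the cells. The
  constant depends on \<open>p\<close> alone, which is the source of uniformity in
  \<open>n\<close>.\<close>

lemma moment_weighted_martingale:
  assumes n: "n \<ge> 1" and p: "p > 0" and ab: "0 \<le> \<alpha>" "0 \<le> \<beta>" "\<alpha> + \<beta> \<le> 1"
  shows "(\<integral>\<^sup>+\<omega>. ennreal (Max ((\<lambda>i. \<bar>weighted_martingale \<alpha> \<beta> n i \<omega>\<bar>) ` {..n}) powr p) \<partial>completion M)
    \<le> ennreal (moment_const p) * (\<integral>\<^sup>+\<omega>. ennreal ((\<gamma>\<^sup>2 * deriv_energy \<omega>) powr (p / 2)) \<partial>completion M)"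
proof -
  interpret Mc: prob_space "completion M" by (rule prob_space_completion)
  define r where "r = nat \<lceil>p\<rceil>"
  have "p \<le> real r" using p by (simp add: r_def)
  then have pr: "p < 2 * real (Suc r)" using p by simp
  show ?thesis unfolding moment_const_def Let_def r_def[symmetric]
  proof (rule Mc.moment_le_of_weak_type[OF _ _ _ _ p pr])
    show "(\<lambda>\<omega>. Max ((\<lambda>i. \<bar>weighted_martingale \<alpha> \<beta> n i \<omega>\<bar>) ` {..n})) \<in> borel_measurable (completion M)"
      by (intro borel_measurable_Max borel_measurable_abs weighted_martingale_measurable[OF n]) auto
    show "0 \<le> Max ((\<lambda>i. \<bar>weighted_martingale \<alpha> \<beta> n i \<omega>\<bar>) ` {..n})" for \<omega>
      by (rule order_trans[OF _ Max_ge[of _ "\<bar>weighted_martingale \<alpha> \<beta> n 0 \<omega>\<bar>"]]) auto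
    show "(\<lambda>\<omega>. \<gamma>\<^sup>2 * deriv_energy \<omega>) \<in> borel_measurable (completion M)" using deriv_energy_measurable by measurable
    show "0 \<le> \<gamma>\<^sup>2 * deriv_energy \<omega>" for \<omega> using deriv_energy_nonneg by simp
    show "0 \<le> weak_const r" using weak_const_ge_1[of r] by simp
    fix t :: real assume t: "t > 0"
    have "{\<omega>\<in>space (completion M). t < Max ((\<lambda>i. \<bar>weighted_martingale \<alpha> \<beta> n i \<omega>\<bar>) ` {..n})} = {\<omega>\<in>space M. \<exists>i\<le>n. t < \<bar>weighted_martingale \<alpha> \<beta> n i \<omega>\<bar>}"
      by (auto simp: Max_gr_iff)
    note eq = this
    show "Mc.prob {\<omega>\<in>space (completion M). t < Max ((\<lambda>i. \<bar>weighted_martingale \<alpha> \<beta> n i \<omega>\<bar>) ` {..n})}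
      \<le> weak_const r * Mc.expectation (\<lambda>\<omega>. min (\<gamma>\<^sup>2 * deriv_energy \<omega> / t\<^sup>2) 1 ^ Suc r)"
      unfolding eq by (rule weak_type_weighted_martingale[OF n t ab])
  qed
qed

end

section \<open>Stability of the implicit scheme\<close>

lemma interval_integral_upper_bound:
  fixes f :: "real \<Rightarrow> real"
  assumes ab: "a \<le> b" and f: "\<And>t. a < t \<Longrightarrow> t < b \<Longrightarrow> f t \<le> B" and B: "B \<ge> 0"
  shows "(LBINT t=a..b. f t) \<le> B * (b - a)"
proof -
  have eq: "(LBINT t=a..b. f t) = (LINT t:{a<..<b}|lborel. f t)"
    using ab by (simp add: interval_lebesgue_integral_def)
  show ?thesis
  proof (cases "set_integrable lborel {a<..<b} f")
    case True
    have "integrable lborel (indicat_real {a<..<b})"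
      by (rule integrable_real_indicator) (use ab in auto)
    then have "(LINT t:{a<..<b}|lborel. f t) \<le> (LINT t:{a<..<b}|lborel. B)"
      using True f by (intro set_integral_mono) (auto simp: set_integrable_def)
    also have "\<dots> = B * (b - a)" using ab by (simp add: set_lebesgue_integral_def)
    finally show ?thesis by (simp add: eq)
  next
    \<comment> \<open>A function that is not integrable has integral 0 by convention, which
      \<open>B >= 0\<close> covers.\<close>
    case False
    then have "(LINT t:{a<..<b}|lborel. f t) = 0"
      by (simp add: set_lebesgue_integral_def set_integrable_def not_integrable_integral_eq)
    then show ?thesis using eq B ab by simp
  qed
qed

lemma interval_integral_reversed_bound:
  fixes f :: "real \<Rightarrow> real"
  assumes ab: "a \<le> b" and f: "\<And>t. a < t \<Longrightarrow> t < b \<Longrightarrow> \<bar>f t\<bar> \<le> B" and B: "B \<ge> 0"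
  shows "\<bar>LBINT t=b..a. f t\<bar> \<le> B * (b - a)"
proof -
  have "(LBINT t=a..b. f t) \<le> B * (b - a)" "(LBINT t=a..b. - f t) \<le> B * (b - a)"
    using f by (auto intro!: interval_integral_upper_bound[OF ab _ B] simp: abs_le_iff)
  moreover have "(LBINT t=a..b. - f t) = - (LBINT t=a..b. f t)" by (rule interval_lebesgue_integral_uminus)
  moreover have "(LBINT t=b..a. f t) = - (LBINT t=a..b. f t)" by (rule interval_integral_endpoints_reverse)
  ultimately show ?thesis by (simp add: abs_le_iff)
qed

text \<open>If \<open>L\<close> were bounded above near 0, the exponent in \<open>feller_v\<close>
  would be bounded above on \<open>(0, d)\<close>, and \<open>feller_v\<close> itself would stay
  bounded near 0. Large values of \<open>L\<close> near 0 are what the intermediate value argument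
  for the implicit equation uses.\<close>

lemma feller_imp_unbounded_at_0:
  assumes L: "continuous_on {0<..} L" and d: "d > 0"
    and lim: "filterlim (feller_v L \<gamma> d) at_top (at_right 0)"
  shows "\<exists>x. 0 < x \<and> x < 1 \<and> L x > C"
proof (rule ccontr)
  assume "\<not> ?thesis"
  then have C: "\<And>x. 0 < x \<Longrightarrow> x < 1 \<Longrightarrow> L x \<le> C" by force
  have "compact (L ` {1/2..d})"
    by (intro compact_continuous_image continuous_on_subset[OF L]) auto
  then obtain C1 where C1: "\<And>x. x \<in> {1/2..d} \<Longrightarrow> \<bar>L x\<bar> \<le> C1"
    by (force dest!: compact_imp_bounded simp: bounded_iff)
  define B where "B = max 0 (max C C1)"
  have B: "L x \<le> B" if "0 < x" "x \<le> d" for x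
    using C[of x] C1[of x] that by (cases "x < 1/2") (auto simp: B_def abs_le_iff le_max_iff_disj)
  have B0: "B \<ge> 0" by (simp add: B_def)
  define G where "G = exp (2 / \<gamma>\<^sup>2 * (B * d))"
  have inner: "\<bar>LBINT z=d..r. exp (- (2 / \<gamma>\<^sup>2) * (LBINT \<xi>=z..r. L \<xi>))\<bar> \<le> G * d" if r: "0 < r" "r < d" for r
  proof -
    have "\<bar>LBINT z=d..r. exp (- (2 / \<gamma>\<^sup>2) * (LBINT \<xi>=z..r. L \<xi>))\<bar> \<le> G * (d - r)"
    proof (rule interval_integral_reversed_bound)
      fix z assume z: "r < z" "z < d"
      \<comment> \<open>The integral in the exponent runs backwards, which cancels the minus sign,
        so an upper bound of \<open>L\<close> bounds the exponential.\<close>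
      have "(LBINT \<xi>=r..z. L \<xi>) \<le> B * (z - r)"
        by (rule interval_integral_upper_bound) (use z r B B0 in auto)
      also have "\<dots> \<le> B * d" using z r B0 by (intro mult_left_mono) auto
      finally have "2 / \<gamma>\<^sup>2 * (LBINT \<xi>=r..z. L \<xi>) \<le> 2 / \<gamma>\<^sup>2 * (B * d)" by (intro mult_left_mono) auto
      moreover have "(LBINT \<xi>=z..r. L \<xi>) = - (LBINT \<xi>=r..z. L \<xi>)" by (rule interval_integral_endpoints_reverse)
      ultimately show "\<bar>exp (- (2 / \<gamma>\<^sup>2) * (LBINT \<xi>=z..r. L \<xi>))\<bar> \<le> G" by (simp add: G_def)
    qed (use r in \<open>auto simp: G_def\<close>)
    also have "\<dots> \<le> G * d" using r by (intro mult_left_mono) (auto simp: G_def)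
    finally show ?thesis .
  qed
  have outer: "feller_v L \<gamma> d x \<le> G * d * d" if x: "0 < x" "x < d" for x
  proof -
    have "\<bar>feller_v L \<gamma> d x\<bar> \<le> G * d * (d - x)"
      unfolding feller_v_def
      by (rule interval_integral_reversed_bound) (use x d inner in \<open>auto simp: G_def\<close>)
    also have "\<dots> \<le> G * d * d" using x d by (intro mult_left_mono) (auto simp: G_def)
    finally show ?thesis by simp
  qed
  have "\<forall>\<^sub>F x in at_right 0. G * d * d < feller_v L \<gamma> d x"
    using lim by (simp add: filterlim_at_top_dense)
  moreover have "\<forall>\<^sub>F x in at_right 0. 0 < x \<and> x < d"
    unfolding eventually_at_right_field using d by (intro exI[of _ d]) auto
  ultimately have "\<forall>\<^sub>F x in at_right (0::real). False"
    by eventually_elim (use outer in force)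
  then show False by (simp add: trivial_limit_at_right_real)
qed

text \<open>The derivative is nonpositive on \<open>(0, A)\<close>, at most \<open>K\<close> beyond
  \<open>A\<close>, and at most \<open>K\<close> at \<open>A\<close> by continuity; the mean value
  theorem concludes. Near 0 the derivative may be unbounded below, which does no harm to a one-sided
  bound.\<close>

lemma one_sided_lipschitz:
  fixes L L1 :: "real \<Rightarrow> real"
  assumes L: "\<And>x. x > 0 \<Longrightarrow> (L has_real_derivative L1 x) (at x)"
    and L1: "continuous_on {0<..} L1"
    and A: "A > 0" and K: "K > 0" and anti: "antimono_on {0<..<A} L"
    and bd: "\<And>x. x > A \<Longrightarrow> L1 x \<le> K"
    and x: "0 < x" "x \<le> x'"
  shows "L x' - L x \<le> K * (x' - x)"
proof -
  have le: "L1 u \<le> K" if u: "u > 0" for u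
  proof -
    consider "u < A" | "u = A" | "u > A" by linarith
    then show ?thesis
    proof cases
      case 1
      have "L1 u \<le> 0"
      proof (rule ccontr)
        assume "\<not> L1 u \<le> 0"
        then obtain e where e: "e > 0" "\<And>h. h > 0 \<Longrightarrow> h < e \<Longrightarrow> L u < L (u + h)"
          using DERIV_pos_inc_right[OF L[OF u]] by force
        define h where "h = min (e / 2) ((A - u) / 2)"
        have "h > 0" "h < e" "u + h < A" using e 1 by (auto simp: h_def min_def field_simps)
        then have "L u < L (u + h)" "L (u + h) \<le> L u"
          using e u monotone_onD[OF anti, of u "u + h"] by auto
        then show False by simp
      qed
      then show ?thesis using K by simp
    next
      case 2
      have "isCont L1 A" using L1 A by (simp add: continuous_on_eq_continuous_at)
      then have "(L1 \<longlongrightarrow> L1 A) (at_right A)" by (auto simp: continuous_at filterlim_at_split)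
      moreover have "\<forall>\<^sub>F x in at_right A. L1 x \<le> K"
        unfolding eventually_at_right_field using bd by (intro exI[of _ "A + 1"]) auto
      ultimately show ?thesis using 2 by (auto intro: tendsto_upperbound)
    qed (use bd in auto)
  qed
  show ?thesis
  proof (cases "x = x'")
    case False
    then obtain z where "x < z" "z < x'" "L x' - L x = (x' - x) * L1 z"
      using MVT2[of x x' L L1] L x by auto
    then show ?thesis using le[of z] x by (simp add: mult.commute mult_left_mono)
  qed simp
qed

text \<open>The map \<open>z - L z * h\<close> increases with slope at least 1/2, which gives
  uniqueness. It lies below \<open>c\<close> at some point near 0 because \<open>L\<close> is large
  there, and above \<open>c\<close> for large \<open>z\<close>, so a zero exists in between.\<close>

lemma implicit_equation_ex1:
  fixes L :: "real \<Rightarrow> real"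
  assumes L: "continuous_on {0<..} L" and h: "h > 0" and K: "K * h < 1 / 2"
    and osl: "\<And>x x'. 0 < x \<Longrightarrow> x \<le> x' \<Longrightarrow> L x' - L x \<le> K * (x' - x)"
    and unb: "\<And>C. \<exists>x. 0 < x \<and> x < 1 \<and> L x > C"
  shows "\<exists>!z. z > 0 \<and> z = c + L z * h"
proof -
  define g where "g = (\<lambda>z. z - L z * h)"
  have g: "g x' - g x \<ge> (x' - x) / 2" if "0 < x" "x \<le> x'" for x x'
  proof -
    have "h * (L x' - L x) \<le> h * (K * (x' - x))" using osl[OF that] h by (intro mult_left_mono) auto
    also have "h * (K * (x' - x)) = (K * h) * (x' - x)" by simp
    also have "\<dots> \<le> 1 / 2 * (x' - x)" using K that by (intro mult_right_mono) auto
    finally have "h * (L x' - L x) \<le> (x' - x) / 2" by simp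
    moreover have "g x' - g x = (x' - x) - h * (L x' - L x)" by (simp add: g_def algebra_simps)
    ultimately show ?thesis by (simp add: field_simps)
  qed
  obtain a where a: "0 < a" "a < 1" "L a > (1 - c) / h" using unb by blast
  then have ga: "g a < c" using h by (simp add: g_def field_simps)
  \<comment> \<open>Starting from 1, the slope 1/2 lifts \<open>g\<close> by at least
    \<open>|c - g 1|\<close> over this distance.\<close>
  define b where "b = 1 + 2 * \<bar>c - g 1\<bar>"
  have "g b - g 1 \<ge> \<bar>c - g 1\<bar>" using g[of 1 b] by (simp add: b_def)
  then have gb: "g b \<ge> c" by linarith
  have ab: "a \<le> b" using a(2) abs_ge_zero[of "c - g 1"] unfolding b_def by argo
  have cont: "continuous_on {a..b} g" unfolding g_def
    by (intro continuous_intros continuous_on_subset[OF L]) (use a in auto)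
  then obtain z where z: "a \<le> z" "z \<le> b" "g z = c"
    using IVT'[OF less_imp_le[OF ga] gb ab cont] by blast
  show ?thesis
  proof (rule ex1I[of _ z])
    show "z > 0 \<and> z = c + L z * h" using z a by (simp add: g_def)
    fix v assume v: "v > 0 \<and> v = c + L v * h"
    then have "g v = g z" using z by (simp add: g_def)
    then show "v = z" using g[of v z] g[of z v] v z a by (cases "v \<le> z") auto
  qed
qed

text \<open>One has \<open>e (Suc i) = c * (e i + D i + S (Suc i) - S i)\<close> with \<open>0 \<le> c \<le> 1 / (1 - K * h)\<close>, where \<open>c\<close>
  may be arbitrarily small and is not adapted. The recursion for \<open>e - S\<close> involves \<open>S\<close> itself
  rather than its increments.\<close>

lemma implicit_error_recursion:
  fixes e D S l :: "nat \<Rightarrow> real"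
  assumes h: "h > 0" and K: "K > 0" "K * h < 1 / 2" and e0: "e 0 = 0" and S0: "S 0 = 0"
    and rec: "\<And>i. i < n \<Longrightarrow> e (Suc i) = e i + h * l i + D i + (S (Suc i) - S i)"
    and l_up: "\<And>i. i < n \<Longrightarrow> e (Suc i) > 0 \<Longrightarrow> l i \<le> K * e (Suc i)"
    and l_dn: "\<And>i. i < n \<Longrightarrow> e (Suc i) < 0 \<Longrightarrow> l i \<ge> K * e (Suc i)"
    and s: "\<And>i. i \<le> n \<Longrightarrow> \<bar>S i\<bar> \<le> s"
    and i: "i \<le> n"
  shows "\<bar>e i\<bar> \<le> (1 / (1 - K * h)) ^ i * (2 * s + (\<Sum>k<i. \<bar>D k\<bar>))"
proof -
  define \<theta> where "\<theta> = 1 / (1 - K * h)"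
  have \<theta>: "\<theta> \<ge> 1" using K h by (simp add: \<theta>_def)
  define B where "B = (\<lambda>i. \<theta> ^ i * (2 * s + (\<Sum>k<i. \<bar>D k\<bar>)))"
  have s0: "s \<ge> 0" using s[of 0] by simp
  have B2: "2 * s \<le> B i" for i
  proof -
    have "1 * (2 * s + 0) \<le> B i" unfolding B_def using \<theta> s0 by (intro mult_mono add_left_mono) (auto simp: sum_nonneg)
    then show ?thesis by simp
  qed
  have BS: "\<theta> * (B i + \<bar>D i\<bar>) \<le> B (Suc i)" for i
  proof -
    have "\<theta> * \<bar>D i\<bar> \<le> \<theta> ^ Suc i * \<bar>D i\<bar>"
      using \<theta> power_increasing[of 1 "Suc i" \<theta>] by (intro mult_right_mono) auto
    then show ?thesis by (simp add: B_def algebra_simps)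
  qed
  \<comment> \<open>The extra \<open>s\<close> closes the induction: it turns
    \<open>|c - 1| * s + s\<close> into \<open>c * s\<close> if \<open>c > 1\<close>, and into
    \<open>c * s + (1 - c) * (2 * s)\<close> if \<open>c <= 1\<close>, where the second term is
    covered by \<open>2 * s <= B i\<close>.\<close>
  have "i \<le> n \<Longrightarrow> \<bar>e i - S i\<bar> + s \<le> B i" for i
  proof (induction i)
    case 0
    show ?case using e0 S0 s0 by (simp add: B_def)
  next
    case (Suc i)
    define g where "g = e i - S i"
    define a where "a = g + D i + S (Suc i)"
    have i: "i < n" using Suc.prems by simp
    have IH: "\<bar>g\<bar> + s \<le> B i" using Suc i by (simp add: g_def)
    have xa: "e (Suc i) - h * l i = a" using rec[OF i] by (simp add: a_def g_def)
    \<comment> \<open>The one-sided bounds on \<open>l i\<close> force \<open>e (Suc i)\<close> to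
      have the sign of \<open>a\<close> and at most \<open>\<theta>\<close> times its size.\<close>
    have "\<exists>c. 0 \<le> c \<and> c \<le> \<theta> \<and> e (Suc i) = c * a"
    proof -
      consider "e (Suc i) = 0" | "e (Suc i) > 0" | "e (Suc i) < 0" by linarith
      then show ?thesis
      proof cases
        case 1
        then show ?thesis using \<theta> by (intro exI[of _ 0]) simp
      next
        case 2
        have "h * l i \<le> h * (K * e (Suc i))" using l_up[OF i 2] h by (intro mult_left_mono) auto
        then have a: "(1 - K * h) * e (Suc i) \<le> a" using xa by (simp add: algebra_simps)
        then have "a > 0" using 2 K by (smt (verit) mult_pos_pos field_sum_of_halves)
        then show ?thesis using a 2 K
          by (intro exI[of _ "e (Suc i) / a"]) (auto simp: \<theta>_def field_simps)
      next
        case 3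
        have "h * l i \<ge> h * (K * e (Suc i))" using l_dn[OF i 3] h by (intro mult_left_mono) auto
        then have a: "(1 - K * h) * e (Suc i) \<ge> a" using xa by (simp add: algebra_simps)
        then have "a < 0" using 3 K by (smt (verit) mult_pos_neg field_sum_of_halves)
        then show ?thesis using a 3 K
          by (intro exI[of _ "e (Suc i) / a"]) (auto simp: \<theta>_def field_simps)
      qed
    qed
    then obtain c where c: "0 \<le> c" "c \<le> \<theta>" "e (Suc i) = c * a" by auto
    have Ss: "\<bar>S (Suc i)\<bar> \<le> s" using s Suc.prems by simp
    have "e (Suc i) - S (Suc i) = c * (g + D i) + (c - 1) * S (Suc i)"
      unfolding c(3) a_def by (simp add: algebra_simps)
    also have "\<bar>\<dots>\<bar> \<le> c * (\<bar>g\<bar> + \<bar>D i\<bar>) + \<bar>c - 1\<bar> * s"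
      using c(1) Ss by (intro order_trans[OF abs_triangle_ineq] add_mono) (auto simp: abs_mult intro!: mult_left_mono)
    finally have 1: "\<bar>e (Suc i) - S (Suc i)\<bar> + s \<le> c * (\<bar>g\<bar> + \<bar>D i\<bar>) + \<bar>c - 1\<bar> * s + s" by simp
    also have "\<dots> \<le> \<theta> * (B i + \<bar>D i\<bar>)"
    proof (cases "c \<le> 1")
      case True
      have "c * (\<bar>g\<bar> + \<bar>D i\<bar>) + \<bar>c - 1\<bar> * s + s = c * (\<bar>g\<bar> + s + \<bar>D i\<bar>) + (1 - c) * (2 * s)"
        using True by (simp add: algebra_simps)
      also have "\<dots> \<le> c * (B i + \<bar>D i\<bar>) + (1 - c) * (B i + \<bar>D i\<bar>)"
        using True c IH B2[of i] by (intro add_mono mult_left_mono) auto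
      also have "\<dots> = 1 * (B i + \<bar>D i\<bar>)" by (simp add: algebra_simps)
      also have "\<dots> \<le> \<theta> * (B i + \<bar>D i\<bar>)" using \<theta> B2[of i] s0 by (intro mult_right_mono) auto
      finally show ?thesis .
    next
      case False
      then have "c * (\<bar>g\<bar> + \<bar>D i\<bar>) + \<bar>c - 1\<bar> * s + s = c * (\<bar>g\<bar> + s + \<bar>D i\<bar>)" by (simp add: algebra_simps)
      also have "\<dots> \<le> \<theta> * (B i + \<bar>D i\<bar>)" using c IH s0 by (intro mult_mono) auto
      finally show ?thesis .
    qed
    also have "\<dots> \<le> B (Suc i)" by (rule BS)
    finally show ?case .
  qed
  from this[OF i] s[OF i] show ?thesis unfolding B_def \<theta>_def by linarith
qed

text \<open>For \<open>x <= 1 / 2\<close> one has \<open>1 <= (1 - x) * (1 + 2 * x)\<close>. With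
  \<open>x = K * h\<close> the exponent equals \<open>2 * K * T\<close>, whatever the number of
  steps.\<close>

lemma inverse_one_minus_power_le_exp:
  fixes x :: real
  assumes "0 \<le> x" "x \<le> 1 / 2" shows "(1 / (1 - x)) ^ n \<le> exp (2 * real n * x)"
proof -
  have "x * x \<le> 1 / 2 * x" using assms by (intro mult_right_mono) auto
  then have "1 \<le> (1 - x) * (1 + 2 * x)" by (simp add: algebra_simps)
  also have "\<dots> \<le> (1 - x) * exp (2 * x)" using assms exp_ge_add_one_self[of "2 * x"] by (intro mult_left_mono) auto
  finally have "1 / (1 - x) \<le> exp (2 * x)" using assms by (simp add: field_simps)
  then have "(1 / (1 - x)) ^ n \<le> exp (2 * x) ^ n" using assms by (intro power_mono) auto
  then show ?thesis by (simp add: exp_of_nat_mult[symmetric] mult_ac)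
qed

text \<open>Purely deterministic: for one path, all randomness enters through the bounds
  \<open>\<nu>\<close> on \<open>N\<close> and \<open>s\<close> on the weighted sums. The order one
  is visible once \<open>s\<close> is itself \<open>h\<close> times a quantity with moments bounded
  in \<open>n\<close>.\<close>

lemma implicit_scheme_error:
  fixes L Y w N b :: "real \<Rightarrow> real" and y \<gamma> T K \<nu> s :: real and n :: nat
  defines "h \<equiv> T / real n"
  defines "B \<equiv> integral {0..T} (\<lambda>u. \<bar>b u\<bar>)"
  assumes T: "T > 0" and n: "n \<ge> 1" and K: "K > 0" "K * h < 1 / 2"
    and ex1: "\<And>c. \<exists>!z. z > 0 \<and> z = c + L z * h"
    and osl: "\<And>x x'. 0 < x \<Longrightarrow> x \<le> x' \<Longrightarrow> L x' - L x \<le> K * (x' - x)"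
    and Y_pos: "\<And>t. t \<in> {0..T} \<Longrightarrow> Y t > 0"
    and LY: "continuous_on {0..T} (\<lambda>t. L (Y t))" and b: "continuous_on {0..T} b"
    and Y_eq: "\<And>t. t \<in> {0..T} \<Longrightarrow> Y t = y + integral {0..t} (\<lambda>u. L (Y u)) + \<gamma> * (w t - w 0)"
    and N_eq: "\<And>t. t \<in> {0..T} \<Longrightarrow> N t = L (Y t) - L y - integral {0..t} b"
    and \<nu>: "\<And>t. t \<in> {0..T} \<Longrightarrow> \<bar>N t\<bar> \<le> \<nu>"
    and s: "\<And>i. i \<le> n \<Longrightarrow> \<bar>\<Sum>k<i. h * N (real k * h + h) - integral {real k * h..real k * h + h} N\<bar> \<le> s"
    and t: "t \<in> {0..T}"
  shows "\<bar>implicit_scheme L \<gamma> y T n w t - Y t\<bar> \<le> 3 * (exp (2 * K * T) * (2 * s + h * B)) + 2 * (h * (B + 2 * \<nu>))"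
proof -
  have h: "h > 0" "real n * h = T" using T n by (auto simp: h_def)
  define \<tau> where "\<tau> = (\<lambda>i. real i * h)"
  have \<tau>: "\<tau> 0 = 0" "\<tau> n = T" "\<And>i. \<tau> (Suc i) = \<tau> i + h" using h by (auto simp: \<tau>_def algebra_simps)
  have \<tau>_mem: "\<tau> i \<in> {0..T}" if "i \<le> n" for i
    using that h mult_right_mono[of "real i" "real n" h] by (auto simp: \<tau>_def)
  have \<tau>_alt: "real i * T / real n = \<tau> i" for i by (simp add: \<tau>_def h_def)
  have sub: "{u..v} \<subseteq> {0..T}" if "0 \<le> u" "v \<le> T" for u v :: real using that by auto
  have ig: "f integrable_on {u..v}" if "continuous_on {0..T} f" "0 \<le> u" "v \<le> T" for f :: "real \<Rightarrow> real" and u v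
    by (rule integrable_continuous_real, rule continuous_on_subset[OF that(1) sub[OF that(2,3)]])
  have comb: "integral {0..v} f = integral {0..u} f + integral {u..v} f"
    if "continuous_on {0..T} f" "0 \<le> u" "u \<le> v" "v \<le> T" for f :: "real \<Rightarrow> real" and u v
    using Henstock_Kurzweil_Integration.integral_combine[OF that(2,3) ig[OF that(1) order_refl that(4)]] by simp
  have babs: "continuous_on {0..T} (\<lambda>u. \<bar>b u\<bar>)" by (intro continuous_intros b)
  define P where "P = (\<lambda>t. integral {0..t} b)"
  have cP: "continuous_on {0..T} P"
    unfolding P_def by (intro indefinite_integral_continuous_1 integrable_continuous_real b)
  have P_diff: "\<bar>P v - P u\<bar> \<le> integral {u..v} (\<lambda>u. \<bar>b u\<bar>)" if "0 \<le> u" "u \<le> v" "v \<le> T" for u v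
  proof -
    have "P v - P u = integral {u..v} b" using comb[OF b that] by (simp add: P_def)
    also have "\<bar>\<dots>\<bar> \<le> integral {u..v} (\<lambda>u. \<bar>b u\<bar>)"
      using integral_norm_bound_integral[OF ig[OF b that(1,3)] ig[OF babs that(1,3)]] by simp
    finally show ?thesis .
  qed
  have babs_mono: "integral {u..v} (\<lambda>u. \<bar>b u\<bar>) \<le> integral {u'..v'} (\<lambda>u. \<bar>b u\<bar>)"
    if "0 \<le> u'" "u' \<le> u" "v \<le> v'" "v' \<le> T" for u v u' v'
    by (rule integral_subset_le) (use that in \<open>auto intro!: ig[OF babs]\<close>)
  have cN: "continuous_on {0..T} N"
  proof -
    have "continuous_on {0..T} (\<lambda>t. L (Y t) - L y - P t)" by (intro continuous_intros LY cP)
    then show ?thesis using N_eq by (subst continuous_on_cong[OF refl]) (auto simp: P_def)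
  qed
  have L_diff: "L (Y v) - L (Y u) = (P v - P u) + (N v - N u)" if "u \<in> {0..T}" "v \<in> {0..T}" for u v
    using N_eq[OF that(1)] N_eq[OF that(2)] by (simp add: P_def)
  \<comment> \<open>A crude bound that does not shrink with the cell. It serves inside one cell,
    where the time integral supplies \<open>h\<close>; over the whole grid such errors would add up,
    and the finer splitting of \<open>r\<close> is used instead.\<close>
  have L_osc: "\<bar>L (Y v) - L (Y u)\<bar> \<le> B + 2 * \<nu>" if "0 \<le> u" "u \<le> v" "v \<le> T" for u v
  proof -
    have "\<bar>P v - P u\<bar> \<le> B" using P_diff[OF that] babs_mono[of 0 u v T] that by (simp add: B_def)
    moreover have "\<bar>N v\<bar> \<le> \<nu>" "\<bar>N u\<bar> \<le> \<nu>" using \<nu> that by auto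
    ultimately show ?thesis using L_diff[of u v] that by auto
  qed
  have Y_diff: "Y v - Y u = integral {u..v} (\<lambda>u. L (Y u)) + \<gamma> * (w v - w u)" if "0 \<le> u" "u \<le> v" "v \<le> T" for u v
    using Y_eq[of u] Y_eq[of v] comb[OF LY that] that by (simp add: algebra_simps)

  define g where "g = implicit_grid L \<gamma> y T n w"
  have g_Suc: "g (Suc i) > 0 \<and> g (Suc i) = g i + L (g (Suc i)) * h + \<gamma> * (w (\<tau> (Suc i)) - w (\<tau> i))" for i
  proof -
    have "g (Suc i) = (THE z. z > 0 \<and> z = g i + L z * h + \<gamma> * (w (\<tau> (Suc i)) - w (\<tau> i)))"
      unfolding g_def implicit_grid.simps \<tau>_alt h_def ..
    moreover have "\<exists>!z. z > 0 \<and> z = g i + L z * h + \<gamma> * (w (\<tau> (Suc i)) - w (\<tau> i))"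
      using ex1[of "g i + \<gamma> * (w (\<tau> (Suc i)) - w (\<tau> i))"] by (simp add: algebra_simps)
    ultimately show ?thesis using theI'[of "\<lambda>z. z > 0 \<and> z = g i + L z * h + \<gamma> * (w (\<tau> (Suc i)) - w (\<tau> i))"] by simp
  qed
  define e where "e = (\<lambda>i. g i - Y (\<tau> i))"
  define l where "l = (\<lambda>i. L (g (Suc i)) - L (Y (\<tau> (Suc i))))"
  define r where "r = (\<lambda>i. integral {\<tau> i..\<tau> (Suc i)} (\<lambda>u. L (Y (\<tau> (Suc i))) - L (Y u)))"
  define D where "D = (\<lambda>i. integral {\<tau> i..\<tau> (Suc i)} (\<lambda>u. P (\<tau> (Suc i)) - P u))"
  define S where "S = (\<lambda>i. \<Sum>k<i. h * N (\<tau> k + h) - integral {\<tau> k..\<tau> k + h} N)"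
  have step: "0 \<le> \<tau> i" "\<tau> i \<le> \<tau> (Suc i)" "\<tau> (Suc i) \<le> T" "\<tau> i \<in> {0..T}" "\<tau> (Suc i) \<in> {0..T}" if "i < n" for i
    using \<tau>_mem[of i] \<tau>_mem[of "Suc i"] that \<tau>(3)[of i] h by auto
  have int_shift: "integral {\<tau> i..v} (\<lambda>u. c - f u) = (v - \<tau> i) * c - integral {\<tau> i..v} f"
    if "i < n" "continuous_on {0..T} f" "\<tau> i \<le> v" "v \<le> T" for i v c and f :: "real \<Rightarrow> real"
    using that step[OF that(1)] by (subst Henstock_Kurzweil_Integration.integral_diff) (auto intro!: ig)
  \<comment> \<open>The integral of \<open>N (\<tau> (Suc i)) - N u\<close> over the cell is the
    increment of \<open>S\<close>, that is, \<open>h\<close> times the weighted martingale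
    increment.\<close>
  have r_DS: "r i = D i + (S (Suc i) - S i)" if i: "i < n" for i
  proof -
    note st = step[OF i]
    have "r i = integral {\<tau> i..\<tau> (Suc i)} (\<lambda>u. (P (\<tau> (Suc i)) - P u) + (N (\<tau> (Suc i)) - N u))"
      unfolding r_def by (rule Henstock_Kurzweil_Integration.integral_cong) (use st in \<open>auto intro!: L_diff\<close>)
    also have "\<dots> = D i + integral {\<tau> i..\<tau> (Suc i)} (\<lambda>u. N (\<tau> (Suc i)) - N u)"
      unfolding D_def using st
      by (subst Henstock_Kurzweil_Integration.integral_add) (auto intro!: ig continuous_intros cP cN)
    finally show ?thesis using int_shift[OF i cN st(2,3)] by (simp add: S_def \<tau>(3))
  qed
  have e_Suc: "e (Suc i) = e i + h * l i + r i" if i: "i < n" for i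
  proof -
    note st = step[OF i]
    have "r i = h * L (Y (\<tau> (Suc i))) - integral {\<tau> i..\<tau> (Suc i)} (\<lambda>u. L (Y u))"
      using int_shift[OF i LY st(2,3)] by (simp add: r_def \<tau>(3))
    moreover have "Y (\<tau> (Suc i)) - Y (\<tau> i) = integral {\<tau> i..\<tau> (Suc i)} (\<lambda>u. L (Y u)) + \<gamma> * (w (\<tau> (Suc i)) - w (\<tau> i))"
      by (rule Y_diff[OF st(1-3)])
    moreover have "g (Suc i) - g i = L (g (Suc i)) * h + \<gamma> * (w (\<tau> (Suc i)) - w (\<tau> i))" using g_Suc[of i] by linarith
    ultimately show ?thesis unfolding e_def l_def by (simp add: algebra_simps)
  qed
  have D_le: "\<bar>D i\<bar> \<le> h * integral {\<tau> i..\<tau> i + h} (\<lambda>u. \<bar>b u\<bar>)" if i: "i < n" for i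
  proof -
    note st = step[OF i]
    have "norm (D i) \<le> integral {\<tau> i..\<tau> (Suc i)} (\<lambda>u. \<bar>b u\<bar>) * (\<tau> (Suc i) - \<tau> i)"
      unfolding D_def
    proof (rule integral_bound[OF st(2)])
      show "continuous_on {\<tau> i..\<tau> (Suc i)} (\<lambda>u. P (\<tau> (Suc i)) - P u)"
        by (intro continuous_intros continuous_on_subset[OF cP sub[OF st(1,3)]])
      fix u assume u: "u \<in> {\<tau> i..\<tau> (Suc i)}"
      have "\<bar>P (\<tau> (Suc i)) - P u\<bar> \<le> integral {u..\<tau> (Suc i)} (\<lambda>u. \<bar>b u\<bar>)" using u st by (intro P_diff) auto
      also have "\<dots> \<le> integral {\<tau> i..\<tau> (Suc i)} (\<lambda>u. \<bar>b u\<bar>)" using u st by (intro babs_mono) auto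
      finally show "norm (P (\<tau> (Suc i)) - P u) \<le> integral {\<tau> i..\<tau> (Suc i)} (\<lambda>u. \<bar>b u\<bar>)" by simp
    qed
    then show ?thesis by (simp add: \<tau>(3) mult.commute)
  qed
  have B_sum: "(\<Sum>k<i. integral {\<tau> k..\<tau> k + h} (\<lambda>u. \<bar>b u\<bar>)) = integral {0..\<tau> i} (\<lambda>u. \<bar>b u\<bar>)" if "i \<le> n" for i
    using that
  proof (induction i)
    case (Suc i)
    then show ?case using comb[OF babs, of "\<tau> i" "\<tau> (Suc i)"] step[of i] by (simp add: \<tau>(3))
  qed (simp add: \<tau>)
  have B_sum_le: "(\<Sum>k<i. \<bar>D k\<bar>) \<le> h * B" if i: "i \<le> n" for i
  proof -
    have "(\<Sum>k<i. \<bar>D k\<bar>) \<le> (\<Sum>k<i. h * integral {\<tau> k..\<tau> k + h} (\<lambda>u. \<bar>b u\<bar>))"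
      using i by (intro sum_mono D_le) auto
    also have "\<dots> = h * integral {0..\<tau> i} (\<lambda>u. \<bar>b u\<bar>)" using B_sum[OF i] by (simp flip: sum_distrib_left)
    also have "\<dots> \<le> h * B" unfolding B_def using h \<tau>_mem[OF i] by (intro mult_left_mono babs_mono) auto
    finally show ?thesis .
  qed
  have s': "\<bar>S i\<bar> \<le> s" if "i \<le> n" for i using s[OF that] by (simp add: S_def \<tau>_def)
  have s0: "0 \<le> s" using s'[of 0] by (simp add: S_def)
  have B0: "0 \<le> B" unfolding B_def by (intro Henstock_Kurzweil_Integration.integral_nonneg ig[OF babs]) auto
  have \<nu>0: "0 \<le> \<nu>" using \<nu>[of 0] T by simp
  define E where "E = exp (2 * K * T) * (2 * s + h * B)"
  have E0: "0 \<le> E" unfolding E_def using s0 B0 h by auto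
  have e_le: "\<bar>e i\<bar> \<le> E" if i: "i \<le> n" for i
  proof -
    have "\<bar>e i\<bar> \<le> (1 / (1 - K * h)) ^ i * (2 * s + (\<Sum>k<i. \<bar>D k\<bar>))"
    proof (rule implicit_error_recursion[where l=l and S=S and n=n, OF h(1) K])
      show "e 0 = 0" using Y_eq[of 0] T by (simp add: e_def g_def \<tau>)
      show "e (Suc i) = e i + h * l i + D i + (S (Suc i) - S i)" if "i < n" for i
        using e_Suc[OF that] r_DS[OF that] by simp
      show "l i \<le> K * e (Suc i)" if "i < n" "e (Suc i) > 0" for i
        using osl[of "Y (\<tau> (Suc i))" "g (Suc i)"] Y_pos step(5)[OF that(1)] that(2) by (simp add: l_def e_def)
      show "l i \<ge> K * e (Suc i)" if "i < n" "e (Suc i) < 0" for i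
        using osl[of "g (Suc i)" "Y (\<tau> (Suc i))"] g_Suc[of i] that(2) by (simp add: l_def e_def algebra_simps)
    qed (use s' i in \<open>auto simp: S_def\<close>)
    also have "\<dots> \<le> exp (2 * K * T) * (2 * s + h * B)"
    proof (rule mult_mono)
      have "(1 / (1 - K * h)) ^ i \<le> (1 / (1 - K * h)) ^ n" using i K h by (intro power_increasing) auto
      also have "\<dots> \<le> exp (2 * real n * (K * h))"
        using K h by (intro inverse_one_minus_power_le_exp) auto
      also have "2 * real n * (K * h) = 2 * K * T" using h(2) by (simp add: mult_ac)
      finally show "(1 / (1 - K * h)) ^ i \<le> exp (2 * K * T)" .
    qed (use B_sum_le[OF i] s0 in \<open>auto intro!: sum_nonneg add_nonneg_nonneg\<close>)
    finally show ?thesis by (simp add: E_def)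
  qed
  have osc_int: "\<bar>integral {\<tau> i..v} (\<lambda>u. L (Y (\<tau> (Suc i))) - L (Y u))\<bar> \<le> h * (B + 2 * \<nu>)"
    if i: "i < n" and v: "\<tau> i \<le> v" "v \<le> \<tau> (Suc i)" for i v
  proof -
    note st = step[OF i]
    have "norm (integral {\<tau> i..v} (\<lambda>u. L (Y (\<tau> (Suc i))) - L (Y u))) \<le> (B + 2 * \<nu>) * (v - \<tau> i)"
    proof (rule integral_bound[OF v(1)])
      show "continuous_on {\<tau> i..v} (\<lambda>u. L (Y (\<tau> (Suc i))) - L (Y u))"
        using st v by (intro continuous_intros continuous_on_subset[OF LY]) auto
      show "norm (L (Y (\<tau> (Suc i))) - L (Y u)) \<le> B + 2 * \<nu>" if "u \<in> {\<tau> i..v}" for u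
        using L_osc[of u "\<tau> (Suc i)"] that v st by auto
    qed
    also have "\<dots> \<le> (B + 2 * \<nu>) * h" using v \<tau>(3)[of i] B0 \<nu>0 by (intro mult_left_mono) auto
    finally show ?thesis by (simp add: mult.commute)
  qed
  have scheme: "implicit_scheme L \<gamma> y T n w t = (let i = nat \<lfloor>t * real n / T\<rfloor> in
      g i + L (g (Suc i)) * (t - \<tau> i) + \<gamma> * (w t - w (\<tau> i)))"
    by (simp add: implicit_scheme_def Let_def g_def \<tau>_alt)
  show ?thesis
  proof (cases "t = T")
    case True
    then have "implicit_scheme L \<gamma> y T n w t - Y t = e n"
      using T unfolding scheme by (simp add: e_def \<tau>(2))
    then have "\<bar>implicit_scheme L \<gamma> y T n w t - Y t\<bar> \<le> E" using e_le[of n] by simp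
    moreover have "0 \<le> h * (B + 2 * \<nu>)" using h B0 \<nu>0 by simp
    ultimately show ?thesis using E0 unfolding E_def by linarith
  next
    case False
    define i where "i = nat \<lfloor>t * real n / T\<rfloor>"
    have tT: "t * real n / T = t / h" by (simp add: h_def)
    have t0: "0 \<le> t / h" using t h by simp
    have ri: "real i = of_int \<lfloor>t / h\<rfloor>" using t0 by (simp add: i_def tT)
    have "real i \<le> t / h" "t / h < real i + 1" unfolding ri by linarith+
    then have ti: "\<tau> i \<le> t" "t < \<tau> (Suc i)" using h by (simp_all add: \<tau>_def field_simps)
    have "t / h < real n" using t False h T by (simp add: field_simps)
    then have i: "i < n" using \<open>real i \<le> t / h\<close> by linarith
    note st = step[OF i]
    have "Y t - Y (\<tau> i) = integral {\<tau> i..t} (\<lambda>u. L (Y u)) + \<gamma> * (w t - w (\<tau> i))"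
      using t ti st by (intro Y_diff) auto
    moreover have "integral {\<tau> i..t} (\<lambda>u. L (Y (\<tau> (Suc i))) - L (Y u)) = (t - \<tau> i) * L (Y (\<tau> (Suc i))) - integral {\<tau> i..t} (\<lambda>u. L (Y u))"
      using t ti by (intro int_shift[OF i LY]) auto
    ultimately have eq: "implicit_scheme L \<gamma> y T n w t - Y t
      = e i + (t - \<tau> i) * l i + integral {\<tau> i..t} (\<lambda>u. L (Y (\<tau> (Suc i))) - L (Y u))"
      unfolding scheme Let_def i_def[symmetric] e_def l_def by (simp add: algebra_simps)
    \<comment> \<open>There is no direct bound for \<open>l i\<close>, since the scheme may come
      close to 0, where \<open>L\<close> is large. The recursion expresses \<open>h * l i\<close>
      through two grid errors and \<open>r i\<close>, which is the origin of the factors 3 and 2 in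
      the claim.\<close>
    have "\<bar>(t - \<tau> i) * l i\<bar> \<le> \<bar>h * l i\<bar>"
      using ti \<tau>(3)[of i] h unfolding abs_mult by (intro mult_right_mono) auto
    also have "h * l i = e (Suc i) - e i - r i" using e_Suc[OF i] by simp
    also have "\<bar>\<dots>\<bar> \<le> E + E + h * (B + 2 * \<nu>)"
      using e_le[of i] e_le[of "Suc i"] osc_int[OF i st(2) order_refl] i unfolding r_def by linarith
    finally have "\<bar>(t - \<tau> i) * l i\<bar> \<le> E + E + h * (B + 2 * \<nu>)" .
    then show ?thesis unfolding eq E_def[symmetric]
      using e_le[of i] osc_int[OF i ti(1) less_imp_le[OF ti(2)]] i by linarith
  qed
qed

section \<open>Strong order one\<close>

lemma borel_measurable_clip:
  fixes f :: "real \<Rightarrow> real"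
  assumes "continuous_on {0<..} f"
  shows "(\<lambda>x. if x > 0 then f x else 0) \<in> borel_measurable borel"
proof -
  have "(\<lambda>x. indicator {0<..} x *\<^sub>R f x) \<in> borel_measurable borel"
    by (rule borel_measurable_continuous_on_indicator) (use assms in auto)
  also have "(\<lambda>x. indicator {0<..} x *\<^sub>R f x) = (\<lambda>x. if x > 0 then f x else 0)"
    by (auto simp: indicator_def)
  finally show ?thesis .
qed

lemma ennreal_powr_ennreal: "0 \<le> x \<Longrightarrow> ennreal_powr (ennreal x) r = ennreal (x powr r)"
  by (simp add: ennreal_powr_def)

lemma ennreal_powr_le:
  assumes x: "x \<le> ennreal c" and c: "0 \<le> c" and r: "r > 0"
  shows "ennreal_powr x r \<le> ennreal (c powr r)"
proof -
  obtain x' where x': "x = ennreal x'" "0 \<le> x'" "x' \<le> c"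
    using x c by (cases x) (auto simp: top_unique)
  then show ?thesis using r by (simp add: ennreal_powr_ennreal ennreal_leI powr_mono2)
qed

lemma add3_powr_le:
  fixes a b c p :: real
  assumes "0 \<le> a" "0 \<le> b" "0 \<le> c" "p > 0"
  shows "(a + b + c) powr p \<le> 3 powr p * (a powr p + b powr p + c powr p)"
proof -
  define m where "m = max a (max b c)"
  have "(a + b + c) powr p \<le> (3 * m) powr p"
    using assms by (intro powr_mono2) (auto simp: m_def)
  also have "\<dots> = 3 powr p * m powr p" using assms by (simp add: powr_mult m_def)
  also have "\<dots> \<le> 3 powr p * (a powr p + b powr p + c powr p)"
    by (intro mult_left_mono) (auto simp: m_def max_def)
  finally show ?thesis .
qed

lemma nn_integral_continuous_nonneg:
  fixes f :: "real \<Rightarrow> real"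
  assumes "continuous_on {0..T} f" "\<And>t. 0 \<le> f t"
  shows "(\<integral>\<^sup>+u\<in>{0..T}. ennreal (f u) \<partial>lborel) = ennreal (integral {0..T} f)"
  by (rule nn_integral_has_integral_lebesgue')
    (use assms in \<open>auto intro: integrable_integral integrable_continuous_real\<close>)

context additive_sde
begin

definition drift_variation :: "'a \<Rightarrow> real" where
  "drift_variation \<omega> = integral {0..T} (\<lambda>u. \<bar>generator \<omega> u\<bar>)"

lemma drift_variation_nonneg: "0 \<le> drift_variation \<omega>"
proof (cases "(\<lambda>u. \<bar>generator \<omega> u\<bar>) integrable_on {0..T}")
  case True
  then show ?thesis unfolding drift_variation_def by (intro Henstock_Kurzweil_Integration.integral_nonneg) auto
qed (simp add: drift_variation_def not_integrable_integral)

lemma drift_variation_measurable: "drift_variation \<in> borel_measurable (completion M)"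
proof (rule borel_measurable_completion_AE_limit)
  \<comment> \<open>Off the half-line \<open>L\<close> is unrestricted, so a Borel version is
    substituted; on regular paths the two agree because \<open>Y\<close> is positive.\<close>
  define Lc where "Lc = (\<lambda>x. if x > 0 then L x else 0)"
  have [measurable]: "Lc \<in> borel_measurable borel"
    unfolding Lc_def by (rule borel_measurable_clip)
      (use L_deriv in \<open>auto intro!: continuous_at_imp_continuous_on DERIV_isCont\<close>)
  let ?u = "\<lambda>j \<omega>. \<Sum>l<1 * 2 ^ j. \<bar>L1 (Y (real l * grid_step 1 j) \<omega>) * Lc (Y (real l * grid_step 1 j) \<omega>) + \<gamma>\<^sup>2 / 2 * L2 (Y (real l * grid_step 1 j) \<omega>)\<bar> * grid_step 1 j"
  show "?u j \<in> borel_measurable (completion M)" for j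
  proof (rule borel_measurable_sum)
    fix l assume "l \<in> {..<1 * (2::nat) ^ j}"
    then have [measurable]: "Y (real l * grid_step 1 j) \<in> borel_measurable (completion M)"
      by (intro Y_grid_measurable) auto
    show "(\<lambda>\<omega>. \<bar>L1 (Y (real l * grid_step 1 j) \<omega>) * Lc (Y (real l * grid_step 1 j) \<omega>) + \<gamma>\<^sup>2 / 2 * L2 (Y (real l * grid_step 1 j) \<omega>)\<bar> * grid_step 1 j)
      \<in> borel_measurable (completion M)" by measurable
  qed
  show "AE \<omega> in completion M. (\<lambda>j. ?u j \<omega>) \<longlonglongrightarrow> drift_variation \<omega>"
    using AE_regular_path
  proof eventually_elim
    case (elim \<omega>)
    have "continuous_on {0..T} (\<lambda>u. \<bar>generator \<omega> u\<bar>)" by (intro continuous_intros generator_cont[OF elim])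
    from grid_riemann_tendsto[OF order_refl this]
    have "(\<lambda>j. \<Sum>l<1 * 2 ^ j. \<bar>generator \<omega> (real l * grid_step 1 j)\<bar> * grid_step 1 j) \<longlonglongrightarrow> drift_variation \<omega>" by (simp add: drift_variation_def)
    moreover have "Lc (Y (real l * grid_step 1 j) \<omega>) = L (Y (real l * grid_step 1 j) \<omega>)" if "l < 1 * 2 ^ j" for l j
      using Y_pos[OF elim grid_time_mem[of 1 l j]] that by (simp add: Lc_def)
    then have "(\<Sum>l<1 * 2 ^ j. \<bar>generator \<omega> (real l * grid_step 1 j)\<bar> * grid_step 1 j) = ?u j \<omega>" for j
      by (intro sum.cong) (auto simp: generator_def)
    ultimately show ?case by simp
  qed
qed

lemma weighted_martingale_1_0: "weighted_martingale 1 0 n i \<omega> = martingale_part (real i * (T / real n)) \<omega> - martingale_part 0 \<omega>"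
proof -
  have "block_limit 1 0 n k \<omega> = martingale_part (real (Suc k) * (T / real n)) \<omega> - martingale_part (real k * (T / real n)) \<omega>" for k
    by (simp add: block_limit_def Let_def algebra_simps add_divide_distrib)
  then have "weighted_martingale 1 0 n i \<omega> = (\<Sum>k<i. martingale_part (real (Suc k) * (T / real n)) \<omega> - martingale_part (real k * (T / real n)) \<omega>)"
    unfolding weighted_martingale_def by (intro sum.cong) auto
  also have "\<dots> = martingale_part (real i * (T / real n)) \<omega> - martingale_part (real 0 * (T / real n)) \<omega>"
    by (rule sum_lessThan_telescope)
  finally show ?thesis by simp
qed

text \<open>Identifies the sums bounded by \<open>s\<close> in \<open>implicit_scheme_error\<close>:
  the explicit factor \<open>T / real n\<close> is the gain of order one.\<close>

lemma weighted_martingale_0_1_scaled: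
  assumes "n \<ge> 1"
  shows "(\<Sum>k<i. T / real n * martingale_part (real k * (T / real n) + T / real n) \<omega>
      - integral {real k * (T / real n)..real k * (T / real n) + T / real n} (\<lambda>t. martingale_part t \<omega>)) = T / real n * weighted_martingale 0 1 n i \<omega>"
  unfolding weighted_martingale_def sum_distrib_left block_limit_def Let_def
  by (rule sum.cong) (use assms T_pos in \<open>auto simp: right_diff_distrib\<close>)

definition weighted_martingale_max :: "real \<Rightarrow> real \<Rightarrow> nat \<Rightarrow> 'a \<Rightarrow> real" where
  "weighted_martingale_max \<alpha> \<beta> n \<omega> = Max ((\<lambda>i. \<bar>weighted_martingale \<alpha> \<beta> n i \<omega>\<bar>) ` {..n})"

lemma weighted_martingale_le_max: "i \<le> n \<Longrightarrow> \<bar>weighted_martingale \<alpha> \<beta> n i \<omega>\<bar> \<le> weighted_martingale_max \<alpha> \<beta> n \<omega>"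
  unfolding weighted_martingale_max_def by (rule Max_ge) auto

lemma weighted_martingale_max_nonneg: "0 \<le> weighted_martingale_max \<alpha> \<beta> n \<omega>"
  using weighted_martingale_le_max[of 0 n \<alpha> \<beta> \<omega>] by simp

lemma weighted_martingale_max_measurable: "n \<ge> 1 \<Longrightarrow> weighted_martingale_max \<alpha> \<beta> n \<in> borel_measurable (completion M)"
  unfolding weighted_martingale_max_def[abs_def] by (intro borel_measurable_Max borel_measurable_abs weighted_martingale_measurable) auto

lemma weighted_martingale_max_dyadic_mono: "weighted_martingale_max 1 0 (2 ^ j) \<omega> \<le> weighted_martingale_max 1 0 (2 ^ Suc j) \<omega>"
  unfolding weighted_martingale_max_def[of _ _ "2 ^ j"]
proof (rule Max.boundedI)
  fix a assume "a \<in> (\<lambda>i. \<bar>weighted_martingale 1 0 (2 ^ j) i \<omega>\<bar>) ` {..2 ^ j}"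
  then obtain i where i: "i \<le> 2 ^ j" "a = \<bar>weighted_martingale 1 0 (2 ^ j) i \<omega>\<bar>" by auto
  have "weighted_martingale 1 0 (2 ^ j) i \<omega> = weighted_martingale 1 0 (2 ^ Suc j) (2 * i) \<omega>" by (simp add: weighted_martingale_1_0)
  then show "a \<le> weighted_martingale_max 1 0 (2 ^ Suc j) \<omega>" using weighted_martingale_le_max[of "2 * i" "2 ^ Suc j" 1 0 \<omega>] i by simp
qed auto

text \<open>On regular paths, the \<open>p\<close>-th power of the supremum of
  \<open>|martingale_part|\<close> over dyadic times. The dyadic grids are unrelated to the steps of
  the scheme, and nesting makes this a monotone limit.\<close>

definition martingale_sup :: "real \<Rightarrow> 'a \<Rightarrow> ennreal" where
  "martingale_sup p \<omega> = (SUP j. ennreal (weighted_martingale_max 1 0 (2 ^ j) \<omega> powr p))"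

lemma moment_martingale_sup:
  assumes p: "p > 0"
  shows "(\<integral>\<^sup>+\<omega>. martingale_sup p \<omega> \<partial>completion M) \<le> ennreal (moment_const p) * (\<integral>\<^sup>+\<omega>. ennreal ((\<gamma>\<^sup>2 * deriv_energy \<omega>) powr (p / 2)) \<partial>completion M)"
proof -
  have "(\<integral>\<^sup>+\<omega>. martingale_sup p \<omega> \<partial>completion M) = (SUP j. \<integral>\<^sup>+\<omega>. ennreal (weighted_martingale_max 1 0 (2 ^ j) \<omega> powr p) \<partial>completion M)"
    unfolding martingale_sup_def
  proof (rule nn_integral_monotone_convergence_SUP)
    show "incseq (\<lambda>j \<omega>. ennreal (weighted_martingale_max 1 0 (2 ^ j) \<omega> powr p))"
      by (rule incseq_SucI) (use p in \<open>auto simp: le_fun_def intro!: ennreal_leI powr_mono2 weighted_martingale_max_nonneg weighted_martingale_max_dyadic_mono simp del: power_Suc\<close>)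
    show "(\<lambda>\<omega>. ennreal (weighted_martingale_max 1 0 (2 ^ j) \<omega> powr p)) \<in> borel_measurable (completion M)" for j
      using weighted_martingale_max_measurable[of "2 ^ j" 1 0] by simp
  qed
  also have "\<dots> \<le> ennreal (moment_const p) * (\<integral>\<^sup>+\<omega>. ennreal ((\<gamma>\<^sup>2 * deriv_energy \<omega>) powr (p / 2)) \<partial>completion M)"
    by (rule SUP_least) (unfold weighted_martingale_max_def, rule moment_weighted_martingale, use p in auto)
  finally show ?thesis .
qed

lemma martingale_sup_measurable: "martingale_sup p \<in> borel_measurable (completion M)"
proof -
  have "(\<lambda>\<omega>. ennreal (weighted_martingale_max 1 0 (2 ^ j) \<omega> powr p)) \<in> borel_measurable (completion M)" for j
    using weighted_martingale_max_measurable[of "2 ^ j" 1 0] by simp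
  then show ?thesis unfolding martingale_sup_def[abs_def] by measurable
qed

text \<open>A continuous path attains its maximum, and dyadic times approximate the maximizer from
  the left. \<open>\<nu>\<close> is chosen for a fixed \<open>\<omega>\<close>; measurability rests
  on \<open>martingale_sup\<close>.\<close>

lemma exists_martingale_max:
  assumes g: "regular_path \<omega>" and p: "p > 0"
  obtains \<nu> where "0 \<le> \<nu>" "\<And>t. t \<in> {0..T} \<Longrightarrow> \<bar>martingale_part t \<omega>\<bar> \<le> \<nu>" "ennreal (\<nu> powr p) \<le> martingale_sup p \<omega>"
proof -
  have cN: "continuous_on {0..T} (\<lambda>t. \<bar>martingale_part t \<omega>\<bar>)" by (intro continuous_intros martingale_part_cont[OF g])
  obtain t where t: "t \<in> {0..T}" "\<And>u. u \<in> {0..T} \<Longrightarrow> \<bar>martingale_part u \<omega>\<bar> \<le> \<bar>martingale_part t \<omega>\<bar>"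
    using continuous_attains_sup[of "{0..T}" "\<lambda>t. \<bar>martingale_part t \<omega>\<bar>"] cN T_pos by (auto simp: not_less)
  define i where "i = (\<lambda>j::nat. nat \<lfloor>t / (T / 2 ^ j)\<rfloor>)"
  define \<tau> where "\<tau> = (\<lambda>j. real (i j) * (T / 2 ^ j))"
  have i: "real (i j) \<le> t / (T / 2 ^ j)" "t / (T / 2 ^ j) < real (i j) + 1" for j
  proof -
    have "0 \<le> t / (T / 2 ^ j)" using t(1) T_pos by simp
    then have "real (i j) = of_int \<lfloor>t / (T / 2 ^ j)\<rfloor>" by (simp add: i_def)
    then show "real (i j) \<le> t / (T / 2 ^ j)" "t / (T / 2 ^ j) < real (i j) + 1" by linarith+
  qed
  have \<tau>: "\<tau> j \<le> t" "t - T / 2 ^ j \<le> \<tau> j" "0 \<le> \<tau> j" for j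
  proof -
    have d: "T / 2 ^ j > 0" using T_pos by simp
    have "\<And>D::real. D > 0 \<Longrightarrow> t / D * D = t" by simp
    note cancel = this[OF d]
    have "real (i j) * (T / 2 ^ j) \<le> t / (T / 2 ^ j) * (T / 2 ^ j)" using i(1) d by (intro mult_right_mono) auto
    then show "\<tau> j \<le> t" unfolding cancel \<tau>_def .
    have "t / (T / 2 ^ j) * (T / 2 ^ j) \<le> (real (i j) + 1) * (T / 2 ^ j)"
      using i(2)[of j] d by (intro mult_right_mono) auto
    then show "t - T / 2 ^ j \<le> \<tau> j" unfolding cancel \<tau>_def distrib_right by linarith
    show "0 \<le> \<tau> j" using T_pos by (simp add: \<tau>_def)
  qed
  have "(\<lambda>j. t - T * (1 / 2) ^ j) \<longlonglongrightarrow> t - T * 0"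
    by (intro tendsto_intros LIMSEQ_power_zero) auto
  then have "(\<lambda>j. t - T / 2 ^ j) \<longlonglongrightarrow> t" by (simp add: power_one_over)
  then have "\<tau> \<longlonglongrightarrow> t" by (rule tendsto_sandwich[rotated 2, OF _ tendsto_const]) (use \<tau> in auto)
  then have "(\<lambda>j. \<bar>martingale_part (\<tau> j) \<omega>\<bar>) \<longlonglongrightarrow> \<bar>martingale_part t \<omega>\<bar>"
    by (rule continuous_on_tendsto_compose[OF cN _ t(1)]) (use \<tau> t in \<open>auto intro!: always_eventually order_trans[OF \<tau>(1)]\<close>)
  then have "(\<lambda>j. \<bar>martingale_part (\<tau> j) \<omega>\<bar> powr p) \<longlonglongrightarrow> \<bar>martingale_part t \<omega>\<bar> powr p"
    using p by (intro tendsto_powr2 tendsto_const) auto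
  then have "(\<lambda>j. ennreal (\<bar>martingale_part (\<tau> j) \<omega>\<bar> powr p)) \<longlonglongrightarrow> ennreal (\<bar>martingale_part t \<omega>\<bar> powr p)" by (rule tendsto_ennrealI)
  moreover have "ennreal (\<bar>martingale_part (\<tau> j) \<omega>\<bar> powr p) \<le> martingale_sup p \<omega>" for j
  proof -
    have "t / (T / 2 ^ j) \<le> 2 ^ j" using t(1) T_pos by (simp add: field_simps)
    from order_trans[OF i(1) this] have ij: "i j \<le> 2 ^ j" by simp
    have "martingale_part (\<tau> j) \<omega> = weighted_martingale 1 0 (2 ^ j) (i j) \<omega>" by (simp add: weighted_martingale_1_0 martingale_part_0[OF g] \<tau>_def)
    then have "\<bar>martingale_part (\<tau> j) \<omega>\<bar> \<le> weighted_martingale_max 1 0 (2 ^ j) \<omega>" using weighted_martingale_le_max[OF ij] by simp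
    then have "ennreal (\<bar>martingale_part (\<tau> j) \<omega>\<bar> powr p) \<le> ennreal (weighted_martingale_max 1 0 (2 ^ j) \<omega> powr p)"
      using p by (intro ennreal_leI powr_mono2) auto
    also have "\<dots> \<le> martingale_sup p \<omega>" unfolding martingale_sup_def by (rule SUP_upper) simp
    finally show ?thesis .
  qed
  ultimately have "ennreal (\<bar>martingale_part t \<omega>\<bar> powr p) \<le> martingale_sup p \<omega>"
    using LIMSEQ_le_const2[of "\<lambda>j. ennreal (\<bar>martingale_part (\<tau> j) \<omega>\<bar> powr p)"] by blast
  then show ?thesis using t(2) by (intro that[of "\<bar>martingale_part t \<omega>\<bar>"]) auto
qed

lemma strong_error_bound:
  assumes p: "p > 0" and K: "K > 0"
    and osl: "\<And>x x'. 0 < x \<Longrightarrow> x \<le> x' \<Longrightarrow> L x' - L x \<le> K * (x' - x)"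
    and unb: "\<And>C. \<exists>x. 0 < x \<and> x < 1 \<and> L x > C"
    and fin_B: "(\<integral>\<^sup>+\<omega>. ennreal (drift_variation \<omega> powr p) \<partial>completion M) < \<infinity>"
    and fin_Z: "(\<integral>\<^sup>+\<omega>. ennreal (deriv_energy \<omega> powr (p / 2)) \<partial>completion M) < \<infinity>"
  shows "\<exists>C>0. \<forall>n::nat. n \<ge> 1 \<and> K < real n / (2 * T) \<longrightarrow>
     (\<integral>\<^sup>+\<omega>. (SUP t\<in>{0..T}. ennreal (\<bar>implicit_scheme L \<gamma> y T n (\<lambda>s. W s \<omega>) t - Y t \<omega>\<bar> powr p)) \<partial>M)
       \<le> ennreal ((C * (T / real n)) powr p)"
proof -
  \<comment> \<open>The pathwise bound has the coefficients \<open>6 * exp (2 * K * T)\<close> at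
    the weighted maximum, \<open>3 * exp (2 * K * T) + 2\<close> at the drift variation and 4 at
    \<open>\<nu>\<close>; \<open>C1\<close> dominates all three.\<close>
  define C1 where "C1 = 6 * exp (2 * K * T) + 4"
  define IZ where "IZ = (\<integral>\<^sup>+\<omega>. ennreal ((\<gamma>\<^sup>2 * deriv_energy \<omega>) powr (p / 2)) \<partial>completion M)"
  \<comment> \<open>The last summand occurs twice: the supremum of the martingale and the maximum of
    the weighted one satisfy the same moment bound.\<close>
  define V where "V = (\<integral>\<^sup>+\<omega>. ennreal (drift_variation \<omega> powr p) \<partial>completion M) + ennreal (moment_const p) * IZ + ennreal (moment_const p) * IZ"
  have "IZ = ennreal ((\<gamma>\<^sup>2) powr (p / 2)) * (\<integral>\<^sup>+\<omega>. ennreal (deriv_energy \<omega> powr (p / 2)) \<partial>completion M)"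
    unfolding IZ_def using deriv_energy_measurable
    by (subst nn_integral_cmult[symmetric]) (auto simp: powr_mult deriv_energy_nonneg ennreal_mult)
  then have "V < \<infinity>" using fin_B fin_Z by (auto simp: V_def ennreal_mult_less_top)
  then obtain v where v: "V = ennreal v" "0 \<le> v" by (cases V) auto
  \<comment> \<open>The 3 is the price of splitting the power of a sum of three terms, and
    \<open>v + 1\<close> in place of \<open>v\<close> keeps \<open>C\<close> positive.\<close>
  define C where "C = 3 * C1 * (v + 1) powr (1 / p)"
  have C1: "C1 > 0" by (simp add: C1_def add_pos_pos)
  have C: "C > 0" using C1 v(2) by (simp add: C_def)
  have cL: "continuous_on {0<..} L" using L_deriv by (auto intro!: continuous_at_imp_continuous_on DERIV_isCont)
  show ?thesis
  proof (intro exI[of _ C] conjI allI impI C)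
    fix n :: nat assume n: "n \<ge> 1 \<and> K < real n / (2 * T)"
    define h where "h = T / real n"
    have h: "h > 0" using n T_pos by (simp add: h_def)
    have Kh: "K * h < 1 / 2" using n T_pos by (simp add: h_def field_simps)
    have n1: "n \<ge> 1" using n by simp
    let ?E = "\<lambda>\<omega> t. \<bar>implicit_scheme L \<gamma> y T n (\<lambda>s. W s \<omega>) t - Y t \<omega>\<bar>"
    have "AE \<omega> in completion M. (SUP t\<in>{0..T}. ennreal (?E \<omega> t powr p))
        \<le> ennreal ((3 * C1 * h) powr p) * (ennreal (drift_variation \<omega> powr p) + martingale_sup p \<omega> + ennreal (weighted_martingale_max 0 1 n \<omega> powr p))"
      using AE_regular_path
    proof eventually_elim
      case (elim \<omega>)
      obtain \<nu> where \<nu>: "0 \<le> \<nu>" "\<And>t. t \<in> {0..T} \<Longrightarrow> \<bar>martingale_part t \<omega>\<bar> \<le> \<nu>" "ennreal (\<nu> powr p) \<le> martingale_sup p \<omega>"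
        using exists_martingale_max[OF elim p] by blast
      define x where "x = weighted_martingale_max 0 1 n \<omega>"
      have x0: "0 \<le> x" unfolding x_def by (rule weighted_martingale_max_nonneg)
      show ?case
      proof (rule SUP_least)
        fix t assume t: "t \<in> {0..T}"
        have "?E \<omega> t \<le> 3 * (exp (2 * K * T) * (2 * (h * x) + h * drift_variation \<omega>)) + 2 * (h * (drift_variation \<omega> + 2 * \<nu>))"
          unfolding drift_variation_def h_def
        proof (rule implicit_scheme_error[where N="\<lambda>t. martingale_part t \<omega>" and Y="\<lambda>t. Y t \<omega>"])
          show "\<exists>!z. z > 0 \<and> z = c + L z * (T / real n)" for c
            by (rule implicit_equation_ex1[OF cL h[unfolded h_def] Kh[unfolded h_def] osl unb])
          show "Y t \<omega> = y + integral {0..t} (\<lambda>u. L (Y u \<omega>)) + \<gamma> * (W t \<omega> - W 0 \<omega>)" if "t \<in> {0..T}" for t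
            using elim that unfolding regular_path_def by blast
          show "\<bar>\<Sum>k<i. T / real n * martingale_part (real k * (T / real n) + T / real n) \<omega>
             - integral {real k * (T / real n)..real k * (T / real n) + T / real n} (\<lambda>t. martingale_part t \<omega>)\<bar> \<le> T / real n * x" if "i \<le> n" for i
            unfolding weighted_martingale_0_1_scaled[OF n1] x_def abs_mult
            using weighted_martingale_le_max[OF that, of 0 1 \<omega>] T_pos by (simp add: divide_right_mono)
        qed (use T_pos n1 K Kh osl t \<nu>(2) Y_pos[OF elim] LY_cont[OF elim] generator_cont[OF elim] in \<open>auto simp: h_def martingale_part_def\<close>)
        also have "\<dots> \<le> (C1 * h) * (drift_variation \<omega> + \<nu> + x)"
        proof -
          define X' where "X' = exp (2 * K * T)"
          have X'0: "X' \<ge> 0" by (simp add: X'_def)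
          have nn: "0 \<le> X' * (h * drift_variation \<omega>)" "0 \<le> h * drift_variation \<omega>" "0 \<le> X' * (h * \<nu>)" "0 \<le> h * x"
            using X'0 h x0 \<nu>(1) drift_variation_nonneg by auto
          show ?thesis unfolding C1_def X'_def[symmetric] using nn by (simp add: algebra_simps)
        qed
        finally have "?E \<omega> t powr p \<le> ((C1 * h) * (drift_variation \<omega> + \<nu> + x)) powr p" using p by (intro powr_mono2) auto
        also have "\<dots> = (C1 * h) powr p * (drift_variation \<omega> + \<nu> + x) powr p"
          by (rule powr_mult)
        also have "\<dots> \<le> (C1 * h) powr p * (3 powr p * (drift_variation \<omega> powr p + \<nu> powr p + x powr p))"
          by (intro mult_left_mono add3_powr_le drift_variation_nonneg \<nu>(1) x0 p) auto
        also have "\<dots> = (3 * C1 * h) powr p * (drift_variation \<omega> powr p + \<nu> powr p + x powr p)"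
          using C1 h by (simp add: powr_mult)
        finally have "ennreal (?E \<omega> t powr p) \<le> ennreal ((3 * C1 * h) powr p) * (ennreal (drift_variation \<omega> powr p) + ennreal (\<nu> powr p) + ennreal (x powr p))"
          by (simp add: ennreal_mult[symmetric] ennreal_plus[symmetric] ennreal_leI del: ennreal_plus)
        also have "\<dots> \<le> ennreal ((3 * C1 * h) powr p) * (ennreal (drift_variation \<omega> powr p) + martingale_sup p \<omega> + ennreal (x powr p))"
          by (intro mult_left_mono add_mono \<nu>(3)) auto
        finally show "ennreal (?E \<omega> t powr p) \<le> ennreal ((3 * C1 * h) powr p) * (ennreal (drift_variation \<omega> powr p) + martingale_sup p \<omega> + ennreal (weighted_martingale_max 0 1 n \<omega> powr p))"
          by (simp only: x_def)
      qed
    qed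
    \<comment> \<open>The nonnegative integral is monotone for arbitrary functions, so measurability
      is required of the majorant, not of the supremum over \<open>t\<close>.\<close>
    then have "(\<integral>\<^sup>+\<omega>. (SUP t\<in>{0..T}. ennreal (?E \<omega> t powr p)) \<partial>completion M)
      \<le> (\<integral>\<^sup>+\<omega>. ennreal ((3 * C1 * h) powr p) * (ennreal (drift_variation \<omega> powr p) + martingale_sup p \<omega> + ennreal (weighted_martingale_max 0 1 n \<omega> powr p)) \<partial>completion M)"
      by (rule nn_integral_mono_AE)
    also have "\<dots> = ennreal ((3 * C1 * h) powr p) * ((\<integral>\<^sup>+\<omega>. ennreal (drift_variation \<omega> powr p) \<partial>completion M)
       + (\<integral>\<^sup>+\<omega>. martingale_sup p \<omega> \<partial>completion M) + (\<integral>\<^sup>+\<omega>. ennreal (weighted_martingale_max 0 1 n \<omega> powr p) \<partial>completion M))"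
    proof -
      note [measurable] = drift_variation_measurable martingale_sup_measurable[of p] weighted_martingale_max_measurable[OF n1, of 0 1]
      show ?thesis by (simp add: nn_integral_cmult nn_integral_add)
    qed
    also have "\<dots> \<le> ennreal ((3 * C1 * h) powr p) * V"
      unfolding V_def IZ_def
      by (intro mult_left_mono add_mono order_refl moment_martingale_sup[OF p])
        (unfold weighted_martingale_max_def, rule moment_weighted_martingale[OF n1 p], auto)
    also have "\<dots> = ennreal ((3 * C1 * h) powr p * v)" using v by (simp add: ennreal_mult)
    also have "\<dots> \<le> ennreal ((C * h) powr p)"
    proof (rule ennreal_leI)
      have "(3 * C1 * h) powr p * v \<le> (3 * C1 * h) powr p * (v + 1)" by (intro mult_left_mono) auto
      also have "v + 1 = ((v + 1) powr (1 / p)) powr p" using p v(2) by (simp add: powr_powr)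
      also have "(3 * C1 * h) powr p * ((v + 1) powr (1 / p)) powr p = (3 * C1 * h * (v + 1) powr (1 / p)) powr p"
        by (rule powr_mult[symmetric])
      also have "3 * C1 * h * (v + 1) powr (1 / p) = C * h" by (simp add: C_def)
      finally show "(3 * C1 * h) powr p * v \<le> (C * h) powr p" .
    qed
    finally show "(\<integral>\<^sup>+\<omega>. (SUP t\<in>{0..T}. ennreal (?E \<omega> t powr p)) \<partial>M) \<le> ennreal ((C * (T / real n)) powr p)"
      by (simp add: nn_integral_completion h_def)
  qed
qed

end

theorem theorem2p1:
  fixes M :: "'a measure" and W Y :: "real \<Rightarrow> 'a \<Rightarrow> real" and L :: "real \<Rightarrow> real"
    and T \<gamma> y \<kappa> d p A L'A :: real
  assumes "standard_brownian_motion M W"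
    and "T > 0" and "\<gamma> \<noteq> 0" and "y > 0"
    and "C2_on {0<..} L"
    and "\<kappa> > 0" and "\<And>x x'. 0 < x \<Longrightarrow> x \<le> x' \<Longrightarrow> L x' - L x \<le> \<kappa> * (x' - x)"
    and "d > 0" and "filterlim (feller_v L \<gamma> d) at_top (at_right 0)"
    and "strong_solution M W L \<gamma> y T Y"
    and "p > 1"
    and "(\<integral>\<^sup>+\<omega>. ennreal_powr
            (\<integral>\<^sup>+u\<in>{0..T}. ennreal \<bar>deriv L (Y u \<omega>) * L (Y u \<omega>)
                                + \<gamma>\<^sup>2 / 2 * deriv (deriv L) (Y u \<omega>)\<bar> \<partial>lborel) p \<partial>M) < \<infinity>"
    and "(\<integral>\<^sup>+\<omega>. ennreal_powr
            (\<integral>\<^sup>+u\<in>{0..T}. ennreal ((deriv L (Y u \<omega>))\<^sup>2) \<partial>lborel) (p / 2) \<partial>M) < \<infinity>"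
    and "A > 0" and "L'A > 0"
    and "antimono_on {0<..<A} L"
    and "\<And>x. x > A \<Longrightarrow> \<bar>deriv L x\<bar> \<le> L'A"
  shows "\<exists>K>0. \<forall>n::nat. n \<ge> 1 \<and> L'A < real n / (2 * T) \<longrightarrow>
           ennreal_powr
             (\<integral>\<^sup>+\<omega>. (SUP t\<in>{0..T}.
                 ennreal (\<bar>implicit_scheme L \<gamma> y T n (\<lambda>s. W s \<omega>) t - Y t \<omega>\<bar> powr p)) \<partial>M)
             (1 / p)
           \<le> ennreal (K * (T / real n))"
proof -
  \<comment> \<open>Outside the half-line the derivatives are arbitrary and need not be Borel functions.\<close>
  define L1 where "L1 = (\<lambda>x. if x > 0 then deriv L x else 0)"
  define L2 where "L2 = (\<lambda>x. if x > 0 then deriv (deriv L) x else 0)"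
  have C2: "\<And>x. x > 0 \<Longrightarrow> L differentiable (at x)" "\<And>x. x > 0 \<Longrightarrow> deriv L differentiable (at x)"
    "continuous_on {0<..} (deriv (deriv L))"
    using assms(5) by (auto simp: C2_on_def)
  have dL: "(L has_real_derivative deriv L x) (at x)" if "x > 0" for x
    using C2(1)[OF that] by (metis DERIV_imp_deriv real_differentiable_def)
  have dL1: "(deriv L has_real_derivative deriv (deriv L) x) (at x)" if "x > 0" for x
    using C2(2)[OF that] by (metis DERIV_imp_deriv real_differentiable_def)
  have c1: "continuous_on {0<..} (deriv L)" using dL1 by (auto intro!: continuous_at_imp_continuous_on DERIV_isCont)
  have cL: "continuous_on {0<..} L" using dL by (auto intro!: continuous_at_imp_continuous_on DERIV_isCont)
  interpret BM: standard_brownian_motion M W by fact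
  note sol = assms(10)[unfolded strong_solution_def]
  interpret additive_sde M W Y L L1 L2 \<gamma> y T
  proof (intro additive_sde.intro additive_sde_axioms.intro assms(1,2))
    show "Y t \<in> borel_measurable (augmented_filtration M W t)" if "t \<in> {0..T}" for t using sol that by blast
    show "L1 \<in> borel_measurable borel" "L2 \<in> borel_measurable borel"
      unfolding L1_def L2_def by (intro borel_measurable_clip c1 C2(3))+
    show "(L has_real_derivative L1 x) (at x)" if "x > 0" for x using dL[OF that] that by (simp add: L1_def)
    show "(L1 has_real_derivative L2 x) (at x)" if "x > 0" for x
    proof (rule has_field_derivative_transform_within_open[of "deriv L" _ _ "{0<..}"])
      show "(deriv L has_real_derivative L2 x) (at x)" using dL1[OF that] that by (simp add: L2_def)
    qed (use that in \<open>auto simp: L1_def\<close>)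
    show "continuous_on {0<..} L2" using C2(3) by (subst continuous_on_cong[OF refl]) (auto simp: L2_def)
    have "AE \<omega> in M. continuous_on {0..} (\<lambda>t. W t \<omega>)" by (rule BM.W_continuous)
    moreover have "AE \<omega> in M. continuous_on {0..T} (\<lambda>t. Y t \<omega>) \<and>
        (\<forall>t\<in>{0..T}. Y t \<omega> > 0 \<and> Y t \<omega> = y + (LBINT s=0..t. L (Y s \<omega>)) + \<gamma> * (W t \<omega> - W 0 \<omega>))"
      using sol by blast
    ultimately show "AE \<omega> in M. continuous_on {0..T} (\<lambda>t. W t \<omega>) \<and> continuous_on {0..T} (\<lambda>t. Y t \<omega>) \<and>
       (\<forall>t\<in>{0..T}. 0 < Y t \<omega> \<and> Y t \<omega> = y + integral {0..t} (\<lambda>s. L (Y s \<omega>)) + \<gamma> * (W t \<omega> - W 0 \<omega>))"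
    proof eventually_elim
      case (elim \<omega>)
      have LY: "continuous_on {0..T} (\<lambda>t. L (Y t \<omega>))"
        using elim(2) by (intro continuous_on_compose2[OF cL]) auto
      have "(LBINT s=0..t. L (Y s \<omega>)) = integral {0..t} (\<lambda>s. L (Y s \<omega>))" if "t \<in> {0..T}" for t
      proof -
        \<comment> \<open>Continuity of \<open>L (Y)\<close> identifies the Lebesgue integral in the
          notion of solution with the gauge integral of the locale.\<close>
        have "set_integrable lborel {0..t} (\<lambda>s. L (Y s \<omega>))"
          by (intro borel_integrable_atLeastAtMost' continuous_on_subset[OF LY]) (use that in auto)
        then show ?thesis using interval_integral_eq_integral[of 0 t "\<lambda>s. L (Y s \<omega>)"] that by (simp add: zero_ereal_def)
      qed
      moreover have "continuous_on {0..T} (\<lambda>t. W t \<omega>)" by (rule continuous_on_subset[OF elim(1)]) auto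
      ultimately show ?case using elim(2) by (metis (no_types, lifting))
    qed
  qed
  \<comment> \<open>On regular paths the integrand is continuous, so the extended integral of the
    hypothesis is finite and equals \<open>drift_variation\<close>; its \<open>ennreal_powr\<close>
    is then an ordinary power.\<close>
  have fB: "(\<integral>\<^sup>+\<omega>. ennreal (drift_variation \<omega> powr p) \<partial>completion M) < \<infinity>"
  proof -
    have "(\<integral>\<^sup>+\<omega>. ennreal (drift_variation \<omega> powr p) \<partial>completion M) = (\<integral>\<^sup>+\<omega>. ennreal_powr
            (\<integral>\<^sup>+u\<in>{0..T}. ennreal \<bar>deriv L (Y u \<omega>) * L (Y u \<omega>)
                                + \<gamma>\<^sup>2 / 2 * deriv (deriv L) (Y u \<omega>)\<bar> \<partial>lborel) p \<partial>completion M)"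
    proof (rule nn_integral_cong_AE, use AE_regular_path in eventually_elim)
      case (elim \<omega>)
      have "continuous_on {0..T} (\<lambda>u. \<bar>generator \<omega> u\<bar>)" by (intro continuous_intros generator_cont[OF elim])
      then have "(\<integral>\<^sup>+u\<in>{0..T}. ennreal \<bar>generator \<omega> u\<bar> \<partial>lborel) = ennreal (drift_variation \<omega>)"
        unfolding drift_variation_def by (rule nn_integral_continuous_nonneg) simp
      moreover have "(\<integral>\<^sup>+u\<in>{0..T}. ennreal \<bar>generator \<omega> u\<bar> \<partial>lborel) = (\<integral>\<^sup>+u\<in>{0..T}. ennreal \<bar>deriv L (Y u \<omega>) * L (Y u \<omega>)
                                + \<gamma>\<^sup>2 / 2 * deriv (deriv L) (Y u \<omega>)\<bar> \<partial>lborel)"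
      proof (rule nn_integral_cong)
        fix u
        have "generator \<omega> u = deriv L (Y u \<omega>) * L (Y u \<omega>) + \<gamma>\<^sup>2 / 2 * deriv (deriv L) (Y u \<omega>)" if "u \<in> {0..T}"
          unfolding generator_def using Y_pos[OF elim that] by (simp add: L1_def L2_def)
        then show "ennreal \<bar>generator \<omega> u\<bar> * indicator {0..T} u
          = ennreal \<bar>deriv L (Y u \<omega>) * L (Y u \<omega>) + \<gamma>\<^sup>2 / 2 * deriv (deriv L) (Y u \<omega>)\<bar> * indicator {0..T} u"
          by (cases "u \<in> {0..T}") auto
      qed
      ultimately show ?case by (simp add: ennreal_powr_ennreal drift_variation_nonneg)
    qed
    then show ?thesis using assms(12) by (simp add: nn_integral_completion)
  qed
  have fZ: "(\<integral>\<^sup>+\<omega>. ennreal (deriv_energy \<omega> powr (p / 2)) \<partial>completion M) < \<infinity>"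
  proof -
    have "(\<integral>\<^sup>+\<omega>. ennreal (deriv_energy \<omega> powr (p / 2)) \<partial>completion M) = (\<integral>\<^sup>+\<omega>. ennreal_powr
            (\<integral>\<^sup>+u\<in>{0..T}. ennreal ((deriv L (Y u \<omega>))\<^sup>2) \<partial>lborel) (p / 2) \<partial>completion M)"
    proof (rule nn_integral_cong_AE, use AE_regular_path in eventually_elim)
      case (elim \<omega>)
      have "continuous_on {0..T} (\<lambda>u. (L1 (Y u \<omega>))\<^sup>2)" by (intro continuous_intros L1Y_cont[OF elim])
      then have "(\<integral>\<^sup>+u\<in>{0..T}. ennreal ((L1 (Y u \<omega>))\<^sup>2) \<partial>lborel) = ennreal (deriv_energy \<omega>)"
        unfolding deriv_energy_def by (rule nn_integral_continuous_nonneg) simp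
      moreover have "(\<integral>\<^sup>+u\<in>{0..T}. ennreal ((L1 (Y u \<omega>))\<^sup>2) \<partial>lborel) = (\<integral>\<^sup>+u\<in>{0..T}. ennreal ((deriv L (Y u \<omega>))\<^sup>2) \<partial>lborel)"
        by (rule nn_integral_cong) (use Y_pos[OF elim] in \<open>auto simp: L1_def split: split_indicator\<close>)
      ultimately show ?case by (simp add: ennreal_powr_ennreal deriv_energy_nonneg)
    qed
    then show ?thesis using assms(13) by (simp add: nn_integral_completion)
  qed
  have p: "p > 0" using assms(11) by simp
  \<comment> \<open>The step size condition is phrased with \<open>L'A\<close>, so the one-sided
    bound has to be available with this very constant.\<close>
  have osl: "L x' - L x \<le> L'A * (x' - x)" if "0 < x" "x \<le> x'" for x x'
    by (rule one_sided_lipschitz[OF dL c1 assms(14,15,16) _ that]) (use assms(17) in \<open>auto simp: abs_le_iff\<close>)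
  have unb: "\<exists>x. 0 < x \<and> x < 1 \<and> L x > C" for C
    by (rule feller_imp_unbounded_at_0[OF cL assms(8,9)])
  from strong_error_bound[OF p assms(15) osl unb fB fZ] obtain C where C: "C > 0"
    and le: "\<And>n::nat. n \<ge> 1 \<and> L'A < real n / (2 * T) \<Longrightarrow>
     (\<integral>\<^sup>+\<omega>. (SUP t\<in>{0..T}. ennreal (\<bar>implicit_scheme L \<gamma> y T n (\<lambda>s. W s \<omega>) t - Y t \<omega>\<bar> powr p)) \<partial>M)
       \<le> ennreal ((C * (T / real n)) powr p)" by blast
  show ?thesis
  proof (intro exI[of _ C] conjI allI impI C)
    fix n :: nat assume n: "n \<ge> 1 \<and> L'A < real n / (2 * T)"
    have "((C * (T / real n)) powr p) powr (1 / p) = C * (T / real n)"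
      using p C assms(2) by (simp add: powr_powr)
    then show "ennreal_powr
             (\<integral>\<^sup>+\<omega>. (SUP t\<in>{0..T}.
                 ennreal (\<bar>implicit_scheme L \<gamma> y T n (\<lambda>s. W s \<omega>) t - Y t \<omega>\<bar> powr p)) \<partial>M)
             (1 / p)
           \<le> ennreal (C * (T / real n))"
      using ennreal_powr_le[OF le[OF n], of "1 / p"] p by simp
  qed
qed

end
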